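(* Let $W:\mathbb{R}\to\mathbb{R}$ be even and convex, with $\lim_{t\to\infty}\frac{W(t)}{t}=\lim_{t\to\infty}\frac{W(-t)}{t}=W^\infty$ for some real number $W^\infty>0$. Let $f\in W^{1,1}(\mathbb{T})$ and $h>0$. Then there exists a unique weak solution $u\in W^{1,1}(\mathbb{T})$ (in particular, $u$ has an integrable derivative) of the equation $$\frac1h(u-f)=(W_p(u_x))_x\quad\text{in }\mathbb{T}.$$ Moreover, if $\Phi:\mathbb{R}\to\mathbb{R}$ is a smooth convex function with $\lim_{|x|\to\infty}\Phi(x)/|x|=\infty$ and $\int_{\mathbb{T}}\Phi(f_x)\,dx<\infty$ (such a function exists because $f_x\in L^1(\mathbb{T})$), then $$\int_{\mathbb{T}}\Phi(u_x)\,dx\le\int_{\mathbb{T}}\Phi(f_x)\,dx.$$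
   Context: $\mathbb{T}$ is the flat one-dimensional torus, identified with $[0,1)$ (periodic boundary conditions). $\partial W(p)$ denotes the subdifferential of the convex function $W$ at $p$. A function $u\in W^{1,1}(\mathbb{T})$ is called a weak solution of $\frac1h(u-f)=(W_p(u_x))_x$ in $\mathbb{T}$ if there exists $\xi\in L^\infty(\mathbb{T})$ with $\xi_x\in L^2(\mathbb{T})$ such that $\xi(x)\in\partial W(u_x(x))$ for a.e. $x\in\mathbb{T}$ and $$\int_{\mathbb{T}}\Big(\frac1h(u-f)\varphi+\xi\varphi_x\Big)\,dx=0\quad\text{for all }\varphi\in C^\infty(\mathbb{T}).$$ Uniqueness refers to the function $u$. *)

theory Defs
  imports "HOL-Analysis.Analysis"
begin

text \<open>
  Functions on the one-dimensional torus are represented by functions on the reals, of which only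
  the values on the fundamental domain [0,1) matter; two of them are identified if they agree
  almost everywhere there. Periodicity enters only through the test functions.
\<close>

abbreviation torus :: "real measure" where
  "torus \<equiv> lebesgue_on {0..<1}"

definition smooth :: "(real \<Rightarrow> real) \<Rightarrow> bool" where
  "smooth \<phi> \<longleftrightarrow> (\<forall>n x. (deriv ^^ n) \<phi> differentiable at x)"

definition torus_test_functions :: "(real \<Rightarrow> real) set" where
  "torus_test_functions = {\<phi>. smooth \<phi> \<and> (\<forall>x. \<phi> (x + 1) = \<phi> x)}"

definition has_weak_deriv :: "(real \<Rightarrow> real) \<Rightarrow> (real \<Rightarrow> real) \<Rightarrow> bool" where
  "has_weak_deriv u v \<longleftrightarrow> integrable torus u \<and> integrable torus v \<and>
     (\<forall>\<phi>\<in>torus_test_functions. (\<integral>x. u x * deriv \<phi> x \<partial>torus) = - (\<integral>x. v x * \<phi> x \<partial>torus))"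

text \<open>The Sobolev space $W^{1,1}$ of the torus.\<close>

definition W11 :: "(real \<Rightarrow> real) set" where
  "W11 = {u. \<exists>v. has_weak_deriv u v}"

definition L_infinity :: "(real \<Rightarrow> real) set" where
  "L_infinity = {\<xi>. \<xi> \<in> borel_measurable torus \<and> (\<exists>C. AE x in torus. \<bar>\<xi> x\<bar> \<le> C)}"

definition L_2 :: "(real \<Rightarrow> real) set" where
  "L_2 = {g. g \<in> borel_measurable torus \<and> integrable torus (\<lambda>x. (g x)\<^sup>2)}"

definition subdifferential :: "(real \<Rightarrow> real) \<Rightarrow> real \<Rightarrow> real set" where
  "subdifferential W p = {z. \<forall>q. W q \<ge> W p + z * (q - p)}"

definition weak_solution ::
    "(real \<Rightarrow> real) \<Rightarrow> (real \<Rightarrow> real) \<Rightarrow> real \<Rightarrow> (real \<Rightarrow> real) \<Rightarrow> bool" where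
  "weak_solution W f h u \<longleftrightarrow> u \<in> W11 \<and>
     (\<exists>ux \<xi> \<xi>x. has_weak_deriv u ux \<and>
        \<xi> \<in> L_infinity \<and> has_weak_deriv \<xi> \<xi>x \<and> \<xi>x \<in> L_2 \<and>
        (AE x in torus. \<xi> x \<in> subdifferential W (ux x)) \<and>
        (\<forall>\<phi>\<in>torus_test_functions.
           (\<integral>x. (1 / h * (u x - f x) * \<phi> x + \<xi> x * deriv \<phi> x) \<partial>torus) = 0))"

end

theory Submission
  imports Defs
begin

text \<open>
  Write \<open>g = f\<^sub>x\<close>, \<open>p = u\<^sub>x\<close> and let \<open>\<xi>\<close> be the flux. Since \<open>u = f + h \<xi>\<^sub>x\<close>, differentiating once
  turns the equation into the scalar dual problem
  \<open>- h \<xi>\<^sub>x\<^sub>x + p = g\<close>, \<open>\<xi> \<in> \<partial>W(p)\<close>: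
  an elliptic equation for \<open>\<xi>\<close> with the monotone nonlinearity \<open>(\<partial>W)\<^sup>-\<^sup>1\<close> and a right-hand
  side that is merely integrable. A solution \<open>p\<close> which is a function, and not just a measure, is
  exactly what makes \<open>u\<close> a member of \<open>W\<^sup>1\<^sup>,\<^sup>1\<close>.

  Everything rests on one inequality, lemma \<open>integral_second_deriv_mono_le_0\<close>: for a periodic \<open>w\<close>
  and a nondecreasing \<open>m\<close> one has \<open>\<integral> w\<^sub>x\<^sub>x m(w) \<le> 0\<close>. Applied to solutions of the dual problem with
  \<open>(\<partial>W)\<^sup>-\<^sup>1\<close> replaced by its Yosida approximation, plus a small multiple of \<open>\<xi>\<close>, it yields

  \<^item> with \<open>m\<close> close to a sign function, that \<open>g \<mapsto> p\<close> does not increase \<open>L\<^sup>1\<close> distances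
    (lemma \<open>regularized_contraction\<close>);
  \<^item> with \<open>m\<close> the identity, that the pairs \<open>(p, \<xi>)\<close> are a Tikhonov regularization: their square norms
    increase as the parameter decreases, and the increase controls the square of their distance
    (lemma \<open>regularized_tikhonov\<close>);
  \<^item> with \<open>m = \<psi>' \<circ> (\<partial>W)\<^sup>-\<^sup>1\<close>, the estimate \<open>\<integral> \<psi>(p) \<le> \<integral> \<psi>(g)\<close> for convex \<open>\<psi>\<close>, up to an error that
    vanishes with the parameter (lemma \<open>slope_convex_estimate\<close>).

  For bounded \<open>g\<close> the second item makes the approximations of \<open>p\<close> a Cauchy family, strongly and without
  passing to subsequences; the first extends this to all integrable \<open>g\<close>, because bounded functions are
  dense. In the limit \<open>\<xi> \<in> \<partial>W(p)\<close> survives since the graph of the subdifferential is closed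
  (lemma \<open>dual_problem_solvable\<close>). The approximate problems are solved by a contraction argument in the
  space of continuous functions (lemma \<open>regularized_problem_solvable\<close>).

  Uniqueness is the usual monotonicity argument, once weak derivatives are known to be the same as
  derivatives of primitives (lemma \<open>has_weak_deriv_imp_primitive\<close>). The estimate for \<open>\<Phi>\<close>
  follows from the one for Lipschitz \<open>\<psi>\<close>, since \<open>\<Phi>\<close> is the pointwise limit of
  tangent extensions that lie below it.
\<close>

section \<open>Integration on the torus\<close>

text \<open>
  The integral is taken over the whole torus with a cut-off at \<open>x\<close>, so that linearity, \<open>L\<^sup>1\<close> bounds and
  Fubini's theorem apply to it directly.
\<close>

definition primitive :: "(real \<Rightarrow> real) \<Rightarrow> real \<Rightarrow> real" where
  "primitive r x = (\<integral>y. r y * indicator {0..x} y \<partial>torus)"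

lemma borel_measurable_torusI:
  fixes f :: "real \<Rightarrow> real"
  shows "f \<in> borel_measurable borel \<Longrightarrow> f \<in> borel_measurable torus"
  by (intro measurable_restrict_space1 measurable_completion) simp

lemma space_torus [simp]: "space torus = {0..<1}"
  by simp

lemma finite_measure_torus: "finite_measure torus"
  by (rule finite_measureI) (simp add: emeasure_restrict_space)

lemma sigma_finite_torus: "sigma_finite_measure torus"
  using finite_measure_torus by (rule finite_measure.axioms(1))

lemma measure_torus_space [simp]: "measure torus {0..<1} = 1"
  by (simp add: measure_restrict_space)

lemma integrable_const_torus [simp, intro]: "integrable torus (\<lambda>x. c::real)"
  by (rule finite_measure.integrable_const[OF finite_measure_torus])

lemma integral_const_torus [simp]: "(\<integral>x. (c::real) \<partial>torus) = c"
  using measure_torus_space by simp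

lemma borel_measurable_ident_torus [measurable]: "(\<lambda>x. x) \<in> borel_measurable torus"
  by (intro borel_measurable_torusI) simp



lemma integrable_torus_bounded:
  fixes w :: "real \<Rightarrow> real"
  assumes "w \<in> borel_measurable torus" "\<And>x. 0 \<le> x \<Longrightarrow> x < 1 \<Longrightarrow> \<bar>w x\<bar> \<le> C"
  shows "integrable torus w"
  by (rule finite_measure.integrable_const_bound[OF finite_measure_torus, of _ C])
     (use assms in \<open>auto intro!: AE_I2\<close>)

lemma continuous_measurable_torus:
  fixes m :: "real \<Rightarrow> real"
  assumes "continuous_on {0..1} m"
  shows "m \<in> borel_measurable torus"
  by (rule continuous_imp_measurable_on_sets_lebesgue)
     (use assms in \<open>auto intro: continuous_on_subset\<close>)

lemma continuous_bounded_unit_interval: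
  fixes m :: "real \<Rightarrow> real"
  assumes "continuous_on {0..1} m"
  obtains C where "C \<ge> 0" "\<And>x. x \<in> {0..1} \<Longrightarrow> \<bar>m x\<bar> \<le> C"
proof -
  have "bounded (m ` {0..1})"
    using assms compact_Icc compact_continuous_image compact_imp_bounded by blast
  then obtain C where C: "\<And>x. x \<in> {0..1} \<Longrightarrow> \<bar>m x\<bar> \<le> C"
    unfolding bounded_iff real_norm_def by blast
  show ?thesis
    by (rule that[of "max 0 C"]) (use C le_max_iff_disj in fastforce)+
qed

lemma integrable_continuous_torus:
  fixes m :: "real \<Rightarrow> real"
  assumes "continuous_on {0..1} m" shows "integrable torus m"
proof -
  obtain C where "\<And>x. x \<in> {0..1} \<Longrightarrow> \<bar>m x\<bar> \<le> C"
    using continuous_bounded_unit_interval[OF assms] by metis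
  then show ?thesis
    by (intro integrable_torus_bounded[of _ C] continuous_measurable_torus assms) auto
qed

lemma integrable_mult_bounded_torus:
  fixes r w :: "real \<Rightarrow> real"
  assumes r: "integrable torus r" and w: "w \<in> borel_measurable torus"
    and C: "\<And>x. 0 \<le> x \<Longrightarrow> x < 1 \<Longrightarrow> \<bar>w x\<bar> \<le> C"
  shows "integrable torus (\<lambda>x. r x * w x)"
proof (rule Bochner_Integration.integrable_bound)
  show "integrable torus (\<lambda>x. C * r x)" using r by simp
  show "(\<lambda>x. r x * w x) \<in> borel_measurable torus" using r w by measurable
  show "AE x in torus. norm (r x * w x) \<le> norm (C * r x)"
  proof (rule AE_I2)
    fix x assume "x \<in> space torus"
    then have "\<bar>w x\<bar> \<le> \<bar>C\<bar>" using C[of x] by auto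
    then show "norm (r x * w x) \<le> norm (C * r x)"
      by (simp add: abs_mult mult.commute[of "\<bar>r x\<bar>"] mult_right_mono)
  qed
qed

lemma integrable_mult_continuous_torus:
  fixes r m :: "real \<Rightarrow> real"
  assumes r: "integrable torus r" and m: "continuous_on {0..1} m"
  shows "integrable torus (\<lambda>x. r x * m x)"
proof -
  obtain C where "\<And>x. x \<in> {0..1} \<Longrightarrow> \<bar>m x\<bar> \<le> C"
    using continuous_bounded_unit_interval[OF m] by metis
  then show ?thesis
    by (intro integrable_mult_bounded_torus[of _ _ C] continuous_measurable_torus r m) auto
qed

lemma integrable_mult_indicator_torus:
  fixes r :: "real \<Rightarrow> real"
  assumes "integrable torus r"
  shows "integrable torus (\<lambda>y. r y * indicator {a..b} y)"
  by (rule integrable_mult_bounded_torus[where C=1])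
     (use assms in \<open>auto intro!: borel_measurable_torusI simp: indicator_def\<close>)

lemma torus_integrable_on:
  fixes r :: "real \<Rightarrow> real"
  assumes "integrable torus r" shows "r integrable_on {0..1}"
proof -
  have "r integrable_on {0..<1}"
    using assms by (intro integrable_on_lebesgue_on) auto
  then show ?thesis
    by (rule integrable_spike_set) (rule negligible_subset[of "{1::real}"]; force)+
qed

lemma torus_integral_Icc:
  fixes r :: "real \<Rightarrow> real"
  assumes r: "integrable torus r" and ab: "0 \<le> a" "b \<le> 1"
  shows "(\<integral>y. r y * indicator {a..b} y \<partial>torus) = integral {a..b} r"
proof -
  have "(\<integral>y. r y * indicator {a..b} y \<partial>torus) = integral {0..<1} (\<lambda>y. r y * indicator {a..b} y)"
    by (rule lebesgue_integral_eq_integral) (use integrable_mult_indicator_torus[OF r] in auto)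
  also have "\<dots> = integral {0..1} (\<lambda>y. r y * indicator {a..b} y)"
    by (rule integral_spike_set) (rule negligible_subset[of "{1::real}"]; force)+
  also have "\<dots> = integral {0..1} (\<lambda>y. if y \<in> {a..b} then r y else 0)"
    by (rule integral_cong) (auto simp: indicator_def)
  also have "\<dots> = integral {a..b} r"
    using ab by (simp only: integral_restrict_Int) (simp add: Int_absorb1)
  finally show ?thesis .
qed

lemma primitive_eq_integral:
  assumes "integrable torus r" "x \<le> 1"
  shows "primitive r x = integral {0..x} r"
  unfolding primitive_def using assms by (intro torus_integral_Icc) auto

lemma primitive_0 [simp]: "integrable torus r \<Longrightarrow> primitive r 0 = 0"
  by (simp add: primitive_eq_integral)

lemma primitive_1 [simp]: "primitive r 1 = (\<integral>x. r x \<partial>torus)"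
  unfolding primitive_def by (rule Bochner_Integration.integral_cong) auto

lemma continuous_on_primitive:
  assumes "integrable torus r" shows "continuous_on {0..1} (primitive r)"
proof -
  have "continuous_on {0..1} (\<lambda>x. integral {0..x} r)"
    by (rule indefinite_integral_continuous_1[OF torus_integrable_on[OF assms]])
  then show ?thesis
    by (rule continuous_on_eq) (use primitive_eq_integral[OF assms] in auto)
qed

lemma continuous_on_of_primitive:
  assumes "integrable torus v" "\<And>x. x \<in> {0..1} \<Longrightarrow> primitive v x = U x - U 0"
  shows "continuous_on {0..1} U"
proof (rule continuous_on_eq)
  show "continuous_on {0..1} (\<lambda>x. U 0 + primitive v x)"
    by (intro continuous_intros continuous_on_primitive assms)
qed (simp add: assms)

lemma primitive_add:
  assumes "integrable torus r" "integrable torus s"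
  shows "primitive (\<lambda>x. r x + s x) t = primitive r t + primitive s t"
  unfolding primitive_def
  by (simp add: distrib_right integrable_mult_indicator_torus assms)

lemma primitive_diff:
  assumes "integrable torus r" "integrable torus s"
  shows "primitive (\<lambda>x. r x - s x) t = primitive r t - primitive s t"
  unfolding primitive_def
  by (simp add: left_diff_distrib integrable_mult_indicator_torus assms)

lemma primitive_cmult: "primitive (\<lambda>x. c * r x) t = c * primitive r t"
  unfolding primitive_def by (simp add: mult.assoc)

lemma primitive_cdivide: "primitive (\<lambda>x. r x / c) t = primitive r t / c"
  using primitive_cmult[of "1/c" r t] by simp

lemma primitive_cong:
  assumes "\<And>x. 0 \<le> x \<Longrightarrow> x < 1 \<Longrightarrow> r x = s x"
  shows "primitive r t = primitive s t"
  unfolding primitive_def by (rule Bochner_Integration.integral_cong) (use assms in auto)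

lemma abs_primitive_le:
  assumes "integrable torus r"
  shows "\<bar>primitive r t\<bar> \<le> (\<integral>x. \<bar>r x\<bar> \<partial>torus)"
proof -
  have "\<bar>primitive r t\<bar> \<le> (\<integral>y. \<bar>r y * indicator {0..t} y\<bar> \<partial>torus)"
    unfolding primitive_def by (rule integral_abs_bound)
  also have "\<dots> \<le> (\<integral>x. \<bar>r x\<bar> \<partial>torus)"
    by (intro integral_mono integrable_abs integrable_mult_indicator_torus assms)
       (auto simp: indicator_def)
  finally show ?thesis .
qed

lemma integral_has_deriv_Icc:
  fixes M m :: "real \<Rightarrow> real"
  assumes "0 \<le> a" "a \<le> b" "b \<le> 1"
    and "\<And>x. x \<in> {0..1} \<Longrightarrow> (M has_real_derivative m x) (at x within {0..1})"
  shows "integral {a..b} m = M b - M a"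
proof -
  have "(m has_integral (M b - M a)) {a..b}"
    by (rule fundamental_theorem_of_calculus)
       (use assms in \<open>auto simp: has_real_derivative_iff_has_vector_derivative[symmetric]
          intro!: has_field_derivative_subset[OF assms(4)]\<close>)
  then show ?thesis by (rule integral_unique)
qed

lemma primitive_of_deriv:
  assumes "\<And>x. x \<in> {0..1} \<Longrightarrow> (M has_real_derivative m x) (at x within {0..1})"
    and "continuous_on {0..1} m" "t \<in> {0..1}"
  shows "primitive m t = M t - M 0"
  using assms integral_has_deriv_Icc[of 0 t M m]
  by (simp add: primitive_eq_integral integrable_continuous_torus)

lemma deriv_of_primitive:
  assumes "continuous_on {0..1} m" "t \<in> {0..1}"
  shows "(primitive m has_real_derivative m t) (at t within {0..1})"
proof -
  have "((\<lambda>x. integral {0..x} m) has_real_derivative m t) (at t within {0..1})"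
    using assms by (intro integral_has_real_derivative) auto
  then show ?thesis
    unfolding has_real_derivative_iff_has_vector_derivative
    by (rule has_vector_derivative_transform[rotated 2])
       (use assms primitive_eq_integral[OF integrable_continuous_torus] in auto)
qed

text \<open>
  The primitive of \<open>r\<close> is only absolutely continuous, so there is no pointwise product rule to integrate.
  Writing \<open>M(t) - M(x)\<close> as the integral of \<open>m\<close> over \<open>[x, t]\<close> and exchanging the order of integration on
  the triangle \<open>x \<le> y \<le> t\<close> takes its place.
\<close>

lemma primitive_by_parts:
  assumes r: "integrable torus r"
    and M: "\<And>x. x \<in> {0..1} \<Longrightarrow> (M has_real_derivative m x) (at x within {0..1})"
    and m: "continuous_on {0..1} m" and t: "t \<in> {0..1}"
  shows "primitive (\<lambda>x. r x * M x) t
       = primitive r t * M t - primitive (\<lambda>x. primitive r x * m x) t"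
proof -
  interpret sigma_finite_measure torus by (rule sigma_finite_torus)
  interpret pair_sigma_finite torus torus ..
  define K where "K = (\<lambda>x y. r x * (m y * indicator {x..t} y))"
  have mi: "integrable torus m" by (rule integrable_continuous_torus[OF m])
  have [measurable]: "r \<in> borel_measurable torus" "m \<in> borel_measurable torus"
    using r mi by auto
  have cM: "continuous_on {0..1} M"
    by (rule DERIV_continuous_on) (rule M)
  have Ki: "integrable (torus \<Otimes>\<^sub>M torus) (case_prod K)"
  proof (rule Bochner_Integration.integrable_bound)
    show "integrable (torus \<Otimes>\<^sub>M torus) (\<lambda>(x, y). r x * m y)"
      proof (rule Fubini_integrable)
      have "(\<lambda>p. r (fst p) * m (snd p)) \<in> borel_measurable (torus \<Otimes>\<^sub>M torus)" by measurable
      then show "(\<lambda>(x, y). r x * m y) \<in> borel_measurable (torus \<Otimes>\<^sub>M torus)"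
        by (simp add: case_prod_beta)
      show "integrable torus (\<lambda>x. \<integral>y. norm (case (x, y) of (x, y) \<Rightarrow> r x * m y) \<partial>torus)"
        using r by (simp add: abs_mult)
      show "AE x in torus. integrable torus (\<lambda>y. case (x, y) of (x, y) \<Rightarrow> r x * m y)"
        using mi by simp
    qed
    have ind: "(\<lambda>p. indicator {fst p..t} (snd p) :: real) \<in> borel_measurable (torus \<Otimes>\<^sub>M torus)"
    proof -
      have "(\<lambda>p. if fst p \<le> snd p \<and> snd p \<le> t then 1 else 0 :: real)
          \<in> borel_measurable (torus \<Otimes>\<^sub>M torus)"
        by measurable
      moreover have "(\<lambda>p. indicator {fst p..t} (snd p) :: real)
          = (\<lambda>p. if fst p \<le> snd p \<and> snd p \<le> t then 1 else 0)"
        by (auto simp: indicator_def)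
      ultimately show ?thesis by simp
    qed
    show "case_prod K \<in> borel_measurable (torus \<Otimes>\<^sub>M torus)"
    proof -
      have eq: "case_prod K = (\<lambda>p. r (fst p) * (m (snd p) * indicator {fst p..t} (snd p)))"
        by (auto simp: K_def)
      show ?thesis
        unfolding eq by (intro borel_measurable_times ind) measurable
    qed
    show "AE p in torus \<Otimes>\<^sub>M torus. norm (case_prod K p) \<le> norm (case p of (x, y) \<Rightarrow> r x * m y)"
      by (intro AE_I2) (auto simp: K_def indicator_def)
  qed
  have inner1: "(\<integral>y. K x y \<partial>torus) = M t * (r x * indicator {0..t} x) - r x * M x * indicator {0..t} x"
    if "x \<in> {0..<1}" for x
  proof (cases "x \<le> t")
    case True
    have "(\<integral>y. K x y \<partial>torus) = r x * integral {x..t} m"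
      unfolding K_def using that t by (simp add: torus_integral_Icc[OF mi])
    also have "integral {x..t} m = M t - M x"
      by (rule integral_has_deriv_Icc) (use that t True M in auto)
    finally show ?thesis using True that by (simp add: algebra_simps)
  next
    case False
    then have "K x = (\<lambda>y. 0)" by (auto simp: K_def fun_eq_iff)
    then show ?thesis using False by simp
  qed
  have inner2: "(\<integral>x. K x y \<partial>torus) = primitive r y * m y * indicator {0..t} y"
    if "y \<in> {0..<1}" for y
  proof -
    have "(\<integral>x. K x y \<partial>torus) = (\<integral>x. (m y * indicator {0..t} y) * (r x * indicator {0..y} x) \<partial>torus)"
      by (rule Bochner_Integration.integral_cong) (use that in \<open>auto simp: K_def indicator_def\<close>)
    then show ?thesis by (simp add: primitive_def)
  qed
  have "primitive r t * M t - primitive (\<lambda>x. r x * M x) t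
      = (\<integral>x. M t * (r x * indicator {0..t} x) - r x * M x * indicator {0..t} x \<partial>torus)"
    unfolding primitive_def
    by (subst Bochner_Integration.integral_diff)
       (auto intro!: integrable_mult_indicator_torus integrable_mult_continuous_torus r cM)
  also have "\<dots> = (\<integral>x. (\<integral>y. K x y \<partial>torus) \<partial>torus)"
    by (rule Bochner_Integration.integral_cong) (use inner1 in auto)
  also have "\<dots> = (\<integral>y. (\<integral>x. K x y \<partial>torus) \<partial>torus)"
    by (rule Fubini_integral[symmetric, OF Ki])
  also have "\<dots> = primitive (\<lambda>x. primitive r x * m x) t"
    unfolding primitive_def[of "\<lambda>x. primitive r x * m x"]
    by (rule Bochner_Integration.integral_cong) (use inner2 in auto)
  finally show ?thesis by simp
qed

section \<open>Periodic functions with integrable second derivative\<close>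

text \<open>
  The function \<open>w\<close> belongs to \<open>W\<^sup>2\<^sup>,\<^sup>1\<close> of the circle, with derivatives \<open>v\<close> and \<open>r\<close>. The derivatives are
  arguments of the predicate because \<open>r\<close> is determined by \<open>w\<close> only up to a null set.
\<close>

definition periodic_C1 :: "(real \<Rightarrow> real) \<Rightarrow> (real \<Rightarrow> real) \<Rightarrow> (real \<Rightarrow> real) \<Rightarrow> bool" where
  "periodic_C1 w v r \<longleftrightarrow>
     (\<forall>x\<in>{0..1}. (w has_real_derivative v x) (at x within {0..1})) \<and>
     integrable torus r \<and> (\<forall>x\<in>{0..1}. primitive r x = v x - v 0) \<and>
     w 1 = w 0 \<and> v 1 = v 0"

lemma periodic_C1D:
  assumes "periodic_C1 w v r"
  shows "\<And>x. x \<in> {0..1} \<Longrightarrow> (w has_real_derivative v x) (at x within {0..1})"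
    and "integrable torus r"
    and "\<And>x. x \<in> {0..1} \<Longrightarrow> primitive r x = v x - v 0"
    and "w 1 = w 0" and "v 1 = v 0"
    and "continuous_on {0..1} w" and "continuous_on {0..1} v"
    and "(\<integral>x. r x \<partial>torus) = 0" and "(\<integral>x. v x \<partial>torus) = 0"
    and "\<And>x. x \<in> {0..1} \<Longrightarrow> primitive v x = w x - w 0"
proof -
  show d: "\<And>x. x \<in> {0..1} \<Longrightarrow> (w has_real_derivative v x) (at x within {0..1})"
    and r: "integrable torus r"
    and v: "\<And>x. x \<in> {0..1} \<Longrightarrow> primitive r x = v x - v 0"
    and w1: "w 1 = w 0" and v1: "v 1 = v 0"
    using assms unfolding periodic_C1_def by blast+
  show "continuous_on {0..1} w" by (rule DERIV_continuous_on) (rule d)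
  show cv: "continuous_on {0..1} v" by (rule continuous_on_of_primitive[OF r v])
  show "(\<integral>x. r x \<partial>torus) = 0" using v[of 1] v1 by simp
  show w: "primitive v x = w x - w 0" if "x \<in> {0..1}" for x
    using primitive_of_deriv[OF d cv that] by simp
  show "(\<integral>x. v x \<partial>torus) = 0" using w[of 1] w1 by simp
qed

lemma periodic_C1_diff:
  assumes "periodic_C1 w1 v1 r1" "periodic_C1 w2 v2 r2"
  shows "periodic_C1 (\<lambda>x. w1 x - w2 x) (\<lambda>x. v1 x - v2 x) (\<lambda>x. r1 x - r2 x)"
proof -
  have "primitive (\<lambda>x. r1 x - r2 x) x = (v1 x - v2 x) - (v1 0 - v2 0)" if "x \<in> {0..1}" for x
    using periodic_C1D(2,3)[OF assms(1)] periodic_C1D(2,3)[OF assms(2)] that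
    by (simp add: primitive_diff)
  then show ?thesis
    using assms unfolding periodic_C1_def by (auto intro!: derivative_eq_intros)
qed

lemma periodic_C1_by_parts:
  assumes w: "periodic_C1 w v r"
    and M: "\<And>x. x \<in> {0..1} \<Longrightarrow> (M has_real_derivative m x) (at x within {0..1})"
    and m: "continuous_on {0..1} m" and M1: "M 1 = M 0"
  shows "(\<integral>x. r x * M x \<partial>torus) = - (\<integral>x. v x * m x \<partial>torus)"
proof -
  note [simp] = periodic_C1D(8)[OF w]
  have mi: "integrable torus m" by (rule integrable_continuous_torus[OF m])
  have vi: "integrable torus (\<lambda>x. v x * m x)"
    by (intro integrable_continuous_torus continuous_intros m periodic_C1D[OF w])
  have "(\<integral>x. m x \<partial>torus) = 0"
    using primitive_of_deriv[OF M m, of 1] M1 by simp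
  moreover have "(\<integral>x. primitive r x * m x \<partial>torus) = (\<integral>x. v x * m x - v 0 * m x \<partial>torus)"
    by (rule Bochner_Integration.integral_cong) (auto simp: periodic_C1D(3)[OF w] algebra_simps)
  ultimately have "(\<integral>x. primitive r x * m x \<partial>torus) = (\<integral>x. v x * m x \<partial>torus)"
    using vi mi by simp
  then show ?thesis
    using primitive_by_parts[OF periodic_C1D(2)[OF w] M m, of 1] by simp
qed

lemma continuous_antiderivative:
  fixes m :: "real \<Rightarrow> real"
  assumes "continuous_on UNIV m"
  obtains A where "\<And>x. (A has_real_derivative m x) (at x)"
proof -
  have "\<exists>F. \<forall>x :: real. -\<infinity> < ereal x \<longrightarrow> ereal x < \<infinity> \<longrightarrow> (F has_vector_derivative m x) (at x)"
    by (rule einterval_antiderivative)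
       (use assms in \<open>auto simp: continuous_on_eq_continuous_at\<close>)
  then show ?thesis
    using that by (auto simp: has_real_derivative_iff_has_vector_derivative)
qed

text \<open>
  By parts, the integral equals \<open>-\<integral> m'(w) v\<^sup>2\<close>.
\<close>

lemma integral_second_deriv_mono_le_0_smooth:
  assumes w: "periodic_C1 w v r"
    and m: "\<And>y. (m has_real_derivative m' y) (at y)" and m': "continuous_on UNIV m'"
    and nonneg: "\<And>y. 0 \<le> m' y"
  shows "(\<integral>x. r x * m (w x) \<partial>torus) \<le> 0"
proof -
  have "(\<integral>x. r x * m (w x) \<partial>torus) = - (\<integral>x. v x * (m' (w x) * v x) \<partial>torus)"
  proof (rule periodic_C1_by_parts[OF w])
    show "((\<lambda>x. m (w x)) has_real_derivative m' (w x) * v x) (at x within {0..1})"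
      if "x \<in> {0..1}" for x
      by (rule DERIV_chain2[OF m periodic_C1D(1)[OF w that]])
    show "continuous_on {0..1} (\<lambda>x. m' (w x) * v x)"
      by (intro continuous_intros continuous_on_compose2[OF m'] periodic_C1D[OF w]) auto
  qed (simp add: periodic_C1D(4)[OF w])
  moreover have "0 \<le> (\<integral>x. v x * (m' (w x) * v x) \<partial>torus)"
  proof (rule Bochner_Integration.integral_nonneg)
    show "0 \<le> v x * (m' (w x) * v x)" for x
      using mult_nonneg_nonneg[OF nonneg[of "w x"] zero_le_square[of "v x"]] by (simp add: mult_ac)
  qed
  ultimately show ?thesis by simp
qed

text \<open>
  The central inequality. A continuous nondecreasing \<open>m\<close> is the pointwise limit of the difference
  quotients of its antiderivative. These are again nondecreasing and of class \<open>C\<^sup>1\<close>, and they lie between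
  \<open>m\<close> and a translate of \<open>m\<close>, which makes them uniformly bounded on the range of \<open>w\<close>.
\<close>

lemma integral_second_deriv_mono_le_0:
  assumes w: "periodic_C1 w v r" and m: "continuous_on UNIV m" and mono: "mono m"
  shows "(\<integral>x. r x * m (w x) \<partial>torus) \<le> 0"
proof -
  note r = periodic_C1D(2)[OF w]
  obtain A where A: "\<And>x. (A has_real_derivative m x) (at x)"
    using continuous_antiderivative[OF m] by blast
  define d where "d = (\<lambda>k. 1 / real (Suc k))"
  have d: "0 < d k" "d k \<le> 1" for k by (auto simp: d_def)
  define mk where "mk = (\<lambda>k y. (A (y + d k) - A y) / d k)"
  have cont_A: "continuous_on UNIV A" using A by (meson DERIV_continuous_on has_field_derivative_at_within)
  have bounds: "m y \<le> mk k y" "mk k y \<le> m (y + d k)" for k y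
  proof -
    obtain z where "y < z" "z < y + d k" "A (y + d k) - A y = d k * m z"
      using MVT2[of y "y + d k" A m] A d[of k] by auto
    then show "m y \<le> mk k y" "mk k y \<le> m (y + d k)"
      using d[of k] monoD[OF mono, of y z] monoD[OF mono, of z "y + d k"] by (auto simp: mk_def)
  qed
  have le0: "(\<integral>x. r x * mk k (w x) \<partial>torus) \<le> 0" for k
  proof (rule integral_second_deriv_mono_le_0_smooth[OF w])
    show "(mk k has_real_derivative (m (y + d k) - m y) / d k) (at y)" for y
      unfolding mk_def
      using d(1)[of k] by (auto intro!: derivative_eq_intros DERIV_chain2[OF A] simp: field_simps)
    show "continuous_on UNIV (\<lambda>y. (m (y + d k) - m y) / d k)"
      using d[of k] by (intro continuous_intros continuous_on_compose2[OF m]) auto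
    show "0 \<le> (m (y + d k) - m y) / d k" for y
      using d[of k] monoD[OF mono, of y "y + d k"] by auto
  qed
  obtain C where C: "\<And>x. x \<in> {0..1} \<Longrightarrow> \<bar>w x\<bar> \<le> C"
    using continuous_bounded_unit_interval periodic_C1D(6)[OF w] by metis
  define B where "B = \<bar>m (-C)\<bar> + \<bar>m (C + 1)\<bar>"
  have mkB: "\<bar>mk k (w x)\<bar> \<le> B" if "x \<in> {0..1}" for k x
  proof -
    have "m (-C) \<le> m (w x)" "m (w x + d k) \<le> m (C + 1)"
      using C[OF that] d[of k] by (auto intro!: monoD[OF mono])
    then show ?thesis using bounds[where k=k and y="w x"] unfolding B_def by linarith
  qed
  have meas_mk: "(\<lambda>x. mk k (w x)) \<in> borel_measurable torus" for k
    unfolding mk_def using d[of k]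
    by (intro continuous_measurable_torus continuous_intros continuous_on_compose2[OF cont_A]
        periodic_C1D(6)[OF w]) auto
  have meas_m: "(\<lambda>x. m (w x)) \<in> borel_measurable torus"
    by (intro continuous_measurable_torus continuous_on_compose2[OF m] periodic_C1D(6)[OF w]) auto
  have [measurable]: "r \<in> borel_measurable torus" using r by auto
  have "(\<lambda>k. \<integral>x. r x * mk k (w x) \<partial>torus) \<longlonglongrightarrow> (\<integral>x. r x * m (w x) \<partial>torus)"
  proof (rule integral_dominated_convergence)
    show "(\<lambda>x. r x * m (w x)) \<in> borel_measurable torus" using meas_m by measurable
    show "(\<lambda>x. r x * mk k (w x)) \<in> borel_measurable torus" for k using meas_mk[of k] by measurable
    show "integrable torus (\<lambda>x. B * \<bar>r x\<bar>)" using r by simp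
    show "AE x in torus. (\<lambda>k. r x * mk k (w x)) \<longlonglongrightarrow> r x * m (w x)"
    proof (intro AE_I2 tendsto_mult tendsto_const)
      fix x
      have d0: "d \<longlonglongrightarrow> 0" unfolding d_def by (rule LIMSEQ_inverse_real_of_nat[unfolded inverse_eq_divide])
      have "(\<lambda>k. m (w x + d k)) \<longlonglongrightarrow> m (w x)"
        by (rule isCont_tendsto_compose)
           (use m d0 in \<open>auto simp: continuous_on_eq_continuous_at intro!: tendsto_eq_intros\<close>)
      then show "(\<lambda>k. mk k (w x)) \<longlonglongrightarrow> m (w x)"
        by (rule tendsto_sandwich[rotated 3, of _ _ _ "\<lambda>_. m (w x)"]) (intro always_eventually allI bounds tendsto_const)+
    qed
    show "AE x in torus. norm (r x * mk k (w x)) \<le> B * \<bar>r x\<bar>" for k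
      by (intro AE_I2) (auto simp: abs_mult mult.commute[of B] intro!: mult_left_mono mkB)
  qed
  then show ?thesis by (rule LIMSEQ_le_const2) (use le0 in auto)
qed


lemma periodic_C1_cong:
  assumes "periodic_C1 w v r" "\<And>x. 0 \<le> x \<Longrightarrow> x < 1 \<Longrightarrow> r x = s x"
  shows "periodic_C1 w v s"
proof -
  have "integrable torus s"
    using periodic_C1D(2)[OF assms(1)] assms(2)
    by (subst Bochner_Integration.integrable_cong[of torus torus s r]) auto
  moreover have "primitive s t = primitive r t" for t
    by (rule primitive_cong) (use assms(2) in auto)
  ultimately show ?thesis using assms(1) unfolding periodic_C1_def by auto
qed

lemma periodic_C1_minus:
  assumes "periodic_C1 w v r"
  shows "periodic_C1 (\<lambda>x. - w x) (\<lambda>x. - v x) (\<lambda>x. - r x)"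
proof -
  have "periodic_C1 (\<lambda>x. 0) (\<lambda>x. 0) (\<lambda>x. 0)"
    unfolding periodic_C1_def primitive_def by auto
  from periodic_C1_diff[OF this assms] show ?thesis by simp
qed

lemma continuous_eq_0_of_integral_le_0:
  fixes F :: "real \<Rightarrow> real"
  assumes "continuous_on {0..1} F" "\<And>x. x \<in> {0..1} \<Longrightarrow> 0 \<le> F x" "(\<integral>x. F x \<partial>torus) \<le> 0"
    and "x \<in> {0..1}"
  shows "F x = 0"
proof -
  have "integral {0..1} F = (\<integral>x. F x \<partial>torus)"
    using primitive_eq_integral[OF integrable_continuous_torus[OF assms(1)], of 1] by simp
  moreover have "0 \<le> integral {0..1} F"
    by (rule integral_nonneg) (use assms integrable_continuous_interval in auto)
  ultimately have "integral {0..1} F = 0" using assms(3) by linarith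
  then show ?thesis
    using integral_eq_0_iff[OF assms(1), of] assms(2,4) by auto
qed

section \<open>The periodic resolvent and the regularized problem\<close>

text \<open>
  The operator factors as \<open>c - h \<partial>\<^sup>2 = h (k - \<partial>) (k + \<partial>)\<close> with \<open>k\<^sup>2 = c / h\<close>. The two first-order periodic
  problems are solved one after the other by variation of constants.
\<close>

lemma exists_periodic_resolvent:
  assumes h: "0 < h" and c: "0 < c" and q: "integrable torus q"
  shows "\<exists>w v. periodic_C1 w v (\<lambda>x. (c * w x - q x) / h)"
proof -
  define k where "k = sqrt (c / h)"
  have k: "0 < k" "k * k = c / h" using h c by (auto simp: k_def)
  define E where "E = (\<lambda>x. exp (k * x))"
  have E_pos: "E x > 0" for x by (simp add: E_def)
  have E0: "E 0 = 1" by (simp add: E_def)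
  have E1: "E 1 > 1" using k by (simp add: E_def)
  have dE: "(E has_real_derivative k * E x) (at x within {0..1})" for x
    unfolding E_def by (auto intro!: derivative_eq_intros)
  have cE: "continuous_on {0..1} E" unfolding E_def by (intro continuous_intros)
  define P where "P = primitive (\<lambda>y. q y * exp (- k * y))"
  have iq: "integrable torus (\<lambda>y. q y * exp (- k * y))"
    by (intro integrable_mult_continuous_torus q continuous_intros)
  have cP: "continuous_on {0..1} P" unfolding P_def by (rule continuous_on_primitive[OF iq])
  have P0: "P 0 = 0" unfolding P_def by (rule primitive_0[OF iq])
  \<comment> \<open>\<open>z\<close> solves \<open>z' = k z - q / h\<close>, and \<open>z0\<close> is the initial value for which it is periodic\<close>
  define z0 where "z0 = E 1 * P 1 / (h * (E 1 - 1))"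
  define z where "z = (\<lambda>x. E x * (z0 - P x / h))"
  have cz: "continuous_on {0..1} z" unfolding z_def by (intro continuous_intros cE cP) (use h in auto)
  have ikz: "integrable torus (\<lambda>x. k * z x)"
    by (intro integrable_continuous_torus continuous_intros cz)
  have iqh: "integrable torus (\<lambda>x. q x / h)" using q by simp
  have z1: "z 1 = z0" and z00: "z 0 = z0"
    using E1 h by (auto simp: z_def z0_def E0 P0 field_simps)
  have prim_z: "primitive (\<lambda>x. k * z x - q x / h) t = z t - z0" if t: "t \<in> {0..1}" for t
  proof -
    have cPE: "continuous_on {0..1} (\<lambda>x. P x * (k * E x))"
      by (intro continuous_intros cP cE)
    have "primitive (\<lambda>x. q x * exp (- k * x) * E x) t = P t * E t - primitive (\<lambda>x. P x * (k * E x)) t"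
      unfolding P_def
      by (rule primitive_by_parts[OF iq dE _ t]) (intro continuous_intros cE)
    moreover have "(\<lambda>x. q x * exp (- k * x) * E x) = q"
      by (simp add: E_def fun_eq_iff mult.assoc flip: exp_add)
    ultimately have q_eq: "primitive q t = P t * E t - primitive (\<lambda>x. P x * (k * E x)) t" by simp
    have E_eq: "primitive (\<lambda>x. k * E x) t = E t - 1"
      using primitive_of_deriv[OF dE continuous_on_mult_left[OF cE] t] E0 by simp
    have "primitive (\<lambda>x. k * z x) t
        = primitive (\<lambda>x. z0 * (k * E x) - P x * (k * E x) / h) t"
      by (rule primitive_cong) (use h in \<open>simp add: z_def field_simps\<close>)
    also have "\<dots> = primitive (\<lambda>x. z0 * (k * E x)) t - primitive (\<lambda>x. P x * (k * E x) / h) t"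
      by (intro primitive_diff integrable_continuous_torus continuous_intros cE cP) (use h in auto)
    also have "\<dots> = z0 * (E t - 1) + (primitive q t - P t * E t) / h"
      using q_eq by (simp add: primitive_cmult[of z0] primitive_cdivide E_eq)
    finally have "primitive (\<lambda>x. k * z x) t = z t - z0 + primitive q t / h"
      using h by (simp add: z_def field_simps)
    moreover have "primitive (\<lambda>x. k * z x - q x / h) t = primitive (\<lambda>x. k * z x) t - primitive (\<lambda>x. q x / h) t"
      by (rule primitive_diff[OF ikz iqh])
    ultimately show ?thesis by (simp add: primitive_cdivide)
  qed
  define Z where "Z = primitive (\<lambda>y. E y * z y)"
  have cEz: "continuous_on {0..1} (\<lambda>y. E y * z y)" by (intro continuous_intros cE cz)
  have Z0: "Z 0 = 0" unfolding Z_def by (intro primitive_0 integrable_continuous_torus cEz)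
  have dZ: "(Z has_real_derivative E x * z x) (at x within {0..1})" if "x \<in> {0..1}" for x
    unfolding Z_def by (rule deriv_of_primitive[OF cEz that])
  \<comment> \<open>\<open>w\<close> solves \<open>w' = z - k w\<close>, and \<open>w0\<close> is the initial value for which it is periodic\<close>
  define w0 where "w0 = Z 1 / (E 1 - 1)"
  define w where "w = (\<lambda>x. (w0 + Z x) / E x)"
  define v where "v = (\<lambda>x. z x - k * w x)"
  have dw: "(w has_real_derivative v x) (at x within {0..1})" if "x \<in> {0..1}" for x
  proof -
    have "(w has_real_derivative
          ((E x * z x) * E x - (w0 + Z x) * (k * E x)) / (E x * E x)) (at x within {0..1})"
      unfolding w_def
      by (rule DERIV_divide) (use E_pos[of x] in \<open>auto intro!: derivative_eq_intros dZ[OF that] dE\<close>)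
    also have "((E x * z x) * E x - (w0 + Z x) * (k * E x)) / (E x * E x) = v x"
      using E_pos[of x] by (simp add: v_def w_def field_simps)
    finally show ?thesis .
  qed
  have w1: "w 1 = w 0"
    using E1 by (simp add: w_def Z0 E0 w0_def field_simps)
  have cw: "continuous_on {0..1} w" by (rule DERIV_continuous_on) (rule dw)
  have cv: "continuous_on {0..1} v" unfolding v_def by (intro continuous_intros cz cw)
  have "primitive (\<lambda>x. (c * w x - q x) / h) t = v t - v 0" if t: "t \<in> {0..1}" for t
  proof -
    have "primitive (\<lambda>x. (c * w x - q x) / h) t = primitive (\<lambda>x. (k * z x - q x / h) - k * v x) t"
    proof (rule primitive_cong)
      fix x
      have "(k * z x - q x / h) - k * v x = (k * k) * w x - q x / h"
        by (simp add: v_def algebra_simps)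
      then show "(c * w x - q x) / h = (k * z x - q x / h) - k * v x"
        using k(2) by (simp add: diff_divide_distrib)
    qed
    also have "\<dots> = primitive (\<lambda>x. k * z x - q x / h) t - primitive (\<lambda>x. k * v x) t"
      by (intro primitive_diff Bochner_Integration.integrable_diff[OF ikz iqh]
          integrable_continuous_torus continuous_intros cv)
    also have "\<dots> = (z t - z0) - k * (w t - w 0)"
      using prim_z[OF t] primitive_of_deriv[OF dw cv t] by (simp add: primitive_cmult)
    finally show ?thesis by (simp add: v_def z00 algebra_simps)
  qed
  moreover have "integrable torus (\<lambda>x. (c * w x - q x) / h)"
    using q integrable_continuous_torus[OF cw] by auto
  ultimately have "periodic_C1 w v (\<lambda>x. (c * w x - q x) / h)"
    unfolding periodic_C1_def using dw w1 z1 z00 by (auto simp: v_def)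
  then show ?thesis by blast
qed

text \<open>
  Maximum principle: the equation is tested with the positive part of \<open>w - C / c\<close>.
\<close>

lemma periodic_resolvent_upper_bound:
  assumes h: "0 < h" and c: "0 < c"
    and w: "periodic_C1 w v (\<lambda>x. (c * w x - d x) / h)"
    and d: "\<And>x. x \<in> {0..1} \<Longrightarrow> d x \<le> C" and x: "x \<in> {0..1}"
  shows "w x \<le> C / c"
proof -
  define m where "m = (\<lambda>y. max 0 (y - C / c))"
  have cm: "continuous_on UNIV m" unfolding m_def by (intro continuous_intros)
  have cw: "continuous_on {0..1} w" by (rule periodic_C1D[OF w])
  have cmw: "continuous_on {0..1} (\<lambda>x. m (w x))"
    by (rule continuous_on_compose2[OF cm cw]) auto
  have "mono m" unfolding m_def mono_def by auto
  then have le0: "(\<integral>x. (c * w x - d x) / h * m (w x) \<partial>torus) \<le> 0"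
    by (rule integral_second_deriv_mono_le_0[OF w cm])
  have "(\<integral>x. c / h * (m (w x))\<^sup>2 \<partial>torus) \<le> (\<integral>x. (c * w x - d x) / h * m (w x) \<partial>torus)"
  proof (rule integral_mono)
    show "integrable torus (\<lambda>x. c / h * (m (w x))\<^sup>2)"
      by (intro integrable_continuous_torus continuous_intros cmw)
    show "integrable torus (\<lambda>x. (c * w x - d x) / h * m (w x))"
      by (rule integrable_mult_continuous_torus[OF periodic_C1D(2)[OF w] cmw])
    fix x assume "x \<in> space torus"
    then have "c * (w x - C / c) \<le> c * w x - d x" using d[of x] c by (auto simp: algebra_simps)
    then have "c * (w x - C / c) * m (w x) \<le> (c * w x - d x) * m (w x)"
      by (rule mult_right_mono) (simp add: m_def)
    moreover have "c * (w x - C / c) * m (w x) = c * (m (w x))\<^sup>2"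
      by (simp add: m_def max_def power2_eq_square)
    ultimately show "c / h * (m (w x))\<^sup>2 \<le> (c * w x - d x) / h * m (w x)"
      using h by (simp add: divide_right_mono)
  qed
  with le0 have "(\<integral>x. c / h * (m (w x))\<^sup>2 \<partial>torus) \<le> 0" by linarith
  then have "c / h * (m (w x))\<^sup>2 = 0"
    by (intro continuous_eq_0_of_integral_le_0[OF _ _ _ x]) (use h c in \<open>auto intro!: continuous_intros cmw\<close>)
  then show ?thesis using h c by (auto simp: m_def)
qed

lemma periodic_resolvent_bound:
  assumes h: "0 < h" and c: "0 < c"
    and w: "periodic_C1 w v (\<lambda>x. (c * w x - d x) / h)"
    and d: "\<And>x. x \<in> {0..1} \<Longrightarrow> \<bar>d x\<bar> \<le> C" and x: "x \<in> {0..1}"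
  shows "\<bar>w x\<bar> \<le> C / c"
proof -
  have "w x \<le> C / c"
    by (rule periodic_resolvent_upper_bound[OF h c w _ x]) (use d in force)
  moreover have "- w x \<le> C / c"
  proof (rule periodic_resolvent_upper_bound[OF h c _ _ x])
    have "(\<lambda>x. (c * - w x - - d x) / h) = (\<lambda>x. - ((c * w x - d x) / h))"
      using h by (auto simp: field_simps)
    then show "periodic_C1 (\<lambda>x. - w x) (\<lambda>x. - v x) (\<lambda>x. (c * - w x - - d x) / h)"
      using periodic_C1_minus[OF w] by simp
  qed (use d in force)
  ultimately show ?thesis by linarith
qed

text \<open>
  Adding \<open>L \<xi>\<close> on both sides, the equation says that \<open>\<xi>\<close> is the resolvent with constant \<open>L + l\<close> of
  \<open>g + (L \<xi> - b(\<xi>))\<close>. As \<open>b\<close> is nondecreasing, \<open>s \<mapsto> L s - b s\<close> still has Lipschitz constant \<open>L\<close>, while the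
  resolvent divides the supremum norm by \<open>L + l\<close>. Hence the right-hand side is a contraction.
\<close>

lemma regularized_problem_solvable:
  assumes h: "0 < h" and l: "0 < l" and L: "0 \<le> L" and g: "integrable torus g"
    and mono: "mono b" and lip: "\<And>s t. \<bar>b s - b t\<bar> \<le> L * \<bar>s - t\<bar>"
  shows "\<exists>\<xi> \<eta>. periodic_C1 \<xi> \<eta> (\<lambda>x. (b (\<xi> x) + l * \<xi> x - g x) / h)"
proof -
  define c where "c = L + l"
  have c: "0 < c" using L l by (simp add: c_def)
  have cb: "continuous_on UNIV b"
  proof -
    have "L-lipschitz_on UNIV b" using lip L by (auto intro!: lipschitz_onI simp: dist_real_def)
    then show ?thesis by (rule lipschitz_on_continuous_on)
  qed
  define q where "q = (\<lambda>F x. g x + (L * apply_bcontfun F x - b (apply_bcontfun F x)))"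
  have qi: "integrable torus (q F)" for F
    unfolding q_def
    by (intro Bochner_Integration.integrable_add g integrable_continuous_torus continuous_intros
        continuous_on_compose2[OF cb]) auto
  have "\<forall>F. \<exists>wv. periodic_C1 (fst wv) (snd wv) (\<lambda>x. (c * fst wv x - q F x) / h)"
    using exists_periodic_resolvent[OF h c qi] by auto
  then obtain wv where wv: "\<And>F. periodic_C1 (fst (wv F)) (snd (wv F)) (\<lambda>x. (c * fst (wv F) x - q F x) / h)"
    by metis
  define w where "w = (\<lambda>F. fst (wv F))"
  define v where "v = (\<lambda>F. snd (wv F))"
  have wv: "periodic_C1 (w F) (v F) (\<lambda>x. (c * w F x - q F x) / h)" for F
    using wv by (simp add: w_def v_def)
  \<comment> \<open>clamping the argument turns functions on \<open>[0,1]\<close> into bounded continuous functions on the line\<close>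
  define e where "e = (\<lambda>x::real. max 0 (min 1 x))"
  have e01: "e x \<in> {0..1}" for x by (auto simp: e_def)
  have e_id: "e x = x" if "x \<in> {0..1}" for x using that by (auto simp: e_def)
  have bcont: "(\<lambda>x. w F (e x)) \<in> bcontfun" for F
  proof -
    obtain C where "\<And>x. x \<in> {0..1} \<Longrightarrow> \<bar>w F x\<bar> \<le> C"
      using continuous_bounded_unit_interval periodic_C1D(6)[OF wv] by metis
    moreover have "continuous_on UNIV (\<lambda>x. w F (e x))"
    proof (rule continuous_on_compose2[OF periodic_C1D(6)[OF wv]])
      show "continuous_on UNIV e" unfolding e_def by (intro continuous_intros)
    qed (use e01 in auto)
    ultimately show ?thesis using e01 by (intro bcontfun_normI[of _ C]) auto
  qed
  define T where "T = (\<lambda>F. Bcontfun (\<lambda>x. w F (e x)))"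
  have T: "apply_bcontfun (T F) x = w F (e x)" for F x
    unfolding T_def using Bcontfun_inverse[OF bcont] by simp
  have "dist (T F) (T G) \<le> L / c * dist F G" for F G
  proof (rule dist_bound)
    fix x
    have diff: "periodic_C1 (\<lambda>x. w F x - w G x) (\<lambda>x. v F x - v G x)
        (\<lambda>x. (c * (w F x - w G x) - (q F x - q G x)) / h)"
      using periodic_C1_diff[OF wv[of F] wv[of G]]
      by (simp add: algebra_simps diff_divide_distrib add_divide_distrib)
    have "\<bar>w F (e x) - w G (e x)\<bar> \<le> (L * dist F G) / c"
    proof (rule periodic_resolvent_bound[OF h c diff _ e01])
      fix y
      define s t where "s = apply_bcontfun F y" and "t = apply_bcontfun G y"
      have "\<bar>s - t\<bar> \<le> dist F G"
        using dist_bounded[of F y G] by (simp add: s_def t_def dist_real_def)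
      have "0 \<le> (b s - b t) \<and> t \<le> s \<or> b s - b t \<le> 0 \<and> s \<le> t"
        using monoD[OF mono, of s t] monoD[OF mono, of t s] by linarith
      moreover have "L * s - L * t = L * (s - t)" by (simp add: algebra_simps)
      moreover have "t \<le> s \<Longrightarrow> 0 \<le> L * (s - t)" "s \<le> t \<Longrightarrow> L * (s - t) \<le> 0"
        using L by (auto simp: mult_nonneg_nonpos)
      moreover have "L * \<bar>s - t\<bar> = \<bar>L * (s - t)\<bar>" using L by (simp add: abs_mult)
      ultimately have "\<bar>(L * s - b s) - (L * t - b t)\<bar> \<le> L * \<bar>s - t\<bar>"
        using lip[of s t] by linarith
      also have "\<dots> \<le> L * dist F G" using L \<open>\<bar>s - t\<bar> \<le> dist F G\<close> by (rule mult_left_mono[rotated])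
      finally show "\<bar>q F y - q G y\<bar> \<le> L * dist F G" by (simp add: q_def s_def t_def)
    qed
    then show "dist (apply_bcontfun (T F) x) (apply_bcontfun (T G) x) \<le> L / c * dist F G"
      by (simp add: T dist_real_def)
  qed
  then obtain F where F: "T F = F"
    using banach_fix_type[of "L / c" T] L l c by (auto simp: c_def)
  have Fx: "apply_bcontfun F x = w F x" if "x \<in> {0..1}" for x
    using T[of F x] F e_id[OF that] by simp
  have "periodic_C1 (w F) (v F) (\<lambda>x. (b (w F x) + l * w F x - g x) / h)"
  proof (rule periodic_C1_cong[OF wv])
    show "(c * w F x - q F x) / h = (b (w F x) + l * w F x - g x) / h" if "0 \<le> x" "x < 1" for x
      using Fx[of x] that by (simp add: q_def c_def algebra_simps)
  qed
  then show ?thesis by blast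
qed

section \<open>Subdifferentials and their regularized inverses\<close>

lemma subdifferential_monotone:
  assumes "z \<in> subdifferential W p" "y \<in> subdifferential W q"
  shows "0 \<le> (p - q) * (z - y)"
proof -
  have "W p + z * (q - p) \<le> W q" "W q + y * (p - q) \<le> W p"
    using assms by (auto simp: subdifferential_def)
  then show ?thesis by (simp add: algebra_simps)
qed

lemma subdifferential_closed:
  assumes W: "continuous_on UNIV W" and z: "z \<longlonglongrightarrow> z'" and p: "p \<longlonglongrightarrow> p'"
    and mem: "\<And>n. z n \<in> subdifferential W (p n)"
  shows "z' \<in> subdifferential W p'"
  unfolding subdifferential_def mem_Collect_eq
proof
  fix q
  have "(\<lambda>n. W (p n)) \<longlonglongrightarrow> W p'"
    by (rule isCont_tendsto_compose[OF _ p]) (use W in \<open>simp add: continuous_on_eq_continuous_at\<close>)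
  then have "(\<lambda>n. W (p n) + z n * (q - p n)) \<longlonglongrightarrow> W p' + z' * (q - p')"
    by (intro tendsto_intros z p)
  then show "W p' + z' * (q - p') \<le> W q"
    by (rule LIMSEQ_le_const2) (use mem in \<open>auto simp: subdifferential_def\<close>)
qed

text \<open>
  Divide the subgradient inequality between \<open>p\<close> and \<open>t\<close> by \<open>t\<close> and let \<open>t\<close> tend to infinity.
\<close>

lemma subdifferential_upper_bound:
  assumes lim: "((\<lambda>t. W t / t) \<longlongrightarrow> K) at_top" and z: "z \<in> subdifferential W p"
  shows "z \<le> K"
proof (rule tendsto_le[OF _ lim])
  show "((\<lambda>t. z + (W p - z * p) * inverse t) \<longlongrightarrow> z) at_top"
    using tendsto_add[OF tendsto_const tendsto_mult_right_zero[OF tendsto_inverse_0_at_top[OF filterlim_ident]],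
      of z "W p - z * p"] by simp
  show "\<forall>\<^sub>F t in at_top. z + (W p - z * p) * inverse t \<le> W t / t"
    using eventually_gt_at_top[of 0]
  proof eventually_elim
    case (elim t)
    have "W p + z * (t - p) \<le> W t" using z by (auto simp: subdifferential_def)
    then have "(W p + z * (t - p)) / t \<le> W t / t" using elim by (simp add: divide_right_mono)
    then show ?case using elim by (simp add: field_simps)
  qed
qed simp

lemma subdifferential_bound:
  assumes "((\<lambda>t. W t / t) \<longlongrightarrow> K) at_top" "((\<lambda>t. W (- t) / t) \<longlongrightarrow> K) at_top"
    and z: "z \<in> subdifferential W p"
  shows "\<bar>z\<bar> \<le> K"
proof -
  have "- z \<in> subdifferential (\<lambda>t. W (- t)) (- p)"
    unfolding subdifferential_def mem_Collect_eq
  proof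
    fix q
    have "W p + z * (- q - p) \<le> W (- q)" using z by (auto simp: subdifferential_def)
    then show "W (- (- p)) + (- z) * (q - (- p)) \<le> W (- q)" by (simp add: algebra_simps)
  qed
  then have "- z \<le> K" by (rule subdifferential_upper_bound[OF assms(2)])
  then show ?thesis using subdifferential_upper_bound[OF assms(1) z] by linarith
qed

lemma convex_continuous_UNIV:
  fixes W :: "real \<Rightarrow> real"
  assumes "convex_on UNIV W" shows "continuous_on UNIV W"
  by (rule convex_on_continuous[OF open_UNIV assms])

text \<open>
  The required \<open>p\<close> minimizes the coercive function \<open>W p + l p\<^sup>2 / 2 - s p\<close>. Since \<open>W\<close> is minimal at \<open>0\<close>, the
  quadratic terms alone show that values outside \<open>[-R, R]\<close> are not below the value at \<open>0\<close>.
\<close>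

lemma resolvent_exists:
  assumes W: "convex_on UNIV W" and W0: "0 \<in> subdifferential W 0" and l: "0 < l"
  shows "\<exists>p. s - l * p \<in> subdifferential W p"
proof -
  define G where "G = (\<lambda>p. W p + l * p\<^sup>2 / 2 - s * p)"
  define R where "R = 2 * \<bar>s\<bar> / l"
  have R: "0 \<le> R" using l by (simp add: R_def)
  have "continuous_on {-R..R} G"
    unfolding G_def using convex_continuous_UNIV[OF W]
    by (intro continuous_intros) (auto intro: continuous_on_subset)
  then obtain p where p: "p \<in> {-R..R}" "\<And>q. q \<in> {-R..R} \<Longrightarrow> G p \<le> G q"
    using continuous_attains_inf[of "{-R..R}" G] R by auto
  have min: "G p \<le> G q" for q
  proof (cases "q \<in> {-R..R}")
    case False
    then have "R < \<bar>q\<bar>" by auto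
    then have "2 * \<bar>s\<bar> < l * \<bar>q\<bar>" using l by (simp add: R_def field_simps)
    then have "2 * \<bar>s\<bar> * \<bar>q\<bar> \<le> l * \<bar>q\<bar> * \<bar>q\<bar>" by (intro mult_right_mono) auto
    then have "s * q \<le> l * q\<^sup>2 / 2"
      using abs_ge_self[of "s * q"] by (simp add: power2_eq_square abs_mult)
    moreover have "W 0 \<le> W q" using W0 by (auto simp: subdifferential_def)
    ultimately have "G 0 \<le> G q" by (simp add: G_def)
    moreover have "G p \<le> G 0" using p R by auto
    ultimately show ?thesis by linarith
  qed (use p in auto)
  have "s - l * p \<in> subdifferential W p"
    unfolding subdifferential_def mem_Collect_eq
  proof
    fix q
    define A where "A = W q - W p - (s - l * p) * (q - p)"
    define B where "B = l * (q - p)\<^sup>2 / 2"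
    have B: "0 \<le> B" using l by (simp add: B_def)
    \<comment> \<open>first-order optimality of \<open>p\<close> along the segment towards \<open>q\<close>\<close>
    have AB: "0 \<le> A + t * B" if t: "0 < t" "t \<le> 1" for t
    proof -
      have "W ((1 - t) * p + t * q) \<le> (1 - t) * W p + t * W q"
        using convex_onD[OF W, of t p q] t by simp
      then have "0 \<le> t * A + t * t * B"
        using min[of "(1 - t) * p + t * q"]
        by (simp add: G_def A_def B_def power2_eq_square algebra_simps add_divide_distrib diff_divide_distrib)
      then have "0 \<le> t * (A + t * B)" by (simp add: algebra_simps)
      then show ?thesis using t by (simp add: zero_le_mult_iff)
    qed
    have "0 \<le> A"
    proof (rule ccontr)
      assume "\<not> 0 \<le> A"
      define t where "t = min 1 (- A / (2 * (B + 1)))"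
      have "t \<le> - A / (2 * (B + 1))" by (simp add: t_def)
      then have "t * (B + 1) \<le> - A / 2" using B by (simp add: field_simps)
      moreover have "0 < t" "t \<le> 1" using \<open>\<not> 0 \<le> A\<close> B by (auto simp: t_def divide_neg_pos)
      ultimately show False
        using AB[of t] \<open>\<not> 0 \<le> A\<close> by (simp add: algebra_simps)
    qed
    then show "W p + (s - l * p) * (q - p) \<le> W q" by (simp add: A_def)
  qed
  then show ?thesis by blast
qed

text \<open>
  The Yosida approximation of the inverse of the subdifferential: \<open>p = yosida W l s\<close> solves
  \<open>s \<in> \<partial>W(p) + l p\<close>, which approximates \<open>s \<in> \<partial>W(p)\<close>.
\<close>

definition yosida :: "(real \<Rightarrow> real) \<Rightarrow> real \<Rightarrow> real \<Rightarrow> real" where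
  "yosida W l s = (SOME p. s - l * p \<in> subdifferential W p)"

context
  fixes W :: "real \<Rightarrow> real" and l :: real
  assumes W: "convex_on UNIV W" and W0: "0 \<in> subdifferential W 0" and l: "0 < l"
begin

lemma yosida_mem: "s - l * yosida W l s \<in> subdifferential W (yosida W l s)"
  unfolding yosida_def using someI_ex[OF resolvent_exists[OF W W0 l]] .

lemma yosida_cocoercive:
  "l * (yosida W l s - yosida W l t)\<^sup>2 \<le> (yosida W l s - yosida W l t) * (s - t)"
  using subdifferential_monotone[OF yosida_mem[of s] yosida_mem[of t]]
  by (simp add: power2_eq_square algebra_simps)

lemma yosida_lipschitz: "\<bar>yosida W l s - yosida W l t\<bar> \<le> 1 / l * \<bar>s - t\<bar>"
proof (cases "yosida W l s = yosida W l t")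
  case False
  define d where "d = yosida W l s - yosida W l t"
  have "l * \<bar>d\<bar> * \<bar>d\<bar> \<le> \<bar>s - t\<bar> * \<bar>d\<bar>"
    using yosida_cocoercive[of s t] abs_ge_self[of "d * (s - t)"]
    by (simp add: d_def[symmetric] power2_eq_square abs_mult mult_ac)
  then have "l * \<bar>d\<bar> \<le> \<bar>s - t\<bar>" using False by (simp add: d_def mult_le_cancel_right)
  then show ?thesis using l by (simp add: d_def field_simps)
qed (use l in simp)

lemma yosida_mono: "mono (yosida W l)"
proof (rule monoI)
  fix s t :: real assume "s \<le> t"
  show "yosida W l s \<le> yosida W l t"
  proof (rule ccontr)
    assume "\<not> ?thesis"
    then have "0 < (yosida W l s - yosida W l t)\<^sup>2" "(yosida W l s - yosida W l t) * (s - t) \<le> 0"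
      using \<open>s \<le> t\<close> by (auto simp: mult_nonneg_nonpos)
    then show False using yosida_cocoercive[of s t] l
      by (smt (verit) mult_pos_pos)
  qed
qed

lemma yosida_0: "yosida W l 0 = 0"
proof -
  have "0 \<le> (yosida W l 0 - 0) * ((0 - l * yosida W l 0) - 0)"
    by (rule subdifferential_monotone[OF yosida_mem W0])
  then have "l * (yosida W l 0)\<^sup>2 \<le> 0" by (simp add: power2_eq_square algebra_simps)
  then show ?thesis using l by (auto simp: mult_le_0_iff)
qed

lemma yosida_continuous: "continuous_on UNIV (yosida W l)"
proof -
  have "(1 / l)-lipschitz_on UNIV (yosida W l)"
    using l yosida_lipschitz by (intro lipschitz_onI) (auto simp: dist_real_def)
  then show ?thesis by (rule lipschitz_on_continuous_on)
qed

lemma yosida_sign: "0 \<le> yosida W l s * s"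
  using yosida_cocoercive[of s 0] l yosida_0 by (simp add: order_trans[rotated])

end

section \<open>Estimates for the regularized problem\<close>

text \<open>
  Test the difference of the two equations with the sign of \<open>w = \<xi>1 - \<xi>2\<close>. Where \<open>b(\<xi>1) - b(\<xi>2)\<close> does not
  vanish, it has the same sign. The central inequality requires a continuous test, so the sign is replaced by
  steep ramps.
  Where a ramp differs from the sign, \<open>w\<close> is small, and the Lipschitz bound on \<open>b\<close> bounds the error.
\<close>

lemma regularized_contraction:
  assumes h: "0 < h" and l: "0 < l"
    and b: "continuous_on UNIV b" "mono b" and lip: "\<And>s t. \<bar>b s - b t\<bar> \<le> L * \<bar>s - t\<bar>"
    and 1: "periodic_C1 \<xi>1 \<eta>1 (\<lambda>x. (b (\<xi>1 x) + l * \<xi>1 x - g1 x) / h)"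
    and 2: "periodic_C1 \<xi>2 \<eta>2 (\<lambda>x. (b (\<xi>2 x) + l * \<xi>2 x - g2 x) / h)"
    and g1: "integrable torus g1" and g2: "integrable torus g2"
  shows "(\<integral>x. \<bar>b (\<xi>1 x) - b (\<xi>2 x)\<bar> \<partial>torus) \<le> (\<integral>x. \<bar>g1 x - g2 x\<bar> \<partial>torus)"
proof -
  define w where "w = (\<lambda>x. \<xi>1 x - \<xi>2 x)"
  define r where "r = (\<lambda>x. (b (\<xi>1 x) + l * \<xi>1 x - g1 x) / h - (b (\<xi>2 x) + l * \<xi>2 x - g2 x) / h)"
  define p where "p = (\<lambda>x. b (\<xi>1 x) - b (\<xi>2 x))"
  define G where "G = (\<lambda>x. g1 x - g2 x)"
  have w: "periodic_C1 w (\<lambda>x. \<eta>1 x - \<eta>2 x) r"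
    using periodic_C1_diff[OF 1 2] by (simp add: w_def r_def)
  have r: "h * r x = p x + l * w x - G x" for x
    using h by (simp add: r_def p_def G_def w_def field_simps)
  have cw: "continuous_on {0..1} w" by (rule periodic_C1D[OF w])
  have cp: "continuous_on {0..1} p" unfolding p_def
    by (intro continuous_intros continuous_on_compose2[OF b(1)] periodic_C1D(6)[OF 1] periodic_C1D(6)[OF 2]) auto
  have iG: "integrable torus G" unfolding G_def using g1 g2 by simp
  have L: "0 \<le> L" using lip[of 1 0] by simp
  have est: "(\<integral>x. \<bar>p x\<bar> \<partial>torus) \<le> (\<integral>x. \<bar>G x\<bar> \<partial>torus) + L / real (Suc k)" for k
  proof -
    define m where "m = (\<lambda>y. max (-1) (min 1 (real (Suc k) * y)))"
    have cm: "continuous_on UNIV m" unfolding m_def by (intro continuous_intros)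
    have "mono m" unfolding m_def by (intro monoI max.mono min.mono mult_left_mono) auto
    have cmw: "continuous_on {0..1} (\<lambda>x. m (w x))"
      by (rule continuous_on_compose2[OF cm cw]) auto
    have "(\<integral>x. r x * m (w x) \<partial>torus) \<le> 0"
      by (rule integral_second_deriv_mono_le_0[OF w cm \<open>mono m\<close>])
    then have "h * (\<integral>x. r x * m (w x) \<partial>torus) \<le> 0" using h by (simp add: mult_nonneg_nonpos)
    then have I: "(\<integral>x. h * (r x * m (w x)) \<partial>torus) \<le> 0" by simp
    have "(\<integral>x. \<bar>p x\<bar> - \<bar>G x\<bar> - L / real (Suc k) \<partial>torus) \<le> (\<integral>x. h * (r x * m (w x)) \<partial>torus)"
    proof (rule integral_mono)
      show "integrable torus (\<lambda>x. \<bar>p x\<bar> - \<bar>G x\<bar> - L / real (Suc k))"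
        using integrable_continuous_torus[OF cp] iG by auto
      show "integrable torus (\<lambda>x. h * (r x * m (w x)))"
        using integrable_mult_continuous_torus[OF periodic_C1D(2)[OF w] cmw] by simp
      fix x
      have m1: "\<bar>m (w x)\<bar> \<le> 1" by (auto simp: m_def)
      have G: "G x * m (w x) \<le> \<bar>G x\<bar>"
        using abs_ge_self[of "G x * m (w x)"] mult_left_mono[OF m1 abs_ge_zero[of "G x"]]
        by (simp add: abs_mult)
      have m_pos: "0 \<le> m (w x)" if "0 \<le> w x"
        using mult_nonneg_nonneg[OF of_nat_0_le_iff that, of "Suc k"] unfolding m_def by linarith
      have m_neg: "m (w x) \<le> 0" if "w x \<le> 0"
        using mult_nonneg_nonpos[OF of_nat_0_le_iff that, of "Suc k"] unfolding m_def by linarith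
      have lw: "0 \<le> l * w x * m (w x)"
        using l m_pos m_neg by (cases "0 \<le> w x") (auto simp: zero_le_mult_iff mult_le_0_iff)
      have "\<bar>p x\<bar> - L / real (Suc k) \<le> p x * m (w x)"
      proof (cases "\<bar>w x\<bar> * real (Suc k) < 1")
        case True
        then have "\<bar>w x\<bar> \<le> 1 / real (Suc k)" by (simp add: field_simps)
        then have "\<bar>p x\<bar> \<le> L * (1 / real (Suc k))"
          using lip[of "\<xi>1 x" "\<xi>2 x"] mult_left_mono[OF _ L, of "\<bar>w x\<bar>"]
          by (fastforce simp: p_def w_def)
        moreover have "0 \<le> p x * m (w x)"
          using monoD[OF b(2), of "\<xi>1 x" "\<xi>2 x"] monoD[OF b(2), of "\<xi>2 x" "\<xi>1 x"]
            m_pos m_neg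
          by (cases "0 \<le> w x") (auto simp: p_def w_def zero_le_mult_iff)
        ultimately show ?thesis by simp
      next
        case False
        have "0 \<le> L / real (Suc k)" using L by simp
        moreover have "p x * m (w x) = \<bar>p x\<bar>"
        proof (cases "0 \<le> w x")
          case True
          then have "m (w x) = 1" using False by (simp add: m_def mult.commute)
          then show ?thesis using True monoD[OF b(2), of "\<xi>2 x" "\<xi>1 x"] by (simp add: p_def w_def)
        next
          case neg: False
          have "1 \<le> - (real (Suc k) * w x)" using False neg by (simp add: mult.commute)
          then have "m (w x) = -1" unfolding m_def by linarith
          then show ?thesis using neg monoD[OF b(2), of "\<xi>1 x" "\<xi>2 x"] by (simp add: p_def w_def)
        qed
        ultimately show ?thesis by linarith
      qed
      moreover have "h * (r x * m (w x)) = p x * m (w x) + l * w x * m (w x) - G x * m (w x)"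
        using r[of x] by (simp add: mult.assoc[symmetric]) (simp add: algebra_simps)
      ultimately show "\<bar>p x\<bar> - \<bar>G x\<bar> - L / real (Suc k) \<le> h * (r x * m (w x))"
        using G lw by linarith
    qed
    also note I
    finally show ?thesis
      using integrable_continuous_torus[OF cp] iG by simp
  qed
  have "(\<lambda>k. (\<integral>x. \<bar>G x\<bar> \<partial>torus) + L / real (Suc k)) \<longlonglongrightarrow> (\<integral>x. \<bar>G x\<bar> \<partial>torus) + 0"
    by (intro tendsto_add tendsto_const LIMSEQ_Suc[OF lim_const_over_n])
  then have "(\<integral>x. \<bar>p x\<bar> \<partial>torus) \<le> (\<integral>x. \<bar>G x\<bar> \<partial>torus) + 0"
    by (rule LIMSEQ_le_const) (use est in auto)
  then show ?thesis by (simp add: p_def G_def)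
qed

lemma tikhonov_identity:
  fixes x y :: real
  shows "(x - y) * (l * x - m * y) = (l + m) / 2 * (x - y)\<^sup>2 + (l - m) / 2 * (x\<^sup>2 - y\<^sup>2)"
  by (simp add: power2_eq_square field_simps)

text \<open>
  The same small factor multiplies \<open>p\<close>, hidden in the Yosida approximation, and \<open>\<xi>\<close>. So for the pairs
  \<open>X = (p1, \<xi>1)\<close> and \<open>Y = (p2, \<xi>2)\<close> monotonicity reads \<open>\<integral> (X - Y) \<bullet> (l X - m Y) \<le> 0\<close>, and the identity above
  turns this into a bound of \<open>|X - Y|\<^sup>2\<close> by the difference of the square norms.
\<close>

lemma regularized_tikhonov:
  assumes h: "0 < h" and W: "convex_on UNIV W" and W0: "0 \<in> subdifferential W 0"
    and lm: "0 < m" "m < l"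
    and 1: "periodic_C1 \<xi>1 \<eta>1 (\<lambda>x. (yosida W l (\<xi>1 x) + l * \<xi>1 x - g x) / h)"
    and 2: "periodic_C1 \<xi>2 \<eta>2 (\<lambda>x. (yosida W m (\<xi>2 x) + m * \<xi>2 x - g x) / h)"
    and g: "integrable torus g"
    and p: "p1 = (\<lambda>x. yosida W l (\<xi>1 x))" "p2 = (\<lambda>x. yosida W m (\<xi>2 x))"
  shows "(\<integral>x. (p1 x - p2 x)\<^sup>2 \<partial>torus)
     \<le> (\<integral>x. (p2 x)\<^sup>2 + (\<xi>2 x)\<^sup>2 \<partial>torus) - (\<integral>x. (p1 x)\<^sup>2 + (\<xi>1 x)\<^sup>2 \<partial>torus)"
proof -
  have l: "0 < l" using lm by simp
  define r where "r = (\<lambda>x. (yosida W l (\<xi>1 x) + l * \<xi>1 x - g x) / h - (yosida W m (\<xi>2 x) + m * \<xi>2 x - g x) / h)"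
  have w: "periodic_C1 (\<lambda>x. \<xi>1 x - \<xi>2 x) (\<lambda>x. \<eta>1 x - \<eta>2 x) r"
    using periodic_C1_diff[OF 1 2] by (simp add: r_def)
  have r: "h * r x = p1 x - p2 x + (l * \<xi>1 x - m * \<xi>2 x)" for x
    using h by (simp add: r_def p field_simps)
  have c\<xi>: "continuous_on {0..1} \<xi>1" "continuous_on {0..1} \<xi>2"
    using periodic_C1D(6)[OF 1] periodic_C1D(6)[OF 2] by auto
  have cp: "continuous_on {0..1} p1" "continuous_on {0..1} p2" unfolding p
    by (intro continuous_on_compose2[OF yosida_continuous[OF W W0]] c\<xi> l lm; auto)+
  define D where "D = (\<lambda>x. (p1 x - p2 x)\<^sup>2 + (\<xi>1 x - \<xi>2 x)\<^sup>2)"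
  define N1 where "N1 = (\<lambda>x. (p1 x)\<^sup>2 + (\<xi>1 x)\<^sup>2)"
  define N2 where "N2 = (\<lambda>x. (p2 x)\<^sup>2 + (\<xi>2 x)\<^sup>2)"
  have ints: "integrable torus D" "integrable torus N1" "integrable torus N2"
    unfolding D_def N1_def N2_def by (intro integrable_continuous_torus continuous_intros cp c\<xi>)+
  have "(\<integral>x. r x * (\<xi>1 x - \<xi>2 x) \<partial>torus) \<le> 0"
    by (rule integral_second_deriv_mono_le_0[OF w]) (auto intro: monoI continuous_intros)
  then have "h * (\<integral>x. r x * (\<xi>1 x - \<xi>2 x) \<partial>torus) \<le> 0" using h by (simp add: mult_nonneg_nonpos)
  then have I: "(\<integral>x. h * (r x * (\<xi>1 x - \<xi>2 x)) \<partial>torus) \<le> 0" by simp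
  have "(\<integral>x. (l + m) / 2 * D x + (l - m) / 2 * (N1 x - N2 x) \<partial>torus)
      \<le> (\<integral>x. h * (r x * (\<xi>1 x - \<xi>2 x)) \<partial>torus)"
  proof (rule integral_mono)
    show "integrable torus (\<lambda>x. (l + m) / 2 * D x + (l - m) / 2 * (N1 x - N2 x))"
      using ints by auto
    have "integrable torus (\<lambda>x. r x * (\<xi>1 x - \<xi>2 x))"
      by (intro integrable_mult_continuous_torus periodic_C1D(2)[OF w] continuous_intros c\<xi>)
    then show "integrable torus (\<lambda>x. h * (r x * (\<xi>1 x - \<xi>2 x)))" by simp
    fix x
    have "0 \<le> (p1 x - p2 x) * ((\<xi>1 x - l * p1 x) - (\<xi>2 x - m * p2 x))"
      unfolding p
      by (rule subdifferential_monotone[OF yosida_mem[OF W W0 l] yosida_mem[OF W W0 lm(1)]])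
    then have "(p1 x - p2 x) * (l * p1 x - m * p2 x) \<le> (p1 x - p2 x) * (\<xi>1 x - \<xi>2 x)"
      by (simp add: algebra_simps)
    moreover have "h * (r x * (\<xi>1 x - \<xi>2 x))
        = (p1 x - p2 x) * (\<xi>1 x - \<xi>2 x) + (\<xi>1 x - \<xi>2 x) * (l * \<xi>1 x - m * \<xi>2 x)"
      using r[of x] by (simp add: mult.assoc[symmetric]) (simp add: algebra_simps)
    ultimately show "(l + m) / 2 * D x + (l - m) / 2 * (N1 x - N2 x) \<le> h * (r x * (\<xi>1 x - \<xi>2 x))"
      unfolding tikhonov_identity by (simp add: D_def N1_def N2_def algebra_simps)
  qed
  with I have "(\<integral>x. (l + m) / 2 * D x + (l - m) / 2 * (N1 x - N2 x) \<partial>torus) \<le> 0" by linarith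
  then have "(l + m) * (\<integral>x. D x \<partial>torus) \<le> (l - m) * ((\<integral>x. N2 x \<partial>torus) - (\<integral>x. N1 x \<partial>torus))"
    using ints by (simp add: field_simps)
  moreover have D0: "0 \<le> (\<integral>x. D x \<partial>torus)"
    by (rule Bochner_Integration.integral_nonneg) (simp add: D_def)
  then have "(l - m) * (\<integral>x. D x \<partial>torus) \<le> (l + m) * (\<integral>x. D x \<partial>torus)"
    using lm by (intro mult_right_mono) auto
  ultimately have "(l - m) * (\<integral>x. D x \<partial>torus) \<le> (l - m) * ((\<integral>x. N2 x \<partial>torus) - (\<integral>x. N1 x \<partial>torus))"
    by linarith
  then have "(\<integral>x. D x \<partial>torus) \<le> (\<integral>x. N2 x \<partial>torus) - (\<integral>x. N1 x \<partial>torus)"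
    using lm by simp
  moreover have "(\<integral>x. (p1 x - p2 x)\<^sup>2 \<partial>torus) \<le> (\<integral>x. D x \<partial>torus)"
    by (rule integral_mono) (auto simp: D_def[symmetric] ints intro!: integrable_continuous_torus continuous_intros cp, simp add: D_def)
  ultimately show ?thesis by (simp add: N1_def N2_def)
qed

text \<open>
  Testing with \<open>p\<close> itself bounds \<open>p\<close> by \<open>g\<close> in \<open>L\<^sup>2\<close>; the bound on \<open>\<xi>\<close> follows because \<open>\<xi> - l p\<close> is a
  subgradient of \<open>W\<close>.
\<close>

lemma regularized_energy_bound:
  assumes h: "0 < h" and W: "convex_on UNIV W" and W0: "0 \<in> subdifferential W 0"
    and l: "0 < l" "l \<le> 1"
    and K: "\<And>z p. z \<in> subdifferential W p \<Longrightarrow> \<bar>z\<bar> \<le> K"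
    and \<xi>: "periodic_C1 \<xi> \<eta> (\<lambda>x. (yosida W l (\<xi> x) + l * \<xi> x - g x) / h)"
    and g: "g \<in> borel_measurable torus" "\<And>x. \<bar>g x\<bar> \<le> C"
  shows "(\<integral>x. (yosida W l (\<xi> x))\<^sup>2 + (\<xi> x)\<^sup>2 \<partial>torus) \<le> 3 * C\<^sup>2 + 2 * K\<^sup>2"
proof -
  define p where "p = (\<lambda>x. yosida W l (\<xi> x))"
  have c\<xi>: "continuous_on {0..1} \<xi>" by (rule periodic_C1D[OF \<xi>])
  have cp: "continuous_on {0..1} p" unfolding p_def
    by (intro continuous_on_compose2[OF yosida_continuous[OF W W0 l(1)]] c\<xi>) auto
  define r where "r = (\<lambda>x. (p x + l * \<xi> x - g x) / h)"
  have r: "periodic_C1 \<xi> \<eta> r" using \<xi> by (simp add: r_def p_def)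
  have ip2: "integrable torus (\<lambda>x. (p x)\<^sup>2)"
    by (intro integrable_continuous_torus continuous_intros cp)
  have "(\<integral>x. r x * p x \<partial>torus) \<le> 0"
    unfolding p_def
    by (rule integral_second_deriv_mono_le_0[OF r yosida_continuous yosida_mono]) (fact W W0 l)+
  then have I: "(\<integral>x. h * (r x * p x) \<partial>torus) \<le> 0" using h by (simp add: mult_nonneg_nonpos)
  have "(\<integral>x. (p x)\<^sup>2 / 2 - C\<^sup>2 / 2 \<partial>torus) \<le> (\<integral>x. h * (r x * p x) \<partial>torus)"
  proof (rule integral_mono)
    show "integrable torus (\<lambda>x. (p x)\<^sup>2 / 2 - C\<^sup>2 / 2)" using ip2 by auto
    show "integrable torus (\<lambda>x. h * (r x * p x))"
      using integrable_mult_continuous_torus[OF periodic_C1D(2)[OF r] cp] by simp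
    fix x
    have "(g x)\<^sup>2 \<le> C\<^sup>2" using g(2)[of x] abs_le_square_iff[of "g x" C] by simp
    moreover have "0 \<le> (p x - g x)\<^sup>2" by simp
    ultimately have "g x * p x \<le> (p x)\<^sup>2 / 2 + C\<^sup>2 / 2"
      unfolding power2_diff by (simp add: mult_ac)
    moreover have "0 \<le> l * (p x * \<xi> x)"
      using yosida_sign[OF W W0 l(1)] l by (simp add: p_def)
    moreover have "h * (r x * p x) = (p x)\<^sup>2 + l * (p x * \<xi> x) - g x * p x"
      using h by (simp add: r_def power2_eq_square field_simps)
    ultimately show "(p x)\<^sup>2 / 2 - C\<^sup>2 / 2 \<le> h * (r x * p x)" by linarith
  qed
  with I have "(\<integral>x. (p x)\<^sup>2 / 2 - C\<^sup>2 / 2 \<partial>torus) \<le> 0" by linarith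
  then have P: "(\<integral>x. (p x)\<^sup>2 \<partial>torus) \<le> C\<^sup>2" using ip2 by simp
  have "(\<integral>x. (p x)\<^sup>2 + (\<xi> x)\<^sup>2 \<partial>torus) \<le> (\<integral>x. 3 * (p x)\<^sup>2 + 2 * K\<^sup>2 \<partial>torus)"
  proof (rule integral_mono)
    show "integrable torus (\<lambda>x. (p x)\<^sup>2 + (\<xi> x)\<^sup>2)"
      by (intro integrable_continuous_torus continuous_intros cp c\<xi>)
    show "integrable torus (\<lambda>x. 3 * (p x)\<^sup>2 + 2 * K\<^sup>2)" using ip2 by auto
    fix x
    define z where "z = \<xi> x - l * p x"
    have "\<bar>z\<bar> \<le> K" unfolding z_def p_def by (rule K[OF yosida_mem[OF W W0 l(1)]])
    then have "z\<^sup>2 \<le> K\<^sup>2" using abs_le_square_iff[of z K] by simp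
    moreover have "(l * p x)\<^sup>2 \<le> (p x)\<^sup>2"
      using l by (auto simp: power_mult_distrib intro!: mult_left_le_one_le power_le_one)
    moreover have "(z + l * p x)\<^sup>2 \<le> 2 * z\<^sup>2 + 2 * (l * p x)\<^sup>2"
      using zero_le_power2[of "z - l * p x"] unfolding power2_sum power2_diff by linarith
    moreover have "\<xi> x = z + l * p x" by (simp add: z_def)
    ultimately show "(p x)\<^sup>2 + (\<xi> x)\<^sup>2 \<le> 3 * (p x)\<^sup>2 + 2 * K\<^sup>2" by simp
  qed
  also have "\<dots> = 3 * (\<integral>x. (p x)\<^sup>2 \<partial>torus) + 2 * K\<^sup>2" using ip2 by simp
  finally show ?thesis using P by (simp add: p_def)
qed

section \<open>Completeness of the space of integrable functions\<close>

text \<open>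
  Fatou's lemma in a form that also delivers the integrability of the limit.
\<close>

lemma integral_fatou:
  fixes f :: "nat \<Rightarrow> 'a \<Rightarrow> real"
  assumes int: "\<And>n. integrable M (f n)" and nonneg: "\<And>n. AE x in M. 0 \<le> f n x"
    and lim: "AE x in M. (\<lambda>n. f n x) \<longlonglongrightarrow> F x" and F: "F \<in> borel_measurable M"
    and bound: "\<And>n. (\<integral>x. f n x \<partial>M) \<le> B"
  shows "integrable M F" and "(\<integral>x. F x \<partial>M) \<le> B"
proof -
  have B: "0 \<le> B"
    using bound[of 0] integral_nonneg_AE[OF nonneg[of 0]] by linarith
  have nonneg': "AE x in M. \<forall>n. 0 \<le> f n x" using nonneg by (simp add: AE_all_countable)
  have F0: "AE x in M. 0 \<le> F x"
    using lim nonneg'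
  proof eventually_elim
    case (elim x)
    show ?case by (rule LIMSEQ_le_const[OF elim(1)]) (use elim(2) in auto)
  qed
  have "(\<integral>\<^sup>+x. ennreal (F x) \<partial>M) = (\<integral>\<^sup>+x. liminf (\<lambda>n. ennreal (f n x)) \<partial>M)"
  proof (rule nn_integral_cong_AE)
    show "AE x in M. ennreal (F x) = liminf (\<lambda>n. ennreal (f n x))"
      using lim by eventually_elim (auto intro!: lim_imp_Liminf[symmetric] tendsto_ennrealI)
  qed
  also have "\<dots> \<le> liminf (\<lambda>n. \<integral>\<^sup>+x. ennreal (f n x) \<partial>M)"
    by (rule nn_integral_liminf) (use int in auto)
  also have "\<dots> \<le> liminf (\<lambda>n. ennreal B)"
  proof (rule Liminf_mono, rule always_eventually, rule allI)
    show "(\<integral>\<^sup>+x. ennreal (f n x) \<partial>M) \<le> ennreal B" for n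
      using nn_integral_eq_integral[OF int nonneg, of n] bound[of n] by (simp add: ennreal_leI)
  qed
  also have "\<dots> = ennreal B" by (simp add: Liminf_const)
  finally have le: "(\<integral>\<^sup>+x. ennreal (F x) \<partial>M) \<le> ennreal B" .
  then show i: "integrable M F"
    by (intro integrableI_nonneg F F0) (auto intro: le_less_trans)
  show "(\<integral>x. F x \<partial>M) \<le> B"
    using le B unfolding nn_integral_eq_integral[OF i F0] by simp
qed

text \<open>
  A subsequence converges almost everywhere, and Fatou's lemma along it turns the Cauchy property of the
  whole sequence into convergence to the pointwise limit.
\<close>

lemma L1_limit_exists:
  fixes s :: "nat \<Rightarrow> 'a \<Rightarrow> real"
  assumes int: "\<And>n. integrable M (s n)"
    and cauchy: "\<And>e. e > 0 \<Longrightarrow> \<exists>N. \<forall>i\<ge>N. \<forall>j\<ge>N. (\<integral>x. \<bar>s i x - s j x\<bar> \<partial>M) < e"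
  obtains p and r :: "nat \<Rightarrow> nat" where "strict_mono r" "integrable M p"
    "AE x in M. (\<lambda>n. s (r n) x) \<longlonglongrightarrow> p x" "(\<lambda>n. \<integral>x. \<bar>s n x - p x\<bar> \<partial>M) \<longlonglongrightarrow> 0"
proof -
  obtain r where r: "strict_mono r" "AE x in M. Cauchy (\<lambda>i. s (r i) x)"
    by (rule cauchy_L1_AE_cauchy_subseq[of M s]) (use int cauchy in auto)
  define p where "p = (\<lambda>x. lim (\<lambda>n. s (r n) x))"
  have [measurable]: "\<And>n. s n \<in> borel_measurable M" using int by auto
  have p_meas [measurable]: "p \<in> borel_measurable M" unfolding p_def by measurable
  have lim: "AE x in M. (\<lambda>n. s (r n) x) \<longlonglongrightarrow> p x"
    using r(2) by eventually_elim (simp add: p_def Cauchy_convergent convergent_LIMSEQ_iff[symmetric])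
  have close: "integrable M (\<lambda>x. \<bar>s i x - p x\<bar>) \<and> (\<integral>x. \<bar>s i x - p x\<bar> \<partial>M) \<le> e"
    if N: "\<forall>i\<ge>N. \<forall>j\<ge>N. (\<integral>x. \<bar>s i x - s j x\<bar> \<partial>M) < e" and i: "N \<le> i" for i N e
  proof -
    define f where "f = (\<lambda>n x. \<bar>s i x - s (r (n + N)) x\<bar>)"
    have "integrable M (f n)" "AE x in M. 0 \<le> f n x" for n
      using int by (auto simp: f_def)
    moreover have "AE x in M. (\<lambda>n. f n x) \<longlonglongrightarrow> \<bar>s i x - p x\<bar>"
      using lim unfolding f_def
      by eventually_elim (intro tendsto_intros LIMSEQ_ignore_initial_segment)
    moreover have "(\<integral>x. f n x \<partial>M) \<le> e" for n
      using N i seq_suble[OF r(1), of "n + N"] unfolding f_def by (meson le_add2 less_imp_le order_trans)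
    ultimately show ?thesis
      using integral_fatou[of M f "\<lambda>x. \<bar>s i x - p x\<bar>" e] by auto
  qed
  obtain N where N: "\<forall>i\<ge>N. \<forall>j\<ge>N. (\<integral>x. \<bar>s i x - s j x\<bar> \<partial>M) < 1" using cauchy[of 1] by auto
  have d: "integrable M (\<lambda>x. s N x - p x)"
    using close[OF N order_refl] by (subst integrable_abs_iff[symmetric]) auto
  have ip: "integrable M p" using Bochner_Integration.integrable_diff[OF int[of N] d] by simp
  have "(\<lambda>n. \<integral>x. \<bar>s n x - p x\<bar> \<partial>M) \<longlonglongrightarrow> 0"
  proof (rule LIMSEQ_I)
    fix e :: real assume "0 < e"
    then obtain N where "\<forall>i\<ge>N. \<forall>j\<ge>N. (\<integral>x. \<bar>s i x - s j x\<bar> \<partial>M) < e / 2"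
      using cauchy[of "e / 2"] by auto
    then have "(\<integral>x. \<bar>s i x - p x\<bar> \<partial>M) \<le> e / 2" if "N \<le> i" for i using close that by blast
    moreover have "0 \<le> (\<integral>x. \<bar>s i x - p x\<bar> \<partial>M)" for i by simp
    ultimately show "\<exists>N. \<forall>n\<ge>N. norm ((\<integral>x. \<bar>s n x - p x\<bar> \<partial>M) - 0) < e"
      using \<open>0 < e\<close> by (intro exI[of _ N]) (fastforce intro: le_less_trans)
  qed
  with r(1) ip lim show ?thesis by (rule that)
qed

section \<open>Strong convergence of the regularized slopes\<close>

lemma truncation_L1:
  fixes g :: "'a \<Rightarrow> real"
  assumes g: "integrable M g" and e: "0 < e"
  obtains C where "0 \<le> C" "(\<integral>x. \<bar>g x - max (- C) (min C (g x))\<bar> \<partial>M) < e"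
proof -
  have [measurable]: "g \<in> borel_measurable M" using g by auto
  have "(\<lambda>k. \<integral>x. \<bar>g x - max (- real k) (min (real k) (g x))\<bar> \<partial>M) \<longlonglongrightarrow> (\<integral>x. 0 \<partial>M)"
  proof (rule integral_dominated_convergence)
    show "integrable M (\<lambda>x. \<bar>g x\<bar>)" using g by simp
    show "AE x in M. (\<lambda>k. \<bar>g x - max (- real k) (min (real k) (g x))\<bar>) \<longlonglongrightarrow> 0"
    proof (rule AE_I2)
      fix x
      obtain N where N: "\<bar>g x\<bar> \<le> real N" using real_arch_simple by blast
      have "\<forall>\<^sub>F k in sequentially. \<bar>g x - max (- real k) (min (real k) (g x))\<bar> = 0"
        using eventually_ge_at_top[of N]
      proof eventually_elim
        case (elim k)
        then have "\<bar>g x\<bar> \<le> real k" using N by linarith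
        then show ?case by auto
      qed
      then show "(\<lambda>k. \<bar>g x - max (- real k) (min (real k) (g x))\<bar>) \<longlonglongrightarrow> 0"
        by (rule tendsto_eventually)
    qed
    show "AE x in M. norm \<bar>g x - max (- real k) (min (real k) (g x))\<bar> \<le> \<bar>g x\<bar>" for k
      by (rule AE_I2) (auto simp: max_def min_def)
  qed measurable
  then have "(\<lambda>k. \<integral>x. \<bar>g x - max (- real k) (min (real k) (g x))\<bar> \<partial>M) \<longlonglongrightarrow> 0" by simp
  then have "\<forall>\<^sub>F k in sequentially. (\<integral>x. \<bar>g x - max (- real k) (min (real k) (g x))\<bar> \<partial>M) < e"
    by (rule order_tendstoD) (rule e)
  then obtain k where "(\<integral>x. \<bar>g x - max (- real k) (min (real k) (g x))\<bar> \<partial>M) < e"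
    by (auto simp: eventually_sequentially)
  then show ?thesis by (rule that[rotated]) simp
qed

text \<open>
  The approximations of \<open>p = u\<^sub>x\<close> that belong to approximations \<open>\<xi>\<close> of the flux.
\<close>

definition slope :: "(real \<Rightarrow> real) \<Rightarrow> (nat \<Rightarrow> real \<Rightarrow> real) \<Rightarrow> nat \<Rightarrow> real \<Rightarrow> real" where
  "slope W \<xi> n x = yosida W (inverse (real (Suc n))) (\<xi> n x)"

definition regularized_family ::
    "(real \<Rightarrow> real) \<Rightarrow> real \<Rightarrow> (real \<Rightarrow> real) \<Rightarrow> (nat \<Rightarrow> real \<Rightarrow> real) \<Rightarrow> (nat \<Rightarrow> real \<Rightarrow> real) \<Rightarrow> bool" where
  "regularized_family W h g \<xi> \<eta> \<longleftrightarrow>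
     (\<forall>n. periodic_C1 (\<xi> n) (\<eta> n)
        (\<lambda>x. (yosida W (inverse (real (Suc n))) (\<xi> n x) + inverse (real (Suc n)) * \<xi> n x - g x) / h))"

context
  fixes W :: "real \<Rightarrow> real" and h K :: real
  assumes W: "convex_on UNIV W" and W0: "0 \<in> subdifferential W 0"
    and K: "\<And>z p. z \<in> subdifferential W p \<Longrightarrow> \<bar>z\<bar> \<le> K" and h: "0 < h"
begin





lemma regularized_family_exists:
  assumes g: "integrable torus g"
  obtains \<xi> \<eta> where "regularized_family W h g \<xi> \<eta>"
proof -
  have "\<exists>\<xi> \<eta>. periodic_C1 \<xi> \<eta> (\<lambda>x. (yosida W l (\<xi> x) + l * \<xi> x - g x) / h)" if "0 < l" for l
    by (rule regularized_problem_solvable[OF h that _ g yosida_mono[OF W W0 that] yosida_lipschitz[OF W W0 that]])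
       (use that in simp)
  then have "\<forall>n. \<exists>\<xi> \<eta>. periodic_C1 \<xi> \<eta> (\<lambda>x. (yosida W (inverse (real (Suc n))) (\<xi> x)
      + inverse (real (Suc n)) * \<xi> x - g x) / h)"
    by simp
  then show ?thesis using that unfolding regularized_family_def by metis
qed

lemma continuous_slope:
  assumes "regularized_family W h g \<xi> \<eta>"
  shows "continuous_on {0..1} (\<xi> n)" "continuous_on {0..1} (slope W \<xi> n)"
proof -
  show "continuous_on {0..1} (\<xi> n)"
    using assms periodic_C1D(6) unfolding regularized_family_def by blast
  then show "continuous_on {0..1} (slope W \<xi> n)"
    unfolding slope_def
    by (intro continuous_on_compose2[OF yosida_continuous[OF W W0]]) auto
qed

lemma slope_contraction:
  assumes 1: "regularized_family W h g1 \<xi>1 \<eta>1" and 2: "regularized_family W h g2 \<xi>2 \<eta>2"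
    and g: "integrable torus g1" "integrable torus g2"
  shows "(\<integral>x. \<bar>slope W \<xi>1 n x - slope W \<xi>2 n x\<bar> \<partial>torus) \<le> (\<integral>x. \<bar>g1 x - g2 x\<bar> \<partial>torus)"
  unfolding slope_def by (rule regularized_contraction[OF h _ yosida_continuous[OF W W0] yosida_mono[OF W W0]
        yosida_lipschitz[OF W W0]])
     (use assms in \<open>auto simp: regularized_family_def\<close>)

text \<open>
  For bounded \<open>g\<close> the square norms of \<open>(p, \<xi>)\<close> form a bounded increasing sequence. It converges, and its
  increments dominate the squares of the distances.
\<close>

lemma slope_Cauchy_bounded:
  assumes \<xi>: "regularized_family W h g \<xi> \<eta>"
    and g: "g \<in> borel_measurable torus" "\<And>x. \<bar>g x\<bar> \<le> C" and e: "0 < e"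
  shows "\<exists>N. \<forall>i\<ge>N. \<forall>j\<ge>N. (\<integral>x. \<bar>slope W \<xi> i x - slope W \<xi> j x\<bar> \<partial>torus) < e"
proof -
  define N where "N = (\<lambda>n. \<integral>x. (slope W \<xi> n x)\<^sup>2 + (\<xi> n x)\<^sup>2 \<partial>torus)"
  have ig: "integrable torus g" by (rule integrable_torus_bounded[OF g(1)]) (rule g(2))
  have ints: "integrable torus (\<lambda>x. (slope W \<xi> i x - slope W \<xi> j x)\<^sup>2)"
    "integrable torus (\<lambda>x. \<bar>slope W \<xi> i x - slope W \<xi> j x\<bar>)" for i j
    by (intro integrable_continuous_torus continuous_intros continuous_slope[OF \<xi>])+
  have step: "(\<integral>x. (slope W \<xi> i x - slope W \<xi> j x)\<^sup>2 \<partial>torus) \<le> N j - N i" if "i < j" for i j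
    unfolding N_def
  proof (rule regularized_tikhonov[OF h W W0 _ _ _ _ ig])
    show "0 < inverse (real (Suc j))" "inverse (real (Suc j)) < inverse (real (Suc i))"
      using that by auto
  qed (use \<xi> in \<open>auto simp: regularized_family_def slope_def fun_eq_iff\<close>)
  have "incseq N"
  proof (rule incseq_SucI)
    fix n
    have "0 \<le> (\<integral>x. (slope W \<xi> n x - slope W \<xi> (Suc n) x)\<^sup>2 \<partial>torus)" by simp
    then show "N n \<le> N (Suc n)" using step[of n "Suc n"] by linarith
  qed
  moreover have "N n \<le> 3 * C\<^sup>2 + 2 * K\<^sup>2" for n
    unfolding N_def slope_def
  proof (rule regularized_energy_bound[OF h W W0 _ _ K _ g])
    show "0 < inverse (real (Suc n))" "inverse (real (Suc n)) \<le> 1"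
      by (auto simp: field_simps)
    show "periodic_C1 (\<xi> n) (\<eta> n) (\<lambda>x. (yosida W (inverse (real (Suc n))) (\<xi> n x) + inverse (real (Suc n)) * \<xi> n x - g x) / h)"
      using \<xi> unfolding regularized_family_def by blast
  qed
  ultimately have "convergent N"
    using incseq_convergent unfolding convergent_def by metis
  then have "Cauchy N" by (rule convergent_Cauchy)
  then obtain M where M: "\<And>m n. m \<ge> M \<Longrightarrow> n \<ge> M \<Longrightarrow> norm (N m - N n) < e\<^sup>2"
    using e unfolding Cauchy_iff by (metis zero_less_power)
  have lt: "(\<integral>x. \<bar>slope W \<xi> i x - slope W \<xi> j x\<bar> \<partial>torus) < e" if "i < j" "M \<le> i" for i j
  proof -
    have "(\<integral>x. (slope W \<xi> i x - slope W \<xi> j x)\<^sup>2 \<partial>torus) < e\<^sup>2"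
      using step[OF that(1)] M[of j i] that by auto
    moreover have "(\<integral>x. \<bar>slope W \<xi> i x - slope W \<xi> j x\<bar> \<partial>torus)
        \<le> (\<integral>x. (slope W \<xi> i x - slope W \<xi> j x)\<^sup>2 / (2 * e) + e / 2 \<partial>torus)"
    proof (rule integral_mono)
      show "integrable torus (\<lambda>x. (slope W \<xi> i x - slope W \<xi> j x)\<^sup>2 / (2 * e) + e / 2)"
        using ints by auto
      fix x
      define y where "y = \<bar>slope W \<xi> i x - slope W \<xi> j x\<bar>"
      \<comment> \<open>the \<open>L\<^sup>1\<close> norm is bounded by the \<open>L\<^sup>2\<close> norm through \<open>2 e y \<le> y\<^sup>2 + e\<^sup>2\<close>\<close>
      have "0 \<le> (y - e)\<^sup>2" by simp
      then have "2 * e * y \<le> y\<^sup>2 + e * e" unfolding power2_diff by (simp add: power2_eq_square mult_ac)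
      then have "y \<le> y\<^sup>2 / (2 * e) + e / 2" using e by (simp add: field_simps)
      then show "\<bar>slope W \<xi> i x - slope W \<xi> j x\<bar> \<le> (slope W \<xi> i x - slope W \<xi> j x)\<^sup>2 / (2 * e) + e / 2"
        by (simp add: y_def)
    qed (rule ints)
    moreover have "(\<integral>x. (slope W \<xi> i x - slope W \<xi> j x)\<^sup>2 / (2 * e) + e / 2 \<partial>torus)
        = (\<integral>x. (slope W \<xi> i x - slope W \<xi> j x)\<^sup>2 \<partial>torus) / (2 * e) + e / 2"
      using ints by simp
    moreover have "e\<^sup>2 / (2 * e) = e / 2" using e by (simp add: power2_eq_square)
    ultimately show ?thesis
      using e divide_strict_right_mono[of "\<integral>x. (slope W \<xi> i x - slope W \<xi> j x)\<^sup>2 \<partial>torus" "e\<^sup>2" "2 * e"]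
      by linarith
  qed
  have "(\<integral>x. \<bar>slope W \<xi> i x - slope W \<xi> j x\<bar> \<partial>torus) < e" if "M \<le> i" "M \<le> j" for i j
  proof (cases i j rule: linorder_cases)
    case greater
    then show ?thesis using lt[of j i] that by (simp add: abs_minus_commute)
  qed (use lt that e in auto)
  then show ?thesis by blast
qed

text \<open>
  Truncating \<open>g\<close> changes all slopes by little in \<open>L\<^sup>1\<close>, uniformly in the regularization parameter, by the
  contraction property.
\<close>

lemma slope_Cauchy:
  assumes \<xi>: "regularized_family W h g \<xi> \<eta>" and g: "integrable torus g" and e: "0 < e"
  shows "\<exists>N. \<forall>i\<ge>N. \<forall>j\<ge>N. (\<integral>x. \<bar>slope W \<xi> i x - slope W \<xi> j x\<bar> \<partial>torus) < e"
proof -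
  obtain C where C: "0 \<le> C" "(\<integral>x. \<bar>g x - max (- C) (min C (g x))\<bar> \<partial>torus) < e / 3"
    using truncation_L1[OF g, of "e / 3"] e by auto
  define g' where "g' = (\<lambda>x. max (- C) (min C (g x)))"
  have [measurable]: "g \<in> borel_measurable torus" using g by auto
  have g'm: "g' \<in> borel_measurable torus" unfolding g'_def by measurable
  have g'b: "\<bar>g' x\<bar> \<le> C" for x using C(1) by (auto simp: g'_def)
  have g'i: "integrable torus g'" by (rule integrable_torus_bounded[OF g'm]) (rule g'b)
  obtain \<xi>' \<eta>' where \<xi>': "regularized_family W h g' \<xi>' \<eta>'"
    by (rule regularized_family_exists[OF g'i])
  obtain N where N: "\<And>i j. N \<le> i \<Longrightarrow> N \<le> j \<Longrightarrow> (\<integral>x. \<bar>slope W \<xi>' i x - slope W \<xi>' j x\<bar> \<partial>torus) < e / 3"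
    using slope_Cauchy_bounded[OF \<xi>' g'm g'b, of "e / 3"] e by auto
  have ii: "integrable torus (slope W \<xi> i)" "integrable torus (slope W \<xi>' i)" for i
    by (intro integrable_continuous_torus continuous_slope[OF \<xi>] continuous_slope[OF \<xi>'])+
  have near: "(\<integral>x. \<bar>slope W \<xi> i x - slope W \<xi>' i x\<bar> \<partial>torus) < e / 3" for i
    using slope_contraction[OF \<xi> \<xi>' g g'i, of i] C(2) by (simp add: g'_def)
  have "(\<integral>x. \<bar>slope W \<xi> i x - slope W \<xi> j x\<bar> \<partial>torus) < e" if "N \<le> i" "N \<le> j" for i j
  proof -
    have "(\<integral>x. \<bar>slope W \<xi> i x - slope W \<xi> j x\<bar> \<partial>torus)
      \<le> (\<integral>x. \<bar>slope W \<xi> i x - slope W \<xi>' i x\<bar> + (\<bar>slope W \<xi>' i x - slope W \<xi>' j x\<bar> + \<bar>slope W \<xi> j x - slope W \<xi>' j x\<bar>) \<partial>torus)"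
      by (rule integral_mono)
         (use ii in auto)
    also have "\<dots> = (\<integral>x. \<bar>slope W \<xi> i x - slope W \<xi>' i x\<bar> \<partial>torus)
      + ((\<integral>x. \<bar>slope W \<xi>' i x - slope W \<xi>' j x\<bar> \<partial>torus) + (\<integral>x. \<bar>slope W \<xi> j x - slope W \<xi>' j x\<bar> \<partial>torus))"
      using ii by simp
    finally show ?thesis using near[of i] near[of j] N[OF that] by linarith
  qed
  then show ?thesis by blast
qed

end

section \<open>The dual problem for the flux\<close>

text \<open>
  Composition with such a \<open>\<psi>\<close> is continuous in \<open>L\<^sup>1\<close>, so integral inequalities pass to \<open>L\<^sup>1\<close> limits. Convexity
  is expressed by saying that \<open>\<psi>'\<close> selects subgradients, which is the form used in the estimates.
\<close>

definition convex_lipschitz_pair :: "(real \<Rightarrow> real) \<Rightarrow> (real \<Rightarrow> real) \<Rightarrow> real \<Rightarrow> bool" where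
  "convex_lipschitz_pair \<psi> \<psi>' B \<longleftrightarrow> continuous_on UNIV \<psi>' \<and> mono \<psi>' \<and> (\<forall>x. \<bar>\<psi>' x\<bar> \<le> B) \<and>
     (\<forall>x y. \<psi> x + \<psi>' x * (y - x) \<le> \<psi> y)"

lemma convex_lipschitz_pair_lipschitz:
  assumes "convex_lipschitz_pair \<psi> \<psi>' B"
  shows "\<bar>\<psi> x - \<psi> y\<bar> \<le> B * \<bar>x - y\<bar>"
proof -
  have le: "\<psi> x - \<psi> y \<le> B * \<bar>x - y\<bar>" for x y
  proof -
    have "\<psi> x + \<psi>' x * (y - x) \<le> \<psi> y" using assms by (simp add: convex_lipschitz_pair_def)
    then have "\<psi> x - \<psi> y \<le> \<psi>' x * (x - y)" by (simp add: algebra_simps)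
    also have "\<dots> \<le> \<bar>\<psi>' x\<bar> * \<bar>x - y\<bar>" by (metis abs_ge_self abs_mult)
    also have "\<dots> \<le> B * \<bar>x - y\<bar>"
      using assms by (intro mult_right_mono) (auto simp: convex_lipschitz_pair_def)
    finally show ?thesis .
  qed
  show ?thesis using le[of x y] le[of y x] by (simp add: abs_minus_commute abs_le_iff)
qed

lemma convex_lipschitz_pair_continuous:
  assumes "convex_lipschitz_pair \<psi> \<psi>' B" shows "continuous_on UNIV \<psi>"
proof -
  have "\<bar>\<psi>' 0\<bar> \<le> B" using assms by (simp add: convex_lipschitz_pair_def)
  then have "B-lipschitz_on UNIV \<psi>"
    using convex_lipschitz_pair_lipschitz[OF assms]
    by (intro lipschitz_onI) (auto simp: dist_real_def)
  then show ?thesis by (rule lipschitz_on_continuous_on)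
qed

lemma convex_lipschitz_pair_integrable:
  assumes \<psi>: "convex_lipschitz_pair \<psi> \<psi>' B" and p: "integrable torus p"
  shows "integrable torus (\<lambda>x. \<psi> (p x))"
proof (rule Bochner_Integration.integrable_bound)
  show "integrable torus (\<lambda>x. \<bar>\<psi> 0\<bar> + B * \<bar>p x\<bar>)" using p by auto
  show "(\<lambda>x. \<psi> (p x)) \<in> borel_measurable torus"
    by (rule measurable_compose[OF borel_measurable_integrable[OF p]
          borel_measurable_continuous_onI[OF convex_lipschitz_pair_continuous[OF \<psi>]]])
  show "AE x in torus. norm (\<psi> (p x)) \<le> norm (\<bar>\<psi> 0\<bar> + B * \<bar>p x\<bar>)"
  proof (rule AE_I2)
    fix x
    have "\<bar>\<psi> (p x) - \<psi> 0\<bar> \<le> B * \<bar>p x\<bar>"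
      using convex_lipschitz_pair_lipschitz[OF \<psi>, of "p x" 0] by simp
    then show "norm (\<psi> (p x)) \<le> norm (\<bar>\<psi> 0\<bar> + B * \<bar>p x\<bar>)"
      unfolding real_norm_def by linarith
  qed
qed

context
  fixes W :: "real \<Rightarrow> real" and h K :: real
  assumes W: "convex_on UNIV W" and W0: "0 \<in> subdifferential W 0"
    and K: "\<And>z p. z \<in> subdifferential W p \<Longrightarrow> \<bar>z\<bar> \<le> K" and h: "0 < h"
begin

text \<open>
  By convexity \<open>\<psi>(p) - \<psi>(g) \<le> \<psi>'(p) (p - g)\<close>, and \<open>p - g = h \<xi>\<^sub>x\<^sub>x - l \<xi>\<close> by the equation. The first term
  contributes a nonpositive integral since \<open>\<psi>'(p)\<close> is a nondecreasing function of \<open>\<xi>\<close>; the second is the error.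
\<close>

lemma slope_convex_estimate:
  assumes \<xi>: "regularized_family W h g \<xi> \<eta>" and g: "integrable torus g"
    and \<psi>: "convex_lipschitz_pair \<psi> \<psi>' B"
  shows "(\<integral>x. \<psi> (slope W \<xi> n x) \<partial>torus)
    \<le> (\<integral>x. \<psi> (g x) \<partial>torus) + inverse (real (Suc n)) * (B * (\<integral>x. \<bar>\<xi> n x\<bar> \<partial>torus))"
proof -
  define l where "l = inverse (real (Suc n))"
  have l: "0 < l" by (simp add: l_def)
  define p where "p = (\<lambda>x. yosida W l (\<xi> n x))"
  define r where "r = (\<lambda>x. (p x + l * \<xi> n x - g x) / h)"
  have r: "periodic_C1 (\<xi> n) (\<eta> n) r"
    using \<xi> unfolding regularized_family_def r_def p_def l_def by blast
  have c\<xi>: "continuous_on {0..1} (\<xi> n)" by (rule periodic_C1D[OF r])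
  have cp: "continuous_on {0..1} p"
    unfolding p_def by (intro continuous_on_compose2[OF yosida_continuous[OF W W0 l] c\<xi>]) auto
  have \<psi>': "continuous_on UNIV \<psi>'" "mono \<psi>'" "\<And>x. \<bar>\<psi>' x\<bar> \<le> B" "\<And>x y. \<psi> x + \<psi>' x * (y - x) \<le> \<psi> y"
    using \<psi> by (auto simp: convex_lipschitz_pair_def)
  have c\<psi>p: "continuous_on {0..1} (\<lambda>x. \<psi>' (p x))"
    by (rule continuous_on_compose2[OF \<psi>'(1) cp]) auto
  have "(\<integral>x. r x * \<psi>' (yosida W l (\<xi> n x)) \<partial>torus) \<le> 0"
  proof (rule integral_second_deriv_mono_le_0[OF r])
    show "continuous_on UNIV (\<lambda>y. \<psi>' (yosida W l y))"
      by (rule continuous_on_compose2[OF \<psi>'(1) yosida_continuous[OF W W0 l]]) auto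
    show "mono (\<lambda>y. \<psi>' (yosida W l y))"
      using \<psi>'(2) yosida_mono[OF W W0 l] by (auto simp: mono_def)
  qed
  then have I: "(\<integral>x. h * (r x * \<psi>' (p x)) \<partial>torus) \<le> 0"
    using h by (simp add: p_def mult_nonneg_nonpos)
  have ints: "integrable torus (\<lambda>x. \<psi> (p x))" "integrable torus (\<lambda>x. \<psi> (g x))"
      "integrable torus (\<lambda>x. \<bar>\<xi> n x\<bar>)"
    by (intro convex_lipschitz_pair_integrable[OF \<psi>] g integrable_continuous_torus cp continuous_intros c\<xi>)+
  have "(\<integral>x. \<psi> (p x) - \<psi> (g x) - l * (B * \<bar>\<xi> n x\<bar>) \<partial>torus) \<le> (\<integral>x. h * (r x * \<psi>' (p x)) \<partial>torus)"
  proof (rule integral_mono)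
    show "integrable torus (\<lambda>x. \<psi> (p x) - \<psi> (g x) - l * (B * \<bar>\<xi> n x\<bar>))"
      using ints by auto
    show "integrable torus (\<lambda>x. h * (r x * \<psi>' (p x)))"
      using integrable_mult_continuous_torus[OF periodic_C1D(2)[OF r] c\<psi>p] by simp
    fix x
    have "h * (r x * \<psi>' (p x)) = \<psi>' (p x) * (p x - g x) + l * (\<psi>' (p x) * \<xi> n x)"
      using h by (simp add: r_def field_simps)
    moreover have "\<psi> (p x) - \<psi> (g x) \<le> \<psi>' (p x) * (p x - g x)"
      using \<psi>'(4)[of "p x" "g x"] by (simp add: algebra_simps)
    moreover have "- (B * \<bar>\<xi> n x\<bar>) \<le> \<psi>' (p x) * \<xi> n x"
      using mult_right_mono[OF \<psi>'(3)[of "p x"] abs_ge_zero[of "\<xi> n x"]]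
        abs_ge_minus_self[of "\<psi>' (p x) * \<xi> n x"] by (simp add: abs_mult)
    then have "l * - (B * \<bar>\<xi> n x\<bar>) \<le> l * (\<psi>' (p x) * \<xi> n x)"
      using l by (intro mult_left_mono) auto
    ultimately show "\<psi> (p x) - \<psi> (g x) - l * (B * \<bar>\<xi> n x\<bar>) \<le> h * (r x * \<psi>' (p x))"
      by linarith
  qed
  with I have "(\<integral>x. \<psi> (p x) - \<psi> (g x) - l * (B * \<bar>\<xi> n x\<bar>) \<partial>torus) \<le> 0" by linarith
  then show ?thesis using ints by (simp add: p_def l_def slope_def)
qed

text \<open>
  The slopes \<open>P n\<close> converge in \<open>L\<^sup>1\<close> to some \<open>p\<close>. Hence the approximations \<open>V n = F + h \<eta> n\<close> of the primal
  function, which have the mean of \<open>F\<close> and the derivative \<open>P n + l n * \<xi> n\<close>, converge uniformly, and so do the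
  derivatives \<open>\<eta> n\<close> of the fluxes. The fluxes are thereby determined up to a constant, which is merely
  bounded, so a subsequence along which it converges is chosen.
\<close>

lemma dual_problem_solvable:
  assumes g: "integrable torus g" and g0: "(\<integral>x. g x \<partial>torus) = 0"
    and F: "\<And>x. x \<in> {0..1} \<Longrightarrow> primitive g x = F x - F 0"
  obtains p U \<xi> where "integrable torus p" "(\<integral>x. p x \<partial>torus) = 0"
    "\<And>x. x \<in> {0..1} \<Longrightarrow> primitive p x = U x - U 0"
    "(\<integral>x. (U x - F x) / h \<partial>torus) = 0"
    "\<And>x. x \<in> {0..1} \<Longrightarrow> primitive (\<lambda>x. (U x - F x) / h) x = \<xi> x - \<xi> 0"
    "AE x in torus. \<xi> x \<in> subdifferential W (p x)"
    "\<And>\<psi> \<psi>' B. convex_lipschitz_pair \<psi> \<psi>' B \<Longrightarrow> (\<integral>x. \<psi> (p x) \<partial>torus) \<le> (\<integral>x. \<psi> (g x) \<partial>torus)"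
proof -
  have K0: "0 \<le> K" using K[OF W0] by simp
  obtain \<xi> \<eta> where \<xi>: "regularized_family W h g \<xi> \<eta>"
    by (rule regularized_family_exists[OF W W0 K h g])
  define l where "l = (\<lambda>n. inverse (real (Suc n)))"
  have l: "0 < l n" "l n \<le> 1" for n by (auto simp: l_def field_simps)
  have l0: "l \<longlonglongrightarrow> 0" unfolding l_def by (rule LIMSEQ_inverse_real_of_nat)
  define P where "P = (\<lambda>n x. yosida W (l n) (\<xi> n x))"
  have Pslope: "P n = slope W \<xi> n" for n by (simp add: P_def l_def slope_def fun_eq_iff)
  define r where "r = (\<lambda>n x. (P n x + l n * \<xi> n x - g x) / h)"
  have r: "periodic_C1 (\<xi> n) (\<eta> n) (r n)" for n
    using \<xi> unfolding regularized_family_def r_def P_def l_def by blast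
  have c\<xi>: "continuous_on {0..1} (\<xi> n)" and c\<eta>: "continuous_on {0..1} (\<eta> n)" for n
    by (rule periodic_C1D[OF r])+
  have cP: "continuous_on {0..1} (P n)" for n
    unfolding Pslope by (rule continuous_slope[OF W W0 K h \<xi>])
  have iP: "integrable torus (P n)" and i\<xi>: "integrable torus (\<xi> n)" and i\<eta>: "integrable torus (\<eta> n)" for n
    by (intro integrable_continuous_torus cP c\<xi> c\<eta>)+
  have cauchy: "\<exists>N. \<forall>i\<ge>N. \<forall>j\<ge>N. (\<integral>x. \<bar>P i x - P j x\<bar> \<partial>torus) < e" if "0 < e" for e
    unfolding Pslope by (rule slope_Cauchy[OF W W0 K h \<xi> g that])
  obtain p and s :: "nat \<Rightarrow> nat" where s: "strict_mono s" and ip: "integrable torus p"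
    and P_ae: "AE x in torus. (\<lambda>n. P (s n) x) \<longlonglongrightarrow> p x"
    and P_L1: "(\<lambda>n. \<integral>x. \<bar>P n x - p x\<bar> \<partial>torus) \<longlonglongrightarrow> 0"
    by (rule L1_limit_exists[of torus P, OF iP cauchy])

  \<comment> \<open>\<open>\<xi> n - l n * P n\<close> is a subgradient, so \<open>\<xi> n\<close> is bounded in \<open>L\<^sup>1\<close> and \<open>l n * \<xi> n\<close> vanishes in the limit\<close>
  define A where "A = (\<lambda>n. \<integral>x. \<bar>\<xi> n x\<bar> \<partial>torus)"
  have A_le: "A n \<le> K + (\<integral>x. \<bar>p x\<bar> \<partial>torus) + (\<integral>x. \<bar>P n x - p x\<bar> \<partial>torus)" for n
  proof -
    have "A n \<le> (\<integral>x. K + \<bar>p x\<bar> + \<bar>P n x - p x\<bar> \<partial>torus)"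
      unfolding A_def
    proof (rule integral_mono)
      show "integrable torus (\<lambda>x. K + \<bar>p x\<bar> + \<bar>P n x - p x\<bar>)" using ip iP by auto
      fix x
      have "\<bar>\<xi> n x - l n * P n x\<bar> \<le> K"
        unfolding P_def by (rule K[OF yosida_mem[OF W W0 l(1)]])
      moreover have "\<bar>l n * P n x\<bar> \<le> \<bar>P n x\<bar>"
        using l[of n] by (simp add: abs_mult mult_left_le_one_le)
      ultimately show "\<bar>\<xi> n x\<bar> \<le> K + \<bar>p x\<bar> + \<bar>P n x - p x\<bar>" by linarith
    qed (use i\<xi> in auto)
    then show ?thesis using ip iP by simp
  qed
  have "Bseq (\<lambda>n. \<integral>x. \<bar>P n x - p x\<bar> \<partial>torus)"
    using P_L1 convergentI convergent_imp_Bseq by blast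
  then obtain M where M: "\<And>n. (\<integral>x. \<bar>P n x - p x\<bar> \<partial>torus) \<le> M"
    unfolding Bseq_def by (auto simp: abs_le_iff)
  define A0 where "A0 = K + (\<integral>x. \<bar>p x\<bar> \<partial>torus) + M"
  have A0: "A n \<le> A0" "0 \<le> A n" for n using A_le[of n] M[of n] by (auto simp: A0_def A_def)
  have lA: "(\<lambda>n. l n * A n) \<longlonglongrightarrow> 0"
  proof (rule tendsto_sandwich[OF _ _ tendsto_const tendsto_mult_left_zero[OF l0]])
    show "\<forall>\<^sub>F n in sequentially. 0 \<le> l n * A n"
      using mult_nonneg_nonneg[OF less_imp_le[OF l(1)] A0(2)] by simp
    show "\<forall>\<^sub>F n in sequentially. l n * A n \<le> l n * A0"
      using mult_left_mono[OF A0(1) less_imp_le[OF l(1)]] by simp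
  qed
  define q where "q = (\<lambda>n x. P n x + l n * \<xi> n x)"
  have iq: "integrable torus (q n)" for n unfolding q_def using iP i\<xi> by auto
  define d where "d = (\<lambda>n. \<integral>x. \<bar>q n x - p x\<bar> \<partial>torus)"
  have d0: "d \<longlonglongrightarrow> 0"
  proof (rule tendsto_sandwich[OF _ _ tendsto_const])
    show "\<forall>\<^sub>F n in sequentially. 0 \<le> d n" by (simp add: d_def)
    show "(\<lambda>n. (\<integral>x. \<bar>P n x - p x\<bar> \<partial>torus) + l n * A n) \<longlonglongrightarrow> 0"
      using tendsto_add[OF P_L1 lA] by simp
    have "d n \<le> (\<integral>x. \<bar>P n x - p x\<bar> \<partial>torus) + l n * A n" for n
    proof -
      have "d n \<le> (\<integral>x. \<bar>P n x - p x\<bar> + l n * \<bar>\<xi> n x\<bar> \<partial>torus)"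
        unfolding d_def
      proof (rule integral_mono)
        fix x
        have "\<bar>l n * \<xi> n x\<bar> = l n * \<bar>\<xi> n x\<bar>" using l[of n] by (simp add: abs_mult)
        then show "\<bar>q n x - p x\<bar> \<le> \<bar>P n x - p x\<bar> + l n * \<bar>\<xi> n x\<bar>"
          unfolding q_def by linarith
      qed (use iq ip iP i\<xi> in auto)
      then show ?thesis using ip iP i\<xi> by (simp add: A_def)
    qed
    then show "\<forall>\<^sub>F n in sequentially. d n \<le> (\<integral>x. \<bar>P n x - p x\<bar> \<partial>torus) + l n * A n" by simp
  qed
  have prim_close: "\<bar>primitive (q n) x - primitive p x\<bar> \<le> d n" for n x
    using abs_primitive_le[of "\<lambda>x. q n x - p x" x] iq ip by (simp add: primitive_diff d_def)

  have p_mean: "(\<integral>x. p x \<partial>torus) = 0"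
  proof -
    have "(\<integral>x. q n x \<partial>torus) = 0" for n
    proof -
      have "(\<integral>x. q n x \<partial>torus) = (\<integral>x. h * r n x + g x \<partial>torus)"
        by (rule Bochner_Integration.integral_cong) (use h in \<open>auto simp: r_def q_def field_simps\<close>)
      also have "\<dots> = 0" using periodic_C1D(2,8)[OF r[of n]] g g0 by simp
      finally show ?thesis .
    qed
    then have "\<bar>primitive p 1\<bar> \<le> d n" for n using prim_close[of n 1] by simp
    then have "\<bar>primitive p 1\<bar> \<le> 0" by (intro LIMSEQ_le_const[OF d0]) auto
    then show ?thesis by simp
  qed

  have cF: "continuous_on {0..1} F" by (rule continuous_on_of_primitive[OF g F])
  have iF: "integrable torus F" by (rule integrable_continuous_torus[OF cF])
  have cpp: "continuous_on {0..1} (primitive p)" by (rule continuous_on_primitive[OF ip])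
  define a where "a = (\<integral>x. F x \<partial>torus) - (\<integral>x. primitive p x \<partial>torus)"
  define U where "U = (\<lambda>x. a + primitive p x)"
  have cU: "continuous_on {0..1} U" unfolding U_def by (intro continuous_intros cpp)
  have U0: "primitive p x = U x - U 0" for x
    using primitive_0[OF ip] by (simp add: U_def)
  have U_mean: "(\<integral>x. U x \<partial>torus) = (\<integral>x. F x \<partial>torus)"
    unfolding U_def a_def using integrable_continuous_torus[OF cpp] by simp
  define V where "V = (\<lambda>n x. F x + h * \<eta> n x)"
  have cV: "continuous_on {0..1} (V n)" for n unfolding V_def by (intro continuous_intros cF c\<eta>)
  have V: "V n x - V n 0 = primitive (q n) x" if "x \<in> {0..1}" for n x
  proof -
    have "primitive (q n) x = primitive (\<lambda>x. g x + h * r n x) x"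
      by (rule primitive_cong) (use h in \<open>auto simp: r_def q_def field_simps\<close>)
    also have "\<dots> = (F x - F 0) + h * (\<eta> n x - \<eta> n 0)"
      using F[OF that] periodic_C1D(2,3)[OF r] that g by (simp add: primitive_add primitive_cmult)
    finally show ?thesis by (simp add: V_def algebra_simps)
  qed
  have VU: "\<bar>V n x - U x\<bar> \<le> 2 * d n" if "x \<in> {0..1}" for n x
  proof -
    have "(\<integral>x. V n x \<partial>torus) = (\<integral>x. F x \<partial>torus)"
      unfolding V_def using iF i\<eta> periodic_C1D(9)[OF r] by simp
    moreover have "(\<integral>x. V n x \<partial>torus) = (\<integral>x. V n 0 + primitive (q n) x \<partial>torus)"
      by (rule Bochner_Integration.integral_cong) (auto simp: V[symmetric])
    ultimately have "V n 0 - a = (\<integral>x. primitive p x \<partial>torus) - (\<integral>x. primitive (q n) x \<partial>torus)"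
      using integrable_continuous_torus[OF continuous_on_primitive[OF iq]] by (simp add: a_def)
    also have "\<dots> = (\<integral>x. primitive p x - primitive (q n) x \<partial>torus)"
      using integrable_continuous_torus[OF continuous_on_primitive[OF iq]]
        integrable_continuous_torus[OF cpp] by simp
    finally have "\<bar>V n 0 - a\<bar> \<le> (\<integral>x. \<bar>primitive p x - primitive (q n) x\<bar> \<partial>torus)"
      using integral_abs_bound by metis
    also have "\<dots> \<le> (\<integral>x. d n \<partial>torus)"
      using prim_close integrable_continuous_torus[OF continuous_on_primitive[OF iq]]
        integrable_continuous_torus[OF cpp]
      by (intro integral_mono) (auto simp: abs_minus_commute)
    finally have "\<bar>V n 0 - a\<bar> \<le> d n" by simp
    then show ?thesis using V[OF that, of n] prim_close[of n x] unfolding U_def by linarith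
  qed

  define \<eta>' where "\<eta>' = (\<lambda>x. (U x - F x) / h)"
  have c\<eta>': "continuous_on {0..1} \<eta>'" unfolding \<eta>'_def by (intro continuous_intros cU cF) (use h in auto)
  have i\<eta>': "integrable torus \<eta>'" by (rule integrable_continuous_torus[OF c\<eta>'])
  have \<eta>_close: "\<bar>\<eta> n x - \<eta>' x\<bar> \<le> 2 * d n / h" if "x \<in> {0..1}" for n x
  proof -
    have "\<eta> n x - \<eta>' x = (V n x - U x) / h" using h by (simp add: \<eta>'_def V_def field_simps)
    then show ?thesis using VU[OF that, of n] h by (simp add: abs_divide divide_right_mono)
  qed
  have prim_\<eta>: "\<bar>primitive (\<eta> n) x - primitive \<eta>' x\<bar> \<le> 2 * d n / h" for n x
  proof -
    have "\<bar>primitive (\<eta> n) x - primitive \<eta>' x\<bar> \<le> (\<integral>x. \<bar>\<eta> n x - \<eta>' x\<bar> \<partial>torus)"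
      using abs_primitive_le[of "\<lambda>x. \<eta> n x - \<eta>' x" x] i\<eta> i\<eta>' by (simp add: primitive_diff)
    also have "\<dots> \<le> (\<integral>x. 2 * d n / h \<partial>torus)"
      using \<eta>_close i\<eta> i\<eta>' by (intro integral_mono) auto
    finally show ?thesis by simp
  qed
  have "Bseq d" using d0 convergentI convergent_imp_Bseq by blast
  then obtain D where D: "\<And>n. d n \<le> D"
    unfolding Bseq_def by (auto simp: abs_le_iff)
  define C where "C = A0 + ((\<integral>x. \<bar>\<eta>' x\<bar> \<partial>torus) + 2 * D / h)"
  have "\<xi> (s n) 0 \<in> {-C..C}" for n
  proof -
    have "\<bar>\<xi> m 0\<bar> \<le> C" for m
    proof -
      have "\<bar>primitive (\<eta> m) x\<bar> \<le> (\<integral>x. \<bar>\<eta>' x\<bar> \<partial>torus) + 2 * D / h" for x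
        using prim_\<eta>[of m x] abs_primitive_le[OF i\<eta>', of x] D[of m] h
          divide_right_mono[of "2 * d m" "2 * D" h] by linarith
      moreover have "\<xi> m 0 = \<xi> m x - primitive (\<eta> m) x" if "x \<in> {0..1}" for x
        using periodic_C1D(10)[OF r that, of m] by simp
      ultimately have le: "\<bar>\<xi> m 0\<bar> \<le> \<bar>\<xi> m x\<bar> + ((\<integral>x. \<bar>\<eta>' x\<bar> \<partial>torus) + 2 * D / h)" if "x \<in> {0..1}" for x
        using that by (smt (verit))
      have "(\<integral>x. \<bar>\<xi> m 0\<bar> \<partial>torus) \<le> (\<integral>x. \<bar>\<xi> m x\<bar> + ((\<integral>x. \<bar>\<eta>' x\<bar> \<partial>torus) + 2 * D / h) \<partial>torus)"
        by (rule integral_mono) (use le i\<xi> in auto)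
      then have "\<bar>\<xi> m 0\<bar> \<le> A m + ((\<integral>x. \<bar>\<eta>' x\<bar> \<partial>torus) + 2 * D / h)"
        using i\<xi> by (simp add: A_def)
      then show ?thesis using A0(1)[of m] by (simp add: C_def)
    qed
    then show ?thesis by (auto simp: abs_le_iff minus_le_iff)
  qed
  then obtain \<kappa> and t :: "nat \<Rightarrow> nat" where t: "strict_mono t" and \<kappa>: "((\<lambda>n. \<xi> (s n) 0) \<circ> t) \<longlonglongrightarrow> \<kappa>"
    using seq_compactE[OF compact_imp_seq_compact[OF compact_Icc], of "\<lambda>n. \<xi> (s n) 0" "-C" C] by metis
  define \<sigma> where "\<sigma> = (\<lambda>n. s (t n))"
  have \<sigma>: "strict_mono \<sigma>" using s t by (auto simp: \<sigma>_def strict_mono_def)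
  define \<xi>' where "\<xi>' = (\<lambda>x. \<kappa> + primitive \<eta>' x)"
  have \<xi>'0: "primitive \<eta>' x = \<xi>' x - \<xi>' 0" for x
    using primitive_0[OF i\<eta>'] by (simp add: \<xi>'_def)
  have \<xi>_lim: "(\<lambda>n. \<xi> (\<sigma> n) x) \<longlonglongrightarrow> \<xi>' x" if "x \<in> {0..1}" for x
  proof -
    have "(\<lambda>n. primitive (\<eta> n) x - primitive \<eta>' x) \<longlonglongrightarrow> 0"
    proof (rule Lim_null_comparison)
      show "\<forall>\<^sub>F n in sequentially. norm (primitive (\<eta> n) x - primitive \<eta>' x) \<le> 2 * d n / h"
        using prim_\<eta> by simp
      show "(\<lambda>n. 2 * d n / h) \<longlonglongrightarrow> 0"
        using tendsto_divide_zero[OF tendsto_mult_right_zero[OF d0]] by simp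
    qed
    then have "(\<lambda>n. primitive (\<eta> n) x) \<longlonglongrightarrow> primitive \<eta>' x" by (simp add: LIM_zero_iff)
    from LIMSEQ_subseq_LIMSEQ[OF this \<sigma>]
    have "(\<lambda>n. \<xi> (\<sigma> n) 0 + primitive (\<eta> (\<sigma> n)) x) \<longlonglongrightarrow> \<kappa> + primitive \<eta>' x"
      using \<kappa> by (intro tendsto_add) (auto simp: \<sigma>_def o_def)
    moreover have "\<xi> (\<sigma> n) 0 + primitive (\<eta> (\<sigma> n)) x = \<xi> (\<sigma> n) x" for n
      using periodic_C1D(10)[OF r that] by simp
    ultimately show ?thesis by (simp add: \<xi>'_def)
  qed
  have sub: "AE x in torus. \<xi>' x \<in> subdifferential W (p x)"
    using P_ae AE_space
  proof eventually_elim
    case (elim x)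
    have Plim: "(\<lambda>n. P (\<sigma> n) x) \<longlonglongrightarrow> p x"
      using LIMSEQ_subseq_LIMSEQ[OF elim(1) t] by (simp add: \<sigma>_def o_def)
    have "(\<lambda>n. \<xi> (\<sigma> n) x - l (\<sigma> n) * P (\<sigma> n) x) \<longlonglongrightarrow> \<xi>' x - 0 * p x"
      using elim(2) LIMSEQ_subseq_LIMSEQ[OF l0 \<sigma>]
      by (intro tendsto_intros \<xi>_lim Plim) (auto simp: o_def)
    then have "(\<lambda>n. \<xi> (\<sigma> n) x - l (\<sigma> n) * P (\<sigma> n) x) \<longlonglongrightarrow> \<xi>' x" by simp
    then show ?case
      by (rule subdifferential_closed[OF convex_continuous_UNIV[OF W] _ Plim])
         (simp add: P_def yosida_mem[OF W W0 l(1)])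
  qed
  have est: "(\<integral>x. \<psi> (p x) \<partial>torus) \<le> (\<integral>x. \<psi> (g x) \<partial>torus)" if \<psi>: "convex_lipschitz_pair \<psi> \<psi>' B" for \<psi> \<psi>' B
  proof -
    have le: "(\<integral>x. \<psi> (p x) \<partial>torus)
        \<le> (\<integral>x. \<psi> (g x) \<partial>torus) + B * (l n * A n) + B * (\<integral>x. \<bar>P n x - p x\<bar> \<partial>torus)" for n
    proof -
      have ints: "integrable torus (\<lambda>x. \<psi> (p x))" "integrable torus (\<lambda>x. \<psi> (P n x))"
        using convex_lipschitz_pair_integrable[OF \<psi>] ip iP by auto
      have "(\<integral>x. \<psi> (p x) \<partial>torus) \<le> (\<integral>x. \<psi> (P n x) + B * \<bar>P n x - p x\<bar> \<partial>torus)"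
      proof (rule integral_mono)
        show "\<psi> (p x) \<le> \<psi> (P n x) + B * \<bar>P n x - p x\<bar>" for x
          using convex_lipschitz_pair_lipschitz[OF \<psi>, of "P n x" "p x"] by linarith
      qed (use ints ip iP in auto)
      also have "\<dots> = (\<integral>x. \<psi> (P n x) \<partial>torus) + B * (\<integral>x. \<bar>P n x - p x\<bar> \<partial>torus)"
        using ints ip iP by simp
      finally show ?thesis
        using slope_convex_estimate[OF \<xi> g \<psi>, of n] by (simp add: Pslope[symmetric] l_def A_def mult_ac)
    qed
    have "(\<lambda>n. (\<integral>x. \<psi> (g x) \<partial>torus) + B * (l n * A n) + B * (\<integral>x. \<bar>P n x - p x\<bar> \<partial>torus))
        \<longlonglongrightarrow> (\<integral>x. \<psi> (g x) \<partial>torus) + B * 0 + B * 0"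
      by (intro tendsto_intros lA P_L1)
    then have "(\<integral>x. \<psi> (p x) \<partial>torus) \<le> (\<integral>x. \<psi> (g x) \<partial>torus) + B * 0 + B * 0"
      by (rule LIMSEQ_le_const) (use le in auto)
    then show ?thesis by simp
  qed
  show ?thesis
  proof (rule that[OF ip p_mean U0 _ _ sub est])
    show "(\<integral>x. (U x - F x) / h \<partial>torus) = 0"
      using integrable_continuous_torus[OF cU] iF U_mean by simp
    show "primitive (\<lambda>x. (U x - F x) / h) x = \<xi>' x - \<xi>' 0" for x
      using \<xi>'0[of x] by (simp add: \<eta>'_def)
  qed
qed

end

section \<open>Test functions and weak derivatives\<close>

lemma smoothD:
  assumes "smooth \<phi>"
  shows "(\<phi> has_real_derivative deriv \<phi> x) (at x)" and "smooth (deriv \<phi>)"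
    and "continuous_on A \<phi>" and "continuous_on A (deriv \<phi>)"
proof -
  have d: "(\<phi> has_real_derivative deriv \<phi> x) (at x)" if "smooth \<phi>" for \<phi> x
  proof -
    have "(deriv ^^ 0) \<phi> differentiable at x" using that unfolding smooth_def by blast
    then show ?thesis by (simp add: DERIV_deriv_iff_real_differentiable)
  qed
  show "(\<phi> has_real_derivative deriv \<phi> x) (at x)" by (rule d[OF assms])
  show s: "smooth (deriv \<phi>)"
    unfolding smooth_def
  proof (intro allI)
    fix n x
    have "(deriv ^^ Suc n) \<phi> differentiable at x" using assms unfolding smooth_def by blast
    then show "(deriv ^^ n) (deriv \<phi>) differentiable at x" by (simp only: funpow_Suc_right o_apply)
  qed
  have c: "continuous_on A \<phi>" if "smooth \<phi>" for \<phi>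
    using d[OF that] by (meson DERIV_isCont continuous_at_imp_continuous_on)
  show "continuous_on A \<phi>" "continuous_on A (deriv \<phi>)" using c assms s by auto
qed

lemma smooth_antiderivative:
  assumes "smooth \<phi>" "\<And>x. (A has_real_derivative \<phi> x) (at x)"
  shows "smooth A"
  unfolding smooth_def
proof (intro allI)
  fix n x
  have dA: "deriv A = \<phi>" using DERIV_imp_deriv[OF assms(2)] by auto
  show "(deriv ^^ n) A differentiable at x"
  proof (cases n)
    case 0
    then show ?thesis using assms(2) by (auto simp: real_differentiable_def)
  next
    case (Suc k)
    then show ?thesis using assms(1) dA unfolding smooth_def by (simp only: funpow_Suc_right o_apply)
  qed
qed

text \<open>
  A class of functions that is closed under differentiation consists of smooth functions. This avoids any
  formula for higher derivatives.
\<close>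

lemma smooth_coinduct:
  assumes "f \<in> X" "\<And>f. f \<in> X \<Longrightarrow> \<exists>f'\<in>X. \<forall>x. (f has_real_derivative f' x) (at x)"
  shows "smooth f"
proof -
  have "deriv f \<in> X" if "f \<in> X" for f
    using assms(2)[OF that] DERIV_imp_deriv by (metis ext)
  then have "(deriv ^^ n) f \<in> X" for n
    using assms(1) by (induction n) auto
  then show ?thesis
    unfolding smooth_def real_differentiable_def using assms(2) by blast
qed

text \<open>
  If the generators have derivatives inside the algebra, then the whole algebra is closed under
  differentiation, by the sum and product rules.
\<close>

inductive_set generated_algebra :: "(real \<Rightarrow> real) set \<Rightarrow> (real \<Rightarrow> real) set"
  for G :: "(real \<Rightarrow> real) set" where
  gen: "f \<in> G \<Longrightarrow> f \<in> generated_algebra G"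
| const: "(\<lambda>x. c) \<in> generated_algebra G"
| add: "f \<in> generated_algebra G \<Longrightarrow> g \<in> generated_algebra G \<Longrightarrow> (\<lambda>x. f x + g x) \<in> generated_algebra G"
| mult: "f \<in> generated_algebra G \<Longrightarrow> g \<in> generated_algebra G \<Longrightarrow> (\<lambda>x. f x * g x) \<in> generated_algebra G"

lemmas generated_algebra_closed =
  generated_algebra.const generated_algebra.add generated_algebra.mult

lemma generated_algebra_deriv:
  assumes "f \<in> generated_algebra G"
    and gen: "\<And>f. f \<in> G \<Longrightarrow> \<exists>f'\<in>generated_algebra G. \<forall>x. (f has_real_derivative f' x) (at x)"
  shows "\<exists>f'\<in>generated_algebra G. \<forall>x. (f has_real_derivative f' x) (at x)"
  using assms(1)
proof induction
  case (gen f)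
  then show ?case by (rule assms(2))
next
  case (const c)
  show ?case by (rule bexI[OF _ generated_algebra.const[of 0]]) auto
next
  case (add f g)
  then obtain f' g' where "f' \<in> generated_algebra G" "g' \<in> generated_algebra G"
    "\<And>x. (f has_real_derivative f' x) (at x)" "\<And>x. (g has_real_derivative g' x) (at x)" by blast
  then show ?case
    by (intro bexI[OF _ generated_algebra.add[of f' G g']] allI DERIV_add) auto
next
  case (mult f g)
  then obtain f' g' where d: "f' \<in> generated_algebra G" "g' \<in> generated_algebra G"
    "\<And>x. (f has_real_derivative f' x) (at x)" "\<And>x. (g has_real_derivative g' x) (at x)" by blast
  have "(\<lambda>x. f' x * g x + g' x * f x) \<in> generated_algebra G"
    by (intro generated_algebra_closed d mult)
  then show ?case
    by (rule bexI[rotated]) (intro allI DERIV_mult d)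
qed

abbreviation trig_polynomials :: "(real \<Rightarrow> real) set" where
  "trig_polynomials \<equiv> generated_algebra {\<lambda>x. sin (2 * pi * x), \<lambda>x. cos (2 * pi * x)}"

lemma trig_generators:
  "(\<lambda>x. sin (2 * pi * x)) \<in> trig_polynomials" "(\<lambda>x. cos (2 * pi * x)) \<in> trig_polynomials"
  by (rule generated_algebra.gen, simp)+

lemma trig_polynomials_test:
  assumes "f \<in> trig_polynomials" shows "f \<in> torus_test_functions"
proof -
  have gens: "\<exists>f'\<in>trig_polynomials. \<forall>x. (f has_real_derivative f' x) (at x)"
    if "f \<in> {\<lambda>x. sin (2 * pi * x), \<lambda>x. cos (2 * pi * x)}" for f
  proof -
    have d: "((\<lambda>x. sin (2 * pi * x)) has_real_derivative 2 * pi * cos (2 * pi * x)) (at x)"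
      "((\<lambda>x. cos (2 * pi * x)) has_real_derivative - (2 * pi) * sin (2 * pi * x)) (at x)" for x
      by (auto intro!: derivative_eq_intros)
    have mem: "(\<lambda>x. 2 * pi * cos (2 * pi * x)) \<in> trig_polynomials"
      "(\<lambda>x. - (2 * pi) * sin (2 * pi * x)) \<in> trig_polynomials"
      by (intro generated_algebra_closed trig_generators)+
    from that consider "f = (\<lambda>x. sin (2 * pi * x))" | "f = (\<lambda>x. cos (2 * pi * x))" by fast
    then show ?thesis
    proof cases
      case 1
      show ?thesis unfolding 1 by (rule bexI[OF _ mem(1)], rule allI, rule d(1))
    next
      case 2
      show ?thesis unfolding 2 by (rule bexI[OF _ mem(2)], rule allI, rule d(2))
    qed
  qed
  have "smooth f" by (rule smooth_coinduct[OF assms generated_algebra_deriv]) (auto intro: gens)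
  moreover have "\<forall>x. f (x + 1) = f x"
    using assms by induction (auto simp: distrib_left sin_add cos_add)
  ultimately show ?thesis by (simp add: torus_test_functions_def)
qed

lemma cos_abs_2pi: "cos (2 * pi * \<bar>t\<bar>) = cos (2 * pi * t)"
  by (cases "0 \<le> t") auto

lemma cos_le_of_dist:
  assumes "0 \<le> d" "d \<le> \<bar>t\<bar>" "\<bar>t\<bar> \<le> 1 - d"
  shows "cos (2 * pi * t) \<le> cos (2 * pi * d)"
proof -
  note abs = cos_abs_2pi[of t, symmetric]
  show ?thesis
  proof (cases "\<bar>t\<bar> \<le> 1 / 2")
    case True
    then show ?thesis unfolding abs using assms by (intro cos_monotone_0_pi_le) auto
  next
    case False
    have "cos (2 * pi * \<bar>t\<bar>) = cos (2 * pi * (1 - \<bar>t\<bar>))"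
      by (simp add: right_diff_distrib cos_diff)
    also have "\<dots> \<le> cos (2 * pi * d)" using assms False by (intro cos_monotone_0_pi_le) auto
    finally show ?thesis unfolding abs .
  qed
qed

text \<open>
  The classical argument for the completeness of the trigonometric system. The powers of the polynomial
  \<open>T\<close> concentrate at \<open>a\<close>: it is at least \<open>\<tau> > 1\<close> near \<open>a\<close>, at least \<open>1\<close> on a larger neighbourhood on which
  \<open>\<Omega>\<close> is positive, and bounded by \<open>1\<close> in absolute value elsewhere.
\<close>

lemma continuous_pos_not_orthogonal:
  assumes cont: "continuous_on {0..1} \<Omega>" and a: "0 < a" "a < 1" and pos: "0 < \<Omega> a"
  shows "\<exists>\<phi>\<in>trig_polynomials. (\<integral>x. \<Omega> x * \<phi> x \<partial>torus) \<noteq> 0"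
proof (rule ccontr)
  assume "\<not> ?thesis"
  then have orth: "(\<integral>x. \<Omega> x * \<phi> x \<partial>torus) = 0" if "\<phi> \<in> trig_polynomials" for \<phi> using that by blast
  define e where "e = \<Omega> a / 2"
  have e: "0 < e" using pos by (simp add: e_def)
  obtain d0 where d0: "0 < d0" "\<And>x. x \<in> {0..1} \<Longrightarrow> \<bar>x - a\<bar> < d0 \<Longrightarrow> \<bar>\<Omega> x - \<Omega> a\<bar> < e"
    using cont a e unfolding continuous_on_iff by (force simp: dist_real_def)
  define d where "d = min (d0 / 2) (min (1 / 4) (min a (1 - a)))"
  have d: "0 < d" "d < d0" "d \<le> 1 / 4" "d \<le> a" "d \<le> 1 - a"
    unfolding d_def using d0(1) a by linarith+
  have \<Omega>: "e \<le> \<Omega> x" if "x \<in> {0..1}" "\<bar>x - a\<bar> \<le> d" for x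
  proof -
    have "\<bar>\<Omega> x - \<Omega> a\<bar> < e" by (rule d0(2)[OF that(1)]) (use that(2) d in linarith)
    moreover have "\<Omega> a = 2 * e" by (simp add: e_def)
    ultimately show ?thesis by linarith
  qed
  define T where "T = (\<lambda>x. cos (2 * pi * (x - a)) + (1 - cos (2 * pi * d)))"
  define \<tau> where "\<tau> = cos (2 * pi * (d / 2)) + (1 - cos (2 * pi * d))"
  have "cos (2 * pi * d) < cos (2 * pi * (d / 2))"
    using d by (intro cos_monotone_0_pi) auto
  then have \<tau>: "1 < \<tau>" by (simp add: \<tau>_def)
  have T_far: "\<bar>T x\<bar> \<le> 1" if "x \<in> {0..1}" "d \<le> \<bar>x - a\<bar>" for x
  proof -
    have "cos (2 * pi * (x - a)) \<le> cos (2 * pi * d)"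
      by (rule cos_le_of_dist) (use that d a in auto)
    then show ?thesis using cos_ge_minus_one[of "2 * pi * (x - a)"] cos_le_one[of "2 * pi * d"]
      unfolding T_def by linarith
  qed
  have T_near: "1 \<le> T x" if "\<bar>x - a\<bar> \<le> d" for x
  proof -
    have "cos (2 * pi * d) \<le> cos (2 * pi * \<bar>x - a\<bar>)"
      using that d by (intro cos_monotone_0_pi_le) auto
    also note cos_abs_2pi
    finally show ?thesis by (simp add: T_def)
  qed
  have T_close: "\<tau> \<le> T x" if "\<bar>x - a\<bar> \<le> d / 2" for x
  proof -
    have "cos (2 * pi * (d / 2)) \<le> cos (2 * pi * \<bar>x - a\<bar>)"
      using that d by (intro cos_monotone_0_pi_le) auto
    also note cos_abs_2pi
    finally show ?thesis by (simp add: T_def \<tau>_def)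
  qed
  have T_trig: "(\<lambda>x. T x ^ n) \<in> trig_polynomials" for n
  proof (induction n)
    case 0
    show ?case using generated_algebra.const[of 1] by simp
  next
    case (Suc n)
    have "(\<lambda>x. (cos (2 * pi * x) * cos (2 * pi * a) + sin (2 * pi * x) * sin (2 * pi * a))
        + (1 - cos (2 * pi * d))) \<in> trig_polynomials"
      by (intro generated_algebra_closed trig_generators)
    then have "T \<in> trig_polynomials"
      unfolding T_def by (simp add: right_diff_distrib cos_diff)
    from generated_algebra.mult[OF this Suc] show ?case by simp
  qed
  have i\<Omega>: "integrable torus \<Omega>" by (rule integrable_continuous_torus[OF cont])
  have ind: "(\<integral>x. c * indicator {a - d / 2..a + d / 2} x \<partial>torus) = c * d" for c
    using torus_integral_Icc[of "\<lambda>x. c" "a - d / 2" "a + d / 2"] d by simp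
  have le: "e * \<tau> ^ n * d \<le> (\<integral>x. \<bar>\<Omega> x\<bar> \<partial>torus)" for n
  proof -
    have ii: "integrable torus (\<lambda>x. e * \<tau> ^ n * indicator {a - d / 2..a + d / 2} x :: real)"
      by (rule integrable_mult_indicator_torus) simp
    have "(\<integral>x. e * \<tau> ^ n * indicator {a - d / 2..a + d / 2} x - \<bar>\<Omega> x\<bar> \<partial>torus) \<le> (\<integral>x. \<Omega> x * T x ^ n \<partial>torus)"
    proof (rule integral_mono)
      show "integrable torus (\<lambda>x. e * \<tau> ^ n * indicator {a - d / 2..a + d / 2} x - \<bar>\<Omega> x\<bar>)"
        using ii i\<Omega> by simp
      show "integrable torus (\<lambda>x. \<Omega> x * T x ^ n)"
        by (intro integrable_mult_continuous_torus i\<Omega>) (auto simp: T_def intro!: continuous_intros)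
      fix x assume "x \<in> space torus"
      then have x: "x \<in> {0..1}" by auto
      consider "\<bar>x - a\<bar> \<le> d / 2" | "d / 2 < \<bar>x - a\<bar>" "\<bar>x - a\<bar> \<le> d" | "d \<le> \<bar>x - a\<bar>" "d / 2 < \<bar>x - a\<bar>"
        by linarith
      then show "e * \<tau> ^ n * indicator {a - d / 2..a + d / 2} x - \<bar>\<Omega> x\<bar> \<le> \<Omega> x * T x ^ n"
      proof cases
        case 1
        have "e * \<tau> ^ n \<le> \<Omega> x * T x ^ n"
          using \<Omega>[OF x] T_close[OF 1] 1 d e \<tau> by (intro mult_mono power_mono) auto
        moreover have "x \<in> {a - d / 2..a + d / 2}" unfolding atLeastAtMost_iff using 1 by linarith
        ultimately show ?thesis by simp
      next
        case 2
        have "0 \<le> \<Omega> x * T x ^ n" using \<Omega>[OF x 2(2)] T_near[OF 2(2)] e by simp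
        moreover have "x \<notin> {a - d / 2..a + d / 2}" unfolding atLeastAtMost_iff using 2 by linarith
        ultimately show ?thesis by simp
      next
        case 3
        have "\<bar>\<Omega> x * T x ^ n\<bar> \<le> \<bar>\<Omega> x\<bar> * 1"
          unfolding abs_mult power_abs using T_far[OF x 3(1)]
          by (intro mult_left_mono power_le_one) auto
        moreover have "x \<notin> {a - d / 2..a + d / 2}" unfolding atLeastAtMost_iff using 3 by linarith
        ultimately show ?thesis by simp
      qed
    qed
    also have "\<dots> = 0" by (rule orth[OF T_trig])
    finally show ?thesis
      unfolding Bochner_Integration.integral_diff[OF ii integrable_abs[OF i\<Omega>]] ind by simp
  qed
  obtain n where "(\<integral>x. \<bar>\<Omega> x\<bar> \<partial>torus) / (e * d) < \<tau> ^ n" using real_arch_pow[OF \<tau>] by blast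
  then have "(\<integral>x. \<bar>\<Omega> x\<bar> \<partial>torus) < e * \<tau> ^ n * d" using e d by (simp add: field_simps)
  then show False using le[of n] by linarith
qed

lemma continuous_eq_0_of_orthogonal:
  assumes cont: "continuous_on {0..1} \<Omega>"
    and orth: "\<And>\<phi>. \<phi> \<in> torus_test_functions \<Longrightarrow> (\<integral>x. \<Omega> x * \<phi> x \<partial>torus) = 0"
    and x: "x \<in> {0..1}"
  shows "\<Omega> x = 0"
proof -
  have "\<Omega> a = 0" if a: "0 < a" "a < 1" for a
  proof -
    have "\<not> 0 < \<Omega> a"
      using continuous_pos_not_orthogonal[OF cont a] orth trig_polynomials_test by blast
    moreover have "\<not> 0 < - \<Omega> a"
      using continuous_pos_not_orthogonal[OF continuous_on_minus[OF cont] a] orth trig_polynomials_test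
      by fastforce
    ultimately show ?thesis by linarith
  qed
  then have "\<And>y. y \<in> {0<..<1} \<Longrightarrow> \<Omega> y = 0" by simp
  moreover have "x \<in> closure {0<..<1}" using x by simp
  ultimately show ?thesis
    using continuous_constant_on_closure[of "{0<..<1}" \<Omega> 0 x] cont by simp
qed

text \<open>
  Derivatives of test functions have mean zero, and every test function becomes such a derivative after
  subtracting its mean.
\<close>

lemma test_function_antiderivative:
  assumes "\<psi> \<in> torus_test_functions"
  obtains \<Psi> where "\<Psi> \<in> torus_test_functions" "\<And>x. deriv \<Psi> x = \<psi> x - (\<integral>y. \<psi> y \<partial>torus)"
proof -
  define c where "c = (\<integral>y. \<psi> y \<partial>torus)"
  have s: "smooth \<psi>" and per: "\<And>x. \<psi> (x + 1) = \<psi> x" using assms by (auto simp: torus_test_functions_def)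
  have cont: "continuous_on UNIV (\<lambda>x. \<psi> x - c)" by (intro continuous_intros smoothD s)
  then obtain \<Psi> where \<Psi>: "\<And>x. (\<Psi> has_real_derivative \<psi> x - c) (at x)"
    using continuous_antiderivative by blast
  have "smooth (\<lambda>x. \<psi> x - c)"
    unfolding smooth_def
  proof (intro allI)
    fix n x
    have d: "deriv (\<lambda>x. \<psi> x - c) = deriv \<psi>"
      by (intro ext DERIV_imp_deriv) (auto intro!: derivative_eq_intros smoothD(1)[OF s])
    show "(deriv ^^ n) (\<lambda>x. \<psi> x - c) differentiable at x"
    proof (cases n)
      case 0
      have "((\<lambda>x. \<psi> x - c) has_real_derivative deriv \<psi> x) (at x)"
        by (auto intro!: derivative_eq_intros smoothD(1)[OF s])
      then show ?thesis using 0 by (auto simp: real_differentiable_def)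
    next
      case (Suc k)
      then show ?thesis using smoothD(2)[OF s] d unfolding smooth_def
        by (simp only: funpow_Suc_right o_apply)
    qed
  qed
  then have "smooth \<Psi>" by (rule smooth_antiderivative[OF _ \<Psi>])
  moreover have "\<Psi> (x + 1) = \<Psi> x" for x
  proof -
    have "((\<lambda>x. \<Psi> (x + 1) - \<Psi> x) has_real_derivative 0) (at y)" for y
    proof -
      have "((\<lambda>x. \<Psi> (x + 1) - \<Psi> x) has_real_derivative (\<psi> (y + 1) - c) * 1 - (\<psi> y - c)) (at y)"
        by (intro DERIV_diff DERIV_chain2[OF \<Psi>] \<Psi>) (auto intro!: derivative_eq_intros)
      then show ?thesis by (simp add: per)
    qed
    then have "\<Psi> (x + 1) - \<Psi> x = \<Psi> (0 + 1) - \<Psi> 0" by (rule DERIV_isconst_all[rule_format])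
    also have "\<dots> = primitive (\<lambda>x. \<psi> x - c) 1"
      by (subst primitive_of_deriv[of \<Psi>])
         (use \<Psi> cont in \<open>auto intro: has_field_derivative_at_within continuous_on_subset\<close>)
    also have "\<dots> = 0"
      using integrable_continuous_torus[OF smoothD(3)[OF s]] by (simp add: c_def)
    finally show ?thesis by simp
  qed
  moreover have "deriv \<Psi> x = \<psi> x - c" for x by (rule DERIV_imp_deriv[OF \<Psi>])
  ultimately show ?thesis by (intro that[of \<Psi>]) (auto simp: torus_test_functions_def c_def)
qed

lemma test_function_facts:
  assumes "\<phi> \<in> torus_test_functions"
  shows "\<And>x. x \<in> {0..1} \<Longrightarrow> (\<phi> has_real_derivative deriv \<phi> x) (at x within {0..1})"
    and "continuous_on {0..1} \<phi>" and "continuous_on {0..1} (deriv \<phi>)" and "\<phi> 1 = \<phi> 0"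
proof -
  have s: "smooth \<phi>" and per: "\<phi> (0 + 1) = \<phi> 0"
    using assms unfolding torus_test_functions_def by blast+
  show "\<And>x. x \<in> {0..1} \<Longrightarrow> (\<phi> has_real_derivative deriv \<phi> x) (at x within {0..1})"
    by (rule has_field_derivative_at_within[OF smoothD(1)[OF s]])
  show "continuous_on {0..1} \<phi>" "continuous_on {0..1} (deriv \<phi>)" by (intro smoothD s)+
  show "\<phi> 1 = \<phi> 0" using per by simp
qed

lemma integral_mean_shift:
  fixes f \<psi> :: "real \<Rightarrow> real"
  assumes f: "integrable torus f" and \<psi>: "continuous_on {0..1} \<psi>"
  shows "(\<integral>x. (f x - (\<integral>y. f y \<partial>torus)) * \<psi> x \<partial>torus) = (\<integral>x. f x * (\<psi> x - (\<integral>y. \<psi> y \<partial>torus)) \<partial>torus)"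
proof -
  have i: "integrable torus (\<lambda>x. f x * \<psi> x)" "integrable torus \<psi>"
    by (rule integrable_mult_continuous_torus[OF f \<psi>], rule integrable_continuous_torus[OF \<psi>])
  have "(\<integral>x. (f x - c) * \<psi> x \<partial>torus) = (\<integral>x. f x * \<psi> x \<partial>torus) - c * (\<integral>x. \<psi> x \<partial>torus)" for c
    unfolding left_diff_distrib using i by simp
  moreover have "(\<integral>x. f x * (\<psi> x - d) \<partial>torus) = (\<integral>x. f x * \<psi> x \<partial>torus) - (\<integral>x. f x \<partial>torus) * d" for d
    unfolding right_diff_distrib using i f by simp
  ultimately show ?thesis by simp
qed

lemma test_by_parts:
  assumes v: "integrable torus v" "(\<integral>x. v x \<partial>torus) = 0" and \<phi>: "\<phi> \<in> torus_test_functions"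
  shows "(\<integral>x. primitive v x * deriv \<phi> x \<partial>torus) = - (\<integral>x. v x * \<phi> x \<partial>torus)"
proof -
  have "primitive (\<lambda>x. v x * \<phi> x) 1 = primitive v 1 * \<phi> 1 - primitive (\<lambda>x. primitive v x * deriv \<phi> x) 1"
    by (rule primitive_by_parts[OF v(1) test_function_facts(1,3)[OF \<phi>]]) auto
  then show ?thesis unfolding primitive_1 v(2) by simp
qed

text \<open>
  All interval integrals of \<open>\<omega>\<close> vanish, so the claim is Lebesgue's differentiation theorem.
\<close>

lemma AE_eq_0_of_primitive_eq_0:
  assumes \<omega>: "integrable torus \<omega>" and prim: "\<And>x. x \<in> {0..1} \<Longrightarrow> primitive \<omega> x = 0"
  shows "AE x in torus. \<omega> x = 0"
proof -
  define w where "w = (\<lambda>x. if x \<in> {0..1} then \<omega> x else 0)"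
  have int01: "\<omega> integrable_on {0..1}" by (rule torus_integrable_on[OF \<omega>])
  have Icc: "integral {a..b} \<omega> = 0" if ab: "0 \<le> a" "a \<le> b" "b \<le> 1" for a b
  proof -
    have "integral {0..a} \<omega> + integral {a..b} \<omega> = integral {0..b} \<omega>"
      by (rule Henstock_Kurzweil_Integration.integral_combine)
         (use ab integrable_subinterval_real[OF int01, of 0 b] in auto)
    moreover have "integral {0..a} \<omega> = 0" "integral {0..b} \<omega> = 0"
      using prim[of a] prim[of b] primitive_eq_integral[OF \<omega>, of a] primitive_eq_integral[OF \<omega>, of b] ab
      by auto
    ultimately show ?thesis by linarith
  qed
  have int0: "integral (cbox a b) w = 0" for a b
  proof -
    have "integral {a..b} w = integral ({a..b} \<inter> {0..1}) \<omega>"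
      unfolding w_def
      by (simp only: Henstock_Kurzweil_Integration.integral_restrict_Int Int_commute)
    also have "{a..b} \<inter> {0..1} = {max a 0..min b 1}" by auto
    also have "integral {max a 0..min b 1} \<omega> = 0"
    proof (cases "max a 0 \<le> min b 1")
      case True
      then show ?thesis by (intro Icc) auto
    next
      case False
      then have "{max a 0..min b 1} = {}" by simp
      then show ?thesis by (simp only: integral_empty)
    qed
    finally show ?thesis by simp
  qed
  have "w integrable_on UNIV"
    unfolding w_def by (simp only: integrable_restrict_UNIV int01)
  then have w_int: "w integrable_on cbox a b" for a b
    by (rule integrable_on_subcbox) auto
  obtain N where N: "negligible N"
    "\<And>x e. \<lbrakk>x \<notin> N; 0 < e\<rbrakk> \<Longrightarrow> \<exists>d>0. \<forall>h. 0 < h \<and> h < d \<longrightarrow>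
       norm (integral (cbox x (x + h *\<^sub>R One)) w /\<^sub>R h ^ DIM(real) - w x) < e"
    by (rule integrable_ccontinuous_explicit[OF w_int], rule that)
  have N': "\<exists>d>0::real. \<forall>h. 0 < h \<and> h < d \<longrightarrow> \<bar>w x\<bar> < e" if "x \<notin> N" "0 < e" for x e
    using N(2)[OF that]
    by (simp only: int0 scaleR_zero_right diff_0 real_norm_def abs_minus_cancel)
  have w0: "w x = 0" if x: "x \<notin> N" for x
  proof (rule ccontr)
    assume "w x \<noteq> 0"
    then have "0 < \<bar>w x\<bar>" by simp
    then obtain d :: real where "0 < d" and d: "\<forall>h. 0 < h \<and> h < d \<longrightarrow> \<bar>w x\<bar> < \<bar>w x\<bar>"
      using N'[OF x] by blast
    then show False using spec[OF d, of "d / 2"] by simp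
  qed
  have "N \<in> null_sets lebesgue" using N(1) by (simp add: negligible_iff_null_sets)
  then have "AE x in lebesgue. w x = 0"
    by (rule AE_I'[of N]) (use w0 in auto)
  then have "AE x in lebesgue. x \<in> {0..<1} \<longrightarrow> w x = 0" by eventually_elim simp
  then have "AE x in torus. w x = 0" by (simp add: AE_restrict_space_iff)
  with AE_space show ?thesis by eventually_elim (simp add: w_def)
qed

text \<open>
  The continuous primitive of \<open>\<omega>\<close> is, by parts, orthogonal to all derivatives of test functions. Up to a
  constant it is then orthogonal to all test functions, hence constant.
\<close>

lemma AE_eq_0_of_orthogonal:
  assumes \<omega>: "integrable torus \<omega>"
    and orth: "\<And>\<phi>. \<phi> \<in> torus_test_functions \<Longrightarrow> (\<integral>x. \<omega> x * \<phi> x \<partial>torus) = 0"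
  shows "AE x in torus. \<omega> x = 0"
proof (rule AE_eq_0_of_primitive_eq_0[OF \<omega>])
  define \<Omega> where "\<Omega> = primitive \<omega>"
  define c where "c = (\<integral>x. \<Omega> x \<partial>torus)"
  have c\<Omega>: "continuous_on {0..1} \<Omega>" unfolding \<Omega>_def by (rule continuous_on_primitive[OF \<omega>])
  have i\<Omega>: "integrable torus \<Omega>" by (rule integrable_continuous_torus[OF c\<Omega>])
  note one = trig_polynomials_test[OF generated_algebra.const[of 1]]
  have mean: "(\<integral>x. \<omega> x \<partial>torus) = 0" using orth[OF one] by simp
  have shifted: "\<Omega> x - c = 0" if "x \<in> {0..1}" for x
  proof (rule continuous_eq_0_of_orthogonal[OF _ _ that])
    show "continuous_on {0..1} (\<lambda>x. \<Omega> x - c)" by (intro continuous_intros c\<Omega>)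
    fix \<psi> assume \<psi>: "\<psi> \<in> torus_test_functions"
    obtain \<Psi> where \<Psi>: "\<Psi> \<in> torus_test_functions" "\<And>x. deriv \<Psi> x = \<psi> x - (\<integral>y. \<psi> y \<partial>torus)"
      using test_function_antiderivative[OF \<psi>] by blast
    have "(\<integral>x. (\<Omega> x - c) * \<psi> x \<partial>torus) = (\<integral>x. \<Omega> x * deriv \<Psi> x \<partial>torus)"
      unfolding c_def \<Psi>(2) by (rule integral_mean_shift[OF i\<Omega> test_function_facts(2)[OF \<psi>]])
    also have "\<dots> = 0" unfolding \<Omega>_def test_by_parts[OF \<omega> mean \<Psi>(1)] using orth[OF \<Psi>(1)] by simp
    finally show "(\<integral>x. (\<Omega> x - c) * \<psi> x \<partial>torus) = 0" .
  qed
  show "primitive \<omega> x = 0" if "x \<in> {0..1}" for x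
    using shifted[OF that] shifted[of 0] primitive_0[OF \<omega>] by (simp add: \<Omega>_def)
qed

text \<open>
  The difference between \<open>u\<close> and the primitive of \<open>v\<close> is orthogonal to all derivatives of test functions.
\<close>

lemma has_weak_deriv_imp_primitive:
  assumes "has_weak_deriv u v"
  obtains c where "(\<integral>x. v x \<partial>torus) = 0" "AE x in torus. u x = c + primitive v x"
proof -
  have iu: "integrable torus u" and iv: "integrable torus v"
    and wd: "\<And>\<phi>. \<phi> \<in> torus_test_functions \<Longrightarrow> (\<integral>x. u x * deriv \<phi> x \<partial>torus) = - (\<integral>x. v x * \<phi> x \<partial>torus)"
    using assms unfolding has_weak_deriv_def by blast+
  note one = trig_polynomials_test[OF generated_algebra.const[of 1]]
  have mean: "(\<integral>x. v x \<partial>torus) = 0" using wd[OF one] by simp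
  have iV: "integrable torus (primitive v)"
    by (rule integrable_continuous_torus[OF continuous_on_primitive[OF iv]])
  define w where "w = (\<lambda>x. u x - primitive v x)"
  have iw: "integrable torus w" unfolding w_def using iu iV by simp
  define c where "c = (\<integral>x. w x \<partial>torus)"
  have "AE x in torus. w x - c = 0"
  proof (rule AE_eq_0_of_orthogonal)
    show "integrable torus (\<lambda>x. w x - c)" using iw by simp
    fix \<psi> assume \<psi>: "\<psi> \<in> torus_test_functions"
    obtain \<Psi> where \<Psi>: "\<Psi> \<in> torus_test_functions" "\<And>x. deriv \<Psi> x = \<psi> x - (\<integral>y. \<psi> y \<partial>torus)"
      using test_function_antiderivative[OF \<psi>] by blast
    have "(\<integral>x. (w x - c) * \<psi> x \<partial>torus) = (\<integral>x. w x * deriv \<Psi> x \<partial>torus)"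
      unfolding c_def \<Psi>(2) by (rule integral_mean_shift[OF iw test_function_facts(2)[OF \<psi>]])
    also have "\<dots> = (\<integral>x. u x * deriv \<Psi> x \<partial>torus) - (\<integral>x. primitive v x * deriv \<Psi> x \<partial>torus)"
      unfolding w_def left_diff_distrib
      by (intro Bochner_Integration.integral_diff integrable_mult_continuous_torus iu iV
          test_function_facts(3)[OF \<Psi>(1)])
    also have "\<dots> = 0" using wd[OF \<Psi>(1)] test_by_parts[OF iv mean \<Psi>(1)] by simp
    finally show "(\<integral>x. (w x - c) * \<psi> x \<partial>torus) = 0" .
  qed
  then have "AE x in torus. u x = c + primitive v x" by eventually_elim (simp add: w_def)
  with mean show ?thesis by (rule that)
qed

lemma has_weak_deriv_of_primitive:
  assumes v: "integrable torus v" "(\<integral>x. v x \<partial>torus) = 0"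
    and U: "\<And>x. x \<in> {0..1} \<Longrightarrow> primitive v x = U x - U 0"
  shows "has_weak_deriv U v"
proof -
  have cU: "continuous_on {0..1} U" by (rule continuous_on_of_primitive[OF v(1) U])
  have "(\<integral>x. U x * deriv \<phi> x \<partial>torus) = - (\<integral>x. v x * \<phi> x \<partial>torus)"
    if \<phi>: "\<phi> \<in> torus_test_functions" for \<phi>
  proof -
    note \<phi>' = test_function_facts[OF \<phi>]
    have "(\<integral>x. U x * deriv \<phi> x \<partial>torus) = (\<integral>x. U 0 * deriv \<phi> x + primitive v x * deriv \<phi> x \<partial>torus)"
      by (rule Bochner_Integration.integral_cong) (auto simp: U algebra_simps)
    also have "\<dots> = U 0 * (\<integral>x. deriv \<phi> x \<partial>torus) + (\<integral>x. primitive v x * deriv \<phi> x \<partial>torus)"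
      by (subst Bochner_Integration.integral_add)
         (auto intro!: integrable_continuous_torus continuous_intros \<phi>' continuous_on_primitive v)
    also have "(\<integral>x. deriv \<phi> x \<partial>torus) = 0"
      using primitive_of_deriv[OF \<phi>'(1,3), of 1] \<phi>'(4) by simp
    finally show ?thesis using test_by_parts[OF v \<phi>] by simp
  qed
  then show ?thesis unfolding has_weak_deriv_def using v integrable_continuous_torus[OF cU] by blast
qed

lemma has_weak_deriv_cong_AE:
  assumes "has_weak_deriv u v" "AE x in torus. u x = u' x" "AE x in torus. v x = v' x"
    and m: "u' \<in> borel_measurable torus" "v' \<in> borel_measurable torus"
  shows "has_weak_deriv u' v'"
proof -
  have iu: "integrable torus u" and iv: "integrable torus v"
    using assms unfolding has_weak_deriv_def by blast+
  have iu': "integrable torus u'" "integrable torus v'"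
    by (rule integrable_cong_AE_imp[OF iu m(1) assms(2)], rule integrable_cong_AE_imp[OF iv m(2) assms(3)])
  have "(\<integral>x. u' x * deriv \<phi> x \<partial>torus) = - (\<integral>x. v' x * \<phi> x \<partial>torus)"
    if \<phi>: "\<phi> \<in> torus_test_functions" for \<phi>
  proof -
    have [measurable]: "\<phi> \<in> borel_measurable torus" "deriv \<phi> \<in> borel_measurable torus"
      by (intro continuous_measurable_torus test_function_facts[OF \<phi>])+
    have [measurable]: "u \<in> borel_measurable torus" "v \<in> borel_measurable torus"
      "u' \<in> borel_measurable torus" "v' \<in> borel_measurable torus" using iu iv m by auto
    have "(\<integral>x. u' x * deriv \<phi> x \<partial>torus) = (\<integral>x. u x * deriv \<phi> x \<partial>torus)"
      by (rule integral_cong_AE) (use assms(2) in auto)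
    moreover have "(\<integral>x. v' x * \<phi> x \<partial>torus) = (\<integral>x. v x * \<phi> x \<partial>torus)"
      by (rule integral_cong_AE) (use assms(3) in auto)
    ultimately show ?thesis using assms(1) \<phi> unfolding has_weak_deriv_def by simp
  qed
  then show ?thesis unfolding has_weak_deriv_def using iu' by blast
qed

lemma has_weak_deriv_unique:
  assumes 1: "has_weak_deriv u1 v1" and 2: "has_weak_deriv u2 v2" and eq: "AE x in torus. u1 x = u2 x"
  shows "AE x in torus. v1 x = v2 x"
proof -
  have i: "integrable torus u1" "integrable torus v1" "integrable torus u2" "integrable torus v2"
    using 1 2 unfolding has_weak_deriv_def by blast+
  then have 3: "has_weak_deriv u1 v2"
    by (intro has_weak_deriv_cong_AE[OF 2]) (use eq in \<open>auto elim: eventually_mono\<close>)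
  have "AE x in torus. v1 x - v2 x = 0"
  proof (rule AE_eq_0_of_orthogonal)
    show "integrable torus (\<lambda>x. v1 x - v2 x)" using i by simp
    fix \<phi> assume \<phi>: "\<phi> \<in> torus_test_functions"
    have "(\<integral>x. v1 x * \<phi> x \<partial>torus) = (\<integral>x. v2 x * \<phi> x \<partial>torus)"
      using 1 3 \<phi> unfolding has_weak_deriv_def by fastforce
    then show "(\<integral>x. (v1 x - v2 x) * \<phi> x \<partial>torus) = 0"
      using integrable_mult_continuous_torus[OF i(2) test_function_facts(2)[OF \<phi>]]
        integrable_mult_continuous_torus[OF i(4) test_function_facts(2)[OF \<phi>]]
      by (simp add: left_diff_distrib)
  qed
  then show ?thesis by simp
qed

section \<open>A smooth superlinear function adapted to an integrable function\<close>

text \<open>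
  The function \<open>hyp\<close> is convex, quadratic near \<open>0\<close> and asymptotic to \<open>|y| - 1\<close>. Its first derivative is
  \<open>hyp'\<close>, its second derivative is the cube of \<open>inv_hyp\<close>, and polynomials in \<open>hyp'\<close> and \<open>inv_hyp\<close> are closed
  under differentiation and bounded.
\<close>

definition hyp :: "real \<Rightarrow> real" where
  "hyp y = sqrt (1 + y\<^sup>2) - 1"

definition hyp' :: "real \<Rightarrow> real" where
  "hyp' y = y / sqrt (1 + y\<^sup>2)"

definition inv_hyp :: "real \<Rightarrow> real" where
  "inv_hyp y = 1 / sqrt (1 + y\<^sup>2)"

lemma sqrt_1_sq: "0 < sqrt (1 + y\<^sup>2)" "sqrt (1 + y\<^sup>2) * sqrt (1 + y\<^sup>2) = 1 + y\<^sup>2" for y :: real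
proof -
  have "0 < 1 + y\<^sup>2" using zero_le_power2[of y] by linarith
  then show "0 < sqrt (1 + y\<^sup>2)" "sqrt (1 + y\<^sup>2) * sqrt (1 + y\<^sup>2) = 1 + y\<^sup>2"
    by (rule real_sqrt_gt_zero, simp only: real_sqrt_mult_self abs_of_pos)
qed

lemma sqrt_1_sq_nonzero: "sqrt (1 + y\<^sup>2) \<noteq> 0" for y :: real
  using sqrt_1_sq(1)[of y] by linarith

lemma DERIV_sqrt_1_sq: "((\<lambda>y. sqrt (1 + y\<^sup>2)) has_real_derivative hyp' y) (at y)"
proof -
  have pos: "0 < 1 + y\<^sup>2" using zero_le_power2[of y] by linarith
  have "((\<lambda>y. 1 + y\<^sup>2) has_real_derivative 2 * y) (at y)"
    by (auto intro!: derivative_eq_intros)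
  then have "((\<lambda>y. sqrt (1 + y\<^sup>2)) has_real_derivative inverse (sqrt (1 + y\<^sup>2)) / 2 * (2 * y)) (at y)"
    using DERIV_chain2[of sqrt "inverse (sqrt (1 + y\<^sup>2)) / 2" "\<lambda>y. 1 + y\<^sup>2" y "2 * y" UNIV,
        OF DERIV_real_sqrt[OF pos]] by blast
  moreover have "inverse S / 2 * (2 * y) = y / S" if "S \<noteq> 0" for S
    using that by (simp add: field_simps)
  ultimately show ?thesis
    using sqrt_1_sq_nonzero[of y] unfolding hyp'_def by metis
qed

lemma DERIV_hyp: "(hyp has_real_derivative hyp' y) (at y)"
proof -
  have "((\<lambda>y. sqrt (1 + y\<^sup>2) - 1) has_real_derivative hyp' y - 0) (at y)"
    by (rule DERIV_diff[OF DERIV_sqrt_1_sq DERIV_const])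
  then show ?thesis by (simp only: hyp_def[abs_def] diff_0_right)
qed

lemma DERIV_inv_hyp: "(inv_hyp has_real_derivative (-1) * (hyp' y * (inv_hyp y * inv_hyp y))) (at y)"
proof -
  have "((\<lambda>y. 1 / sqrt (1 + y\<^sup>2)) has_real_derivative
      (0 * sqrt (1 + y\<^sup>2) - 1 * hyp' y) / (sqrt (1 + y\<^sup>2) * sqrt (1 + y\<^sup>2))) (at y)"
    by (rule DERIV_divide[OF DERIV_const DERIV_sqrt_1_sq sqrt_1_sq_nonzero])
  moreover have "(0 * S - 1 * p) / (S * S) = (-1) * (p * (1 / S * (1 / S)))" for S p :: real
    by simp
  ultimately show ?thesis by (simp only: inv_hyp_def[abs_def])
qed

lemma DERIV_hyp': "(hyp' has_real_derivative inv_hyp y * (inv_hyp y * inv_hyp y)) (at y)"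
proof -
  have "((\<lambda>y. y / sqrt (1 + y\<^sup>2)) has_real_derivative
      (1 * sqrt (1 + y\<^sup>2) - y * hyp' y) / (sqrt (1 + y\<^sup>2) * sqrt (1 + y\<^sup>2))) (at y)"
    by (rule DERIV_divide[OF DERIV_ident DERIV_sqrt_1_sq sqrt_1_sq_nonzero])
  moreover have "(1 * S - y * (y / S)) / (S * S) = 1 / S * (1 / S * (1 / S))"
    if "0 < S" "S * S = 1 + y\<^sup>2" for S
  proof -
    have "1 * S - y * (y / S) = 1 / S" using that by (simp add: field_simps power2_eq_square)
    then show ?thesis by simp
  qed
  from this[OF sqrt_1_sq]
  have "(1 * sqrt (1 + y\<^sup>2) - y * hyp' y) / (sqrt (1 + y\<^sup>2) * sqrt (1 + y\<^sup>2))
      = inv_hyp y * (inv_hyp y * inv_hyp y)"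
    unfolding hyp'_def inv_hyp_def .
  ultimately show ?thesis unfolding hyp'_def[abs_def] by (simp only:)
qed

lemma hyp_bounds:
  "0 \<le> hyp y" "hyp y \<le> \<bar>y\<bar>" "hyp y \<le> y\<^sup>2" "\<bar>y\<bar> - 1 \<le> hyp y"
  "\<bar>hyp' y\<bar> \<le> 1" "\<bar>hyp' y\<bar> \<le> \<bar>y\<bar>" "0 \<le> inv_hyp y" "inv_hyp y \<le> 1"
proof -
  have 1: "1 \<le> sqrt (1 + y\<^sup>2)" by simp
  then show "0 \<le> hyp y" by (simp add: hyp_def)
  have "sqrt (1 + y\<^sup>2) \<le> sqrt ((1 + \<bar>y\<bar>)\<^sup>2)"
    by (rule real_sqrt_le_mono) (simp add: power2_sum)
  then show "hyp y \<le> \<bar>y\<bar>" by (simp add: hyp_def)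
  have "sqrt (1 + y\<^sup>2) * 1 \<le> sqrt (1 + y\<^sup>2) * sqrt (1 + y\<^sup>2)"
    using 1 by (intro mult_left_mono) auto
  then show "hyp y \<le> y\<^sup>2" using sqrt_1_sq(2)[of y] by (simp add: hyp_def)
  have "sqrt (y\<^sup>2) \<le> sqrt (1 + y\<^sup>2)" by (rule real_sqrt_le_mono) simp
  then have ge: "\<bar>y\<bar> \<le> sqrt (1 + y\<^sup>2)" by simp
  then show "\<bar>y\<bar> - 1 \<le> hyp y" by (simp add: hyp_def)
  show "\<bar>hyp' y\<bar> \<le> 1" using ge sqrt_1_sq(1)[of y] by (simp add: hyp'_def abs_divide)
  show "\<bar>hyp' y\<bar> \<le> \<bar>y\<bar>"
    using mult_left_mono[OF 1 abs_ge_zero[of y]] sqrt_1_sq(1)[of y]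
    by (simp add: hyp'_def abs_divide field_simps)
  show "0 \<le> inv_hyp y" "inv_hyp y \<le> 1"
    unfolding inv_hyp_def using 1 sqrt_1_sq(1)[of y] by (auto simp only: divide_le_eq_1 zero_le_divide_1_iff less_imp_le)
qed

abbreviation hyp_polynomials :: "(real \<Rightarrow> real) set" where
  "hyp_polynomials \<equiv> generated_algebra {hyp', inv_hyp}"

lemma hyp_generators: "hyp' \<in> hyp_polynomials" "inv_hyp \<in> hyp_polynomials"
  by (rule generated_algebra.gen, simp)+

lemma hyp_polynomials_deriv:
  assumes "f \<in> hyp_polynomials"
  shows "\<exists>f'\<in>hyp_polynomials. \<forall>x. (f has_real_derivative f' x) (at x)"
proof (rule generated_algebra_deriv[OF assms])
  have mem: "(\<lambda>x. inv_hyp x * (inv_hyp x * inv_hyp x)) \<in> hyp_polynomials"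
    "(\<lambda>x. (-1) * (hyp' x * (inv_hyp x * inv_hyp x))) \<in> hyp_polynomials"
    by (intro generated_algebra_closed hyp_generators)+
  fix f assume "f \<in> {hyp', inv_hyp}"
  then consider "f = hyp'" | "f = inv_hyp" by fast
  then show "\<exists>f'\<in>hyp_polynomials. \<forall>x. (f has_real_derivative f' x) (at x)"
  proof cases
    case 1
    show ?thesis unfolding 1 by (rule bexI[OF _ mem(1)], rule allI, rule DERIV_hyp')
  next
    case 2
    show ?thesis unfolding 2 by (rule bexI[OF _ mem(2)], rule allI, rule DERIV_inv_hyp)
  qed
qed

lemma hyp_polynomials_bounded:
  assumes "f \<in> hyp_polynomials" shows "\<exists>C. \<forall>x. \<bar>f x\<bar> \<le> C"
  using assms
proof induction
  case (gen f)
  have "\<bar>inv_hyp x\<bar> \<le> 1" "\<bar>hyp' x\<bar> \<le> 1" for x using hyp_bounds(5,7,8)[of x] by auto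
  then show ?case using gen by blast
next
  case (add f g)
  then obtain C D where CD: "\<And>x. \<bar>f x\<bar> \<le> C" "\<And>x. \<bar>g x\<bar> \<le> D" by blast
  have "\<bar>f x + g x\<bar> \<le> C + D" for x using CD(1)[of x] CD(2)[of x] by linarith
  then show ?case by blast
next
  case (mult f g)
  then obtain C D where CD: "\<And>x. \<bar>f x\<bar> \<le> C" "\<And>x. \<bar>g x\<bar> \<le> D" by blast
  have "0 \<le> C" using CD(1)[of 0] by linarith
  then have "\<bar>f x * g x\<bar> \<le> C * D" for x unfolding abs_mult by (intro mult_mono CD) auto
  then show ?case by blast
qed auto

definition hyp_series :: "(nat \<Rightarrow> real) \<Rightarrow> (nat \<Rightarrow> real) \<Rightarrow> (real \<Rightarrow> real) \<Rightarrow> real \<Rightarrow> real" where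
  "hyp_series a c P x = (\<Sum>n. c n * P (x / a n))"

text \<open>
  The summand with scale \<open>a n\<close> is at most \<open>x\<^sup>2 / a n\<close>, and is at least \<open>|x| - a n\<close>. If the scales grow
  geometrically, the first bound gives convergence, and the second makes the sum grow faster than every
  multiple of \<open>|x|\<close>.
\<close>

definition hyp_sum :: "(nat \<Rightarrow> real) \<Rightarrow> real \<Rightarrow> real" where
  "hyp_sum a x = (\<Sum>n. a n * hyp (x / a n))"

context
  fixes a :: "nat \<Rightarrow> real"
  assumes a: "\<And>n. 2 ^ n \<le> a n"
begin

lemma scale_ge_1: "1 \<le> a n"
  using a[of n] one_le_power[of "2::real" n] by linarith

lemma inverse_scale_le: "1 / a n \<le> (1 / 2) ^ n"
proof -
  have "1 / a n \<le> 1 / 2 ^ n" using a[of n] scale_ge_1[of n] by (intro divide_left_mono mult_pos_pos) auto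
  then show ?thesis by (simp add: power_divide)
qed

lemma coefficient_div_scale_le:
  assumes "\<bar>c\<bar> \<le> B" shows "\<bar>c / a n\<bar> \<le> B"
proof -
  have "\<bar>c\<bar> / a n \<le> \<bar>c\<bar> / 1" using scale_ge_1[of n] by (intro divide_left_mono) auto
  then show ?thesis using assms scale_ge_1[of n] by (simp add: abs_divide)
qed

text \<open>
  Term-by-term differentiation stays within the class of such series, because it divides the coefficients
  by the scales, which are at least \<open>1\<close>.
\<close>

lemma hyp_series_deriv:
  assumes P: "P \<in> hyp_polynomials" and P': "P' \<in> hyp_polynomials"
    "\<And>x. (P has_real_derivative P' x) (at x)"
    and c: "\<And>n. \<bar>c n\<bar> \<le> (1 / 2) ^ n"
  shows "(hyp_series a c P has_real_derivative hyp_series a (\<lambda>n. c n / a n) P' x) (at x)"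
proof -
  have geo: "summable (\<lambda>n. C * (1 / 2) ^ n)" for C :: real
    by (intro summable_mult summable_geometric) simp
  obtain C where C: "\<And>x. \<bar>P x\<bar> \<le> C" using hyp_polynomials_bounded[OF P] by blast
  obtain D where D: "\<And>x. \<bar>P' x\<bar> \<le> D" using hyp_polynomials_bounded[OF P'(1)] by blast
  note ca = coefficient_div_scale_le[OF c]
  have "((\<lambda>x. \<Sum>n. c n * P (x / a n)) has_real_derivative (\<Sum>n. c n / a n * P' (x / a n))) (at x)"
  proof (rule has_field_derivative_series'(2)[where S=UNIV])
    fix n x
    have "((\<lambda>x. c n * P (x / a n)) has_real_derivative c n * (P' (x / a n) * (1 / a n))) (at x)"
      by (intro DERIV_cmult DERIV_chain2[OF P'(2)] DERIV_cdivide DERIV_ident)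
    then show "((\<lambda>x. c n * P (x / a n)) has_real_derivative c n / a n * P' (x / a n)) (at x within UNIV)"
      using scale_ge_1[of n] by (simp add: field_simps)
  next
    show "uniformly_convergent_on UNIV (\<lambda>n x. \<Sum>i<n. c i / a i * P' (x / a i))"
    proof (rule Weierstrass_m_test'[OF _ geo[of D]])
      fix n x
      have "norm (c n / a n * P' (x / a n)) \<le> (1 / 2) ^ n * D"
        unfolding real_norm_def abs_mult using ca[of n] D[of "x / a n"] by (intro mult_mono) auto
      then show "norm (c n / a n * P' (x / a n)) \<le> D * (1 / 2) ^ n" by (simp add: mult.commute)
    qed
    show "summable (\<lambda>n. c n * P (0 / a n))"
    proof (rule summable_comparison_test'[OF geo[of C]])
      fix n
      have "norm (c n * P (0 / a n)) \<le> (1 / 2) ^ n * C"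
        unfolding real_norm_def abs_mult using c[of n] C[of "0 / a n"] by (intro mult_mono) auto
      then show "norm (c n * P (0 / a n)) \<le> C * (1 / 2) ^ n" by (simp add: mult.commute)
    qed
  qed auto
  then show ?thesis by (simp add: hyp_series_def[abs_def])
qed

lemma hyp_series_smooth:
  assumes P: "P \<in> hyp_polynomials" and c: "\<And>n. \<bar>c n\<bar> \<le> (1 / 2) ^ n"
  shows "smooth (hyp_series a c P)"
proof (rule smooth_coinduct[where X = "{hyp_series a c P |c P. P \<in> hyp_polynomials \<and> (\<forall>n. \<bar>c n\<bar> \<le> (1 / 2) ^ n)}"])
  show "hyp_series a c P \<in> {hyp_series a c P |c P. P \<in> hyp_polynomials \<and> (\<forall>n. \<bar>c n\<bar> \<le> (1 / 2) ^ n)}"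
    using assms by blast
  fix f assume "f \<in> {hyp_series a c P |c P. P \<in> hyp_polynomials \<and> (\<forall>n. \<bar>c n\<bar> \<le> (1 / 2) ^ n)}"
  then obtain c P where f: "f = hyp_series a c P" "P \<in> hyp_polynomials" "\<And>n. \<bar>c n\<bar> \<le> (1 / 2) ^ n" by blast
  obtain P' where P': "P' \<in> hyp_polynomials" "\<And>x. (P has_real_derivative P' x) (at x)"
    using hyp_polynomials_deriv[OF f(2)] by blast
  have "hyp_series a (\<lambda>n. c n / a n) P' \<in> {hyp_series a c P |c P. P \<in> hyp_polynomials \<and> (\<forall>n. \<bar>c n\<bar> \<le> (1 / 2) ^ n)}"
    using P'(1) coefficient_div_scale_le[OF f(3)] by blast
  then show "\<exists>f'\<in>{hyp_series a c P |c P. P \<in> hyp_polynomials \<and> (\<forall>n. \<bar>c n\<bar> \<le> (1 / 2) ^ n)}.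
      \<forall>x. (f has_real_derivative f' x) (at x)"
    using hyp_series_deriv[OF f(2) P' f(3)] unfolding f(1) by blast
qed

lemma hyp_sum_facts:
  shows "smooth (hyp_sum a)" and "convex_on UNIV (hyp_sum a)"
    and "\<And>x. summable (\<lambda>n. a n * hyp (x / a n))"
    and "filterlim (\<lambda>x. hyp_sum a x / \<bar>x\<bar>) at_top at_infinity"
proof -
  have geo: "summable (\<lambda>n. C * (1 / 2) ^ n)" for C :: real
    by (intro summable_mult summable_geometric) simp
  define P where "P = (\<lambda>x. inv_hyp x * (inv_hyp x * inv_hyp x))"
  have P: "P \<in> hyp_polynomials" unfolding P_def by (intro generated_algebra_closed hyp_generators)
  have P0: "0 \<le> P y" "P y \<le> 1" for y
    unfolding P_def using hyp_bounds(7,8)[of y] by (auto intro!: mult_le_one)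
  have a0: "0 < a n" for n using scale_ge_1[of n] by linarith
  have ca: "\<bar>1 / a n\<bar> \<le> (1 / 2) ^ n" for n using inverse_scale_le[of n] a0[of n] by simp
  define \<Phi>' where "\<Phi>' = (\<lambda>x. \<Sum>n. hyp' (x / a n))"
  have s2: "smooth (hyp_series a (\<lambda>n. 1 / a n) P)" by (rule hyp_series_smooth[OF P ca])
  have le: "norm (1 / a n * P (x / a n)) \<le> 1 * (1 / 2) ^ n" for n x
  proof -
    have "\<bar>1 / a n\<bar> * \<bar>P (x / a n)\<bar> \<le> (1 / 2) ^ n * 1"
      using ca[of n] P0[of "x / a n"] by (intro mult_mono) auto
    then show ?thesis by (simp add: abs_mult)
  qed
  have d2: "(\<Phi>' has_real_derivative hyp_series a (\<lambda>n. 1 / a n) P x) (at x)" for x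
    unfolding \<Phi>'_def hyp_series_def
  proof (rule has_field_derivative_series'(2)[where S=UNIV])
    fix n x
    have "((\<lambda>x. hyp' (x / a n)) has_real_derivative P (x / a n) * (1 / a n)) (at x)"
      unfolding P_def by (intro DERIV_chain2[OF DERIV_hyp'] DERIV_cdivide DERIV_ident)
    then show "((\<lambda>x. hyp' (x / a n)) has_real_derivative 1 / a n * P (x / a n)) (at x within UNIV)"
      by (simp add: mult.commute)
  next
    show "uniformly_convergent_on UNIV (\<lambda>n x. \<Sum>i<n. 1 / a i * P (x / a i))"
      by (rule Weierstrass_m_test'[OF _ geo[of 1]]) (rule le)
    show "summable (\<lambda>n. hyp' (0 / a n))" by (simp add: hyp'_def)
  qed auto
  have sum0: "summable (\<lambda>n. a n * hyp (0 / a n))" by (simp add: hyp_def)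
  have d1: "summable (\<lambda>n. a n * hyp (x / a n))" "(hyp_sum a has_real_derivative \<Phi>' x) (at x)" for x
  proof -
    define R where "R = \<bar>x\<bar> + 1"
    have summand: "((\<lambda>x. a n * hyp (x / a n)) has_real_derivative hyp' (y / a n)) (at y within {-R..R})" for n y
    proof -
      have "((\<lambda>x. a n * hyp (x / a n)) has_real_derivative a n * (hyp' (y / a n) * (1 / a n))) (at y within {-R..R})"
        by (intro DERIV_cmult DERIV_chain2[OF DERIV_hyp] DERIV_cdivide DERIV_ident)
      then show ?thesis using a0[of n] by simp
    qed
    have unif: "uniformly_convergent_on {-R..R} (\<lambda>n x. \<Sum>i<n. hyp' (x / a i))"
    proof (rule Weierstrass_m_test'[OF _ geo[of R]])
      fix n y assume "y \<in> {-R..R}"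
      then have "\<bar>y\<bar> \<le> R" by auto
      have "\<bar>hyp' (y / a n)\<bar> \<le> \<bar>y\<bar> * (1 / a n)"
        using hyp_bounds(6)[of "y / a n"] a0[of n] by (simp add: abs_divide)
      also have "\<dots> \<le> R * (1 / 2) ^ n"
        using \<open>\<bar>y\<bar> \<le> R\<close> inverse_scale_le[of n] a0[of n] by (intro mult_mono) auto
      finally show "norm (hyp' (y / a n)) \<le> R * (1 / 2) ^ n" by simp
    qed
    have x: "x \<in> interior {-R..R}" by (auto simp: R_def)
    have 0: "0 \<in> {-R..R}" by (auto simp: R_def)
    show "summable (\<lambda>n. a n * hyp (x / a n))"
      by (rule has_field_derivative_series'(1)[OF _ summand unif 0 sum0 x]) auto
    show "(hyp_sum a has_real_derivative \<Phi>' x) (at x)"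
      unfolding hyp_sum_def[abs_def] \<Phi>'_def
      by (rule has_field_derivative_series'(2)[OF _ summand unif 0 sum0 x]) auto
  qed
  show "smooth (hyp_sum a)" by (rule smooth_antiderivative[OF smooth_antiderivative[OF s2 d2] d1(2)])
  show sums: "summable (\<lambda>n. a n * hyp (x / a n))" for x by (rule d1)
  have "0 \<le> hyp_series a (\<lambda>n. 1 / a n) P x" for x
    unfolding hyp_series_def
  proof (rule suminf_nonneg)
    show "summable (\<lambda>n. 1 / a n * P (x / a n))"
      by (rule summable_comparison_test'[OF geo[of 1] le])
  qed (use P0 a0 in \<open>simp add: less_imp_le\<close>)
  then have "\<Phi>' x \<le> \<Phi>' y" if "x \<le> y" for x y
    using d2 by (intro DERIV_nonneg_imp_nondecreasing[OF that]) blast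
  then show "convex_on UNIV (hyp_sum a)"
    by (intro convex_on_realI[of UNIV "hyp_sum a" \<Phi>'] d1(2)) auto
  show "filterlim (\<lambda>x. hyp_sum a x / \<bar>x\<bar>) at_top at_infinity"
    unfolding filterlim_at_top
  proof
    fix Z :: real
    obtain N where N: "Z + 1 \<le> real N" using real_arch_simple by blast
    define A where "A = (\<Sum>n<N. a n)"
    have A: "0 \<le> A" unfolding A_def using a0 by (intro sum_nonneg) (auto intro: less_imp_le)
    show "\<forall>\<^sub>F x in at_infinity. Z \<le> hyp_sum a x / \<bar>x\<bar>"
      unfolding eventually_at_infinity
    proof (intro exI allI impI)
      fix x :: real assume x: "A + 1 \<le> norm x"
      have "real N * \<bar>x\<bar> - A = (\<Sum>n<N. \<bar>x\<bar> - a n)"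
        by (simp add: A_def sum_subtractf)
      also have "\<dots> \<le> (\<Sum>n<N. a n * hyp (x / a n))"
      proof (rule sum_mono)
        fix n
        have "a n * (\<bar>x / a n\<bar> - 1) \<le> a n * hyp (x / a n)"
          by (rule mult_left_mono[OF hyp_bounds(4)]) (use a0[of n] in simp)
        then show "\<bar>x\<bar> - a n \<le> a n * hyp (x / a n)"
          using a0[of n] by (simp add: abs_divide right_diff_distrib)
      qed
      also have "\<dots> \<le> hyp_sum a x"
        unfolding hyp_sum_def
        by (rule sum_le_suminf[OF sums]) (auto intro!: mult_nonneg_nonneg less_imp_le[OF a0] hyp_bounds(1))
      finally have "real N * \<bar>x\<bar> - A \<le> hyp_sum a x" .
      moreover have "(Z + 1) * \<bar>x\<bar> \<le> real N * \<bar>x\<bar>" using N by (intro mult_right_mono) auto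
      ultimately have "Z * \<bar>x\<bar> \<le> hyp_sum a x" using x by (simp add: algebra_simps)
      then show "Z \<le> hyp_sum a x / \<bar>x\<bar>" using x A by (simp add: pos_le_divide_eq)
    qed
  qed
qed

end

text \<open>
  For each \<open>n\<close>, \<open>b * hyp (g / b)\<close> is dominated by \<open>|g|\<close> and tends to \<open>0\<close> pointwise as \<open>b\<close> tends to infinity. So the
  scale \<open>a n\<close> can be taken so large that the \<open>n\<close>-th summand of \<open>hyp_sum\<close> contributes at most \<open>2\<^sup>-\<^sup>n\<close> to the
  integral.
\<close>

lemma smooth_de_la_Vallee_Poussin:
  assumes g: "integrable torus g"
  shows "\<exists>\<Phi>. smooth \<Phi> \<and> convex_on UNIV \<Phi> \<and> filterlim (\<lambda>x. \<Phi> x / \<bar>x\<bar>) at_top at_infinity \<and>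
    integrable torus (\<lambda>x. \<Phi> (g x))"
proof -
  have [measurable]: "g \<in> borel_measurable torus" using g by auto
  have c_hyp: "continuous_on UNIV hyp"
    unfolding hyp_def by (intro continuous_intros)
  have hyp_meas: "(\<lambda>x. b * hyp (g x / b)) \<in> borel_measurable torus" for b
    using borel_measurable_continuous_onI[OF c_hyp] by measurable
  have i: "integrable torus (\<lambda>x. b * hyp (g x / b))" if "0 < b" for b
  proof (rule Bochner_Integration.integrable_bound[OF g hyp_meas])
    show "AE x in torus. norm (b * hyp (g x / b)) \<le> norm (g x)"
    proof (rule AE_I2)
      fix x
      have "b * hyp (g x / b) \<le> b * \<bar>g x / b\<bar>"
        by (rule mult_left_mono[OF hyp_bounds(2)]) (use that in simp)
      then show "norm (b * hyp (g x / b)) \<le> norm (g x)"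
        using that hyp_bounds(1)[of "g x / b"] by (simp add: abs_divide abs_mult)
    qed
  qed
  have "\<exists>b\<ge>2 ^ n. (\<integral>x. b * hyp (g x / b) \<partial>torus) \<le> (1 / 2) ^ n" for n
  proof -
    define b where "b = (\<lambda>k. real (Suc k))"
    have b: "0 < b k" for k by (simp add: b_def)
    have "(\<lambda>k. \<integral>x. b k * hyp (g x / b k) \<partial>torus) \<longlonglongrightarrow> (\<integral>x. 0 \<partial>torus)"
    proof (rule integral_dominated_convergence)
      show "integrable torus (\<lambda>x. \<bar>g x\<bar>)" using g by simp
      show "AE x in torus. norm (b k * hyp (g x / b k)) \<le> \<bar>g x\<bar>" for k
      proof (rule AE_I2)
        fix x
        have "b k * hyp (g x / b k) \<le> b k * \<bar>g x / b k\<bar>"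
          by (rule mult_left_mono[OF hyp_bounds(2)]) (use b[of k] in simp)
        then show "norm (b k * hyp (g x / b k)) \<le> \<bar>g x\<bar>"
          using b[of k] hyp_bounds(1)[of "g x / b k"] by (simp add: abs_divide abs_mult)
      qed
      show "AE x in torus. (\<lambda>k. b k * hyp (g x / b k)) \<longlonglongrightarrow> 0"
      proof (rule AE_I2)
        fix x
        show "(\<lambda>k. b k * hyp (g x / b k)) \<longlonglongrightarrow> 0"
        proof (rule tendsto_sandwich[OF _ _ tendsto_const])
          show "\<forall>\<^sub>F k in sequentially. 0 \<le> b k * hyp (g x / b k)"
            using b hyp_bounds(1) by (simp add: less_imp_le)
          have "b k * hyp (g x / b k) \<le> (g x)\<^sup>2 * inverse (real (Suc k))" for k
          proof -
            have "b k * hyp (g x / b k) \<le> b k * (g x / b k)\<^sup>2"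
              by (rule mult_left_mono[OF hyp_bounds(3)]) (use b[of k] in simp)
            also have "\<dots> = (g x)\<^sup>2 * inverse (b k)"
              using b[of k] by (simp add: power2_eq_square field_simps)
            finally show ?thesis by (simp add: b_def)
          qed
          then show "\<forall>\<^sub>F k in sequentially. b k * hyp (g x / b k) \<le> (g x)\<^sup>2 * inverse (real (Suc k))" by simp
          show "(\<lambda>k. (g x)\<^sup>2 * inverse (real (Suc k))) \<longlonglongrightarrow> 0"
            using tendsto_mult_right_zero[OF LIMSEQ_inverse_real_of_nat] by blast
        qed
      qed
    qed (use hyp_meas in auto)
    then have "(\<lambda>k. \<integral>x. b k * hyp (g x / b k) \<partial>torus) \<longlonglongrightarrow> 0" by simp
    then have "\<forall>\<^sub>F k in sequentially. (\<integral>x. b k * hyp (g x / b k) \<partial>torus) < (1 / 2) ^ n"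
      by (rule order_tendstoD) simp
    then obtain k0 where k0: "\<And>k. k0 \<le> k \<Longrightarrow> (\<integral>x. b k * hyp (g x / b k) \<partial>torus) < (1 / 2) ^ n"
      by (auto simp: eventually_sequentially)
    have "2 ^ n \<le> b (k0 + 2 ^ n)" by (simp add: b_def)
    then show ?thesis using k0[of "k0 + 2 ^ n"] by (intro exI[of _ "b (k0 + 2 ^ n)"]) auto
  qed
  then obtain a where a: "\<And>n. 2 ^ n \<le> a n" "\<And>n. (\<integral>x. a n * hyp (g x / a n) \<partial>torus) \<le> (1 / 2) ^ n"
    by metis
  note facts = hyp_sum_facts[OF a(1)]
  have a0: "0 < a n" for n using scale_ge_1[OF a(1), of n] by linarith
  define S where "S = (\<lambda>N x. \<Sum>n<N. a n * hyp (g x / a n))"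
  have "integrable torus (\<lambda>x. hyp_sum a (g x))"
  proof (rule integral_fatou(1)[of torus S])
    show "integrable torus (S N)" for N unfolding S_def using i[OF a0] by (intro Bochner_Integration.integrable_sum)
    show "AE x in torus. 0 \<le> S N x" for N
      unfolding S_def by (intro AE_I2 sum_nonneg mult_nonneg_nonneg less_imp_le[OF a0] hyp_bounds(1))
    show "AE x in torus. (\<lambda>N. S N x) \<longlonglongrightarrow> hyp_sum a (g x)"
      unfolding S_def hyp_sum_def by (intro AE_I2 summable_LIMSEQ facts(3))
    show "(\<lambda>x. hyp_sum a (g x)) \<in> borel_measurable torus"
      using borel_measurable_continuous_onI[OF smoothD(3)[OF facts(1)]] by measurable
    show "(\<integral>x. S N x \<partial>torus) \<le> 2" for N
    proof -
      have "(\<integral>x. S N x \<partial>torus) = (\<Sum>n<N. \<integral>x. a n * hyp (g x / a n) \<partial>torus)"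
        unfolding S_def using i[OF a0] by (intro Bochner_Integration.integral_sum)
      also have "\<dots> \<le> (\<Sum>n<N. (1 / 2) ^ n)" by (intro sum_mono a(2))
      also have "\<dots> \<le> (\<Sum>n. (1 / 2) ^ n)" by (rule sum_le_suminf) (auto simp: summable_geometric)
      also have "\<dots> = 2" by (simp add: suminf_geometric)
      finally show ?thesis .
    qed
  qed
  then show ?thesis using facts by blast
qed

section \<open>Uniqueness and existence of weak solutions\<close>

lemma weak_solution_dual_deriv:
  assumes u: "integrable torus u" and f: "integrable torus f" and \<xi>: "has_weak_deriv \<xi> \<xi>x"
    and eq: "\<And>\<phi>. \<phi> \<in> torus_test_functions \<Longrightarrow>
      (\<integral>x. (1 / h * (u x - f x) * \<phi> x + \<xi> x * deriv \<phi> x) \<partial>torus) = 0"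
  shows "has_weak_deriv \<xi> (\<lambda>x. (u x - f x) / h)"
proof -
  have i\<xi>: "integrable torus \<xi>" using \<xi> unfolding has_weak_deriv_def by blast
  have i: "integrable torus (\<lambda>x. (u x - f x) / h)" using u f by simp
  have "(\<integral>x. \<xi> x * deriv \<phi> x \<partial>torus) = - (\<integral>x. (u x - f x) / h * \<phi> x \<partial>torus)"
    if \<phi>: "\<phi> \<in> torus_test_functions" for \<phi>
  proof -
    have "(\<integral>x. (u x - f x) / h * \<phi> x \<partial>torus) + (\<integral>x. \<xi> x * deriv \<phi> x \<partial>torus)
        = (\<integral>x. (u x - f x) / h * \<phi> x + \<xi> x * deriv \<phi> x \<partial>torus)"
      by (intro Bochner_Integration.integral_add[symmetric] integrable_mult_continuous_torus i i\<xi>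
          test_function_facts[OF \<phi>])
    also have "\<dots> = 0" using eq[OF \<phi>] by simp
    finally show ?thesis by linarith
  qed
  then show ?thesis unfolding has_weak_deriv_def using i i\<xi> by blast
qed

lemma primitive_cong_AE:
  assumes "AE x in torus. r x = s x" "r \<in> borel_measurable torus" "s \<in> borel_measurable torus"
  shows "primitive r t = primitive s t"
proof -
  have "(\<lambda>y. indicator {0..t} y :: real) \<in> borel_measurable torus"
    by (intro borel_measurable_torusI) simp
  then show ?thesis
    unfolding primitive_def using assms by (intro integral_cong_AE) auto
qed

lemma has_weak_deriv_diff:
  assumes 1: "has_weak_deriv u1 v1" and 2: "has_weak_deriv u2 v2"
  shows "has_weak_deriv (\<lambda>x. u1 x - u2 x) (\<lambda>x. v1 x - v2 x)"
proof -
  have i: "integrable torus u1" "integrable torus v1" "integrable torus u2" "integrable torus v2"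
    using 1 2 unfolding has_weak_deriv_def by blast+
  have "(\<integral>x. (u1 x - u2 x) * deriv \<phi> x \<partial>torus) = - (\<integral>x. (v1 x - v2 x) * \<phi> x \<partial>torus)"
    if \<phi>: "\<phi> \<in> torus_test_functions" for \<phi>
  proof -
    note t = test_function_facts(2,3)[OF \<phi>]
    have "(\<integral>x. (u1 x - u2 x) * deriv \<phi> x \<partial>torus)
        = (\<integral>x. u1 x * deriv \<phi> x \<partial>torus) - (\<integral>x. u2 x * deriv \<phi> x \<partial>torus)"
      unfolding left_diff_distrib
      by (intro Bochner_Integration.integral_diff integrable_mult_continuous_torus i t)
    moreover have "(\<integral>x. (v1 x - v2 x) * \<phi> x \<partial>torus)
        = (\<integral>x. v1 x * \<phi> x \<partial>torus) - (\<integral>x. v2 x * \<phi> x \<partial>torus)"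
      unfolding left_diff_distrib
      by (intro Bochner_Integration.integral_diff integrable_mult_continuous_torus i t)
    moreover have "(\<integral>x. u1 x * deriv \<phi> x \<partial>torus) = - (\<integral>x. v1 x * \<phi> x \<partial>torus)"
      "(\<integral>x. u2 x * deriv \<phi> x \<partial>torus) = - (\<integral>x. v2 x * \<phi> x \<partial>torus)"
      using 1 2 \<phi> unfolding has_weak_deriv_def by blast+
    ultimately show ?thesis by linarith
  qed
  then show ?thesis unfolding has_weak_deriv_def using i by simp
qed

text \<open>
  With continuous representatives, integration by parts gives \<open>\<integral> p \<zeta> = -\<integral> w\<^sup>2 / h\<close>. For the differences \<open>w\<close> of
  two solutions and \<open>\<zeta>\<close> of their fluxes, monotonicity of the subdifferential makes the left side nonnegative.
\<close>

lemma monotone_flux_imp_eq_0: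
  assumes w: "has_weak_deriv w p" and \<zeta>: "has_weak_deriv \<zeta> (\<lambda>x. w x / h)" and h: "0 < h"
    and mono: "AE x in torus. 0 \<le> p x * \<zeta> x"
  shows "AE x in torus. w x = 0"
proof -
  have iw: "integrable torus w" and ip: "integrable torus p" and i\<zeta>: "integrable torus \<zeta>"
    using w \<zeta> unfolding has_weak_deriv_def by blast+
  obtain c where p0: "(\<integral>x. p x \<partial>torus) = 0" and w_ae: "AE x in torus. w x = c + primitive p x"
    by (rule has_weak_deriv_imp_primitive[OF w])
  obtain k where \<zeta>0: "(\<integral>x. w x / h \<partial>torus) = 0" and \<zeta>_ae: "AE x in torus. \<zeta> x = k + primitive (\<lambda>x. w x / h) x"
    by (rule has_weak_deriv_imp_primitive[OF \<zeta>])
  define V where "V = (\<lambda>x. c + primitive p x)"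
  have cV: "continuous_on {0..1} V" unfolding V_def by (intro continuous_intros continuous_on_primitive ip)
  have cVh: "continuous_on {0..1} (\<lambda>x. V x / h)" by (intro continuous_intros cV) (use h in auto)
  have iVh: "integrable torus (\<lambda>x. V x / h)" by (rule integrable_continuous_torus[OF cVh])
  have wm: "(\<lambda>x. w x / h) \<in> borel_measurable torus" using iw by auto
  have Vm: "(\<lambda>x. V x / h) \<in> borel_measurable torus" using iVh by auto
  have wV: "AE x in torus. w x / h = V x / h" using w_ae by eventually_elim (simp add: V_def)
  have prim_eq: "primitive (\<lambda>x. w x / h) t = primitive (\<lambda>x. V x / h) t" for t
    by (rule primitive_cong_AE[OF wV wm Vm])
  have V0: "(\<integral>x. V x / h \<partial>torus) = 0" using prim_eq[of 1] \<zeta>0 unfolding primitive_1 by linarith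
  define M where "M = (\<lambda>x. k + primitive (\<lambda>x. V x / h) x)"
  have dM: "(M has_real_derivative V x / h) (at x within {0..1})" if "x \<in> {0..1}" for x
    unfolding M_def using DERIV_add[OF DERIV_const deriv_of_primitive[OF cVh that]] by simp
  have cM: "continuous_on {0..1} M" by (rule DERIV_continuous_on) (rule dM)
  have "primitive (\<lambda>x. p x * M x) 1 = primitive p 1 * M 1 - primitive (\<lambda>x. primitive p x * (V x / h)) 1"
    by (rule primitive_by_parts[OF ip dM cVh]) auto
  then have "(\<integral>x. p x * M x \<partial>torus) = - (\<integral>x. primitive p x * (V x / h) \<partial>torus)"
    using p0 by simp
  also have "(\<integral>x. primitive p x * (V x / h) \<partial>torus) = (\<integral>x. (V x)\<^sup>2 / h - c * (V x / h) \<partial>torus)"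
  proof -
    have "primitive p x * (V x / h) = (V x)\<^sup>2 / h - c * (V x / h)" for x
    proof -
      have "primitive p x = V x - c" by (simp add: V_def)
      then show ?thesis by (simp add: power2_eq_square left_diff_distrib diff_divide_distrib)
    qed
    then show ?thesis by simp
  qed
  also have "\<dots> = (\<integral>x. (V x)\<^sup>2 / h \<partial>torus) - (\<integral>x. c * (V x / h) \<partial>torus)"
    by (intro Bochner_Integration.integral_diff integrable_continuous_torus continuous_intros cV cVh) (use h in auto)
  also have "(\<integral>x. c * (V x / h) \<partial>torus) = 0" using V0 by (simp only: integral_mult_right_zero)
  finally have "(\<integral>x. p x * M x \<partial>torus) = - (\<integral>x. (V x)\<^sup>2 / h \<partial>torus)" by simp
  moreover have "0 \<le> (\<integral>x. p x * M x \<partial>torus)"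
  proof (rule integral_nonneg_AE)
    show "AE x in torus. 0 \<le> p x * M x"
      using mono \<zeta>_ae by eventually_elim (simp add: M_def prim_eq)
  qed
  ultimately have le0: "(\<integral>x. (V x)\<^sup>2 / h \<partial>torus) \<le> 0" by linarith
  have V_zero: "V x = 0" if x: "x \<in> {0..1}" for x
  proof -
    have "(V x)\<^sup>2 / h = 0"
      by (rule continuous_eq_0_of_integral_le_0[OF _ _ le0 x])
         (use h in \<open>auto intro!: continuous_intros cV\<close>)
    then show ?thesis using h by simp
  qed
  show ?thesis
    using w_ae AE_space
  proof eventually_elim
    case (elim x)
    then show ?case using V_zero[of x] by (simp add: V_def)
  qed
qed

lemma weak_solution_unique:
  assumes h: "0 < h" and f: "integrable torus f"
    and u: "weak_solution W f h u" and v: "weak_solution W f h v"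
  shows "AE x in torus. u x = v x"
proof -
  obtain ux \<xi> \<xi>x where 1: "has_weak_deriv u ux" "has_weak_deriv \<xi> \<xi>x"
    "AE x in torus. \<xi> x \<in> subdifferential W (ux x)"
    "\<And>\<phi>. \<phi> \<in> torus_test_functions \<Longrightarrow> (\<integral>x. (1 / h * (u x - f x) * \<phi> x + \<xi> x * deriv \<phi> x) \<partial>torus) = 0"
    using u unfolding weak_solution_def by blast
  obtain vx \<zeta> \<zeta>x where 2: "has_weak_deriv v vx" "has_weak_deriv \<zeta> \<zeta>x"
    "AE x in torus. \<zeta> x \<in> subdifferential W (vx x)"
    "\<And>\<phi>. \<phi> \<in> torus_test_functions \<Longrightarrow> (\<integral>x. (1 / h * (v x - f x) * \<phi> x + \<zeta> x * deriv \<phi> x) \<partial>torus) = 0"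
    using v unfolding weak_solution_def by blast
  have iu: "integrable torus u" and iv: "integrable torus v"
    using 1(1) 2(1) unfolding has_weak_deriv_def by blast+
  have d: "has_weak_deriv (\<lambda>x. \<xi> x - \<zeta> x) (\<lambda>x. (u x - f x) / h - (v x - f x) / h)"
    by (intro has_weak_deriv_diff weak_solution_dual_deriv[OF iu f 1(2,4)]
        weak_solution_dual_deriv[OF iv f 2(2,4)])
  have "AE x in torus. u x - v x = 0"
  proof (rule monotone_flux_imp_eq_0[OF has_weak_deriv_diff[OF 1(1) 2(1)] _ h])
    have "(u x - f x) / h - (v x - f x) / h = (u x - v x) / h" for x
      by (simp add: diff_divide_distrib)
    with d show "has_weak_deriv (\<lambda>x. \<xi> x - \<zeta> x) (\<lambda>x. (u x - v x) / h)" by simp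
    show "AE x in torus. 0 \<le> (ux x - vx x) * (\<xi> x - \<zeta> x)"
      using 1(3) 2(3) by eventually_elim (rule subdifferential_monotone)
  qed
  then show ?thesis by simp
qed

text \<open>
  Continuing \<open>\<Phi>\<close> outside \<open>[-k, k]\<close> by its tangents at the end points keeps it convex and makes it Lipschitz.
\<close>

lemma convex_tangent_clamp:
  assumes sm: "smooth \<Phi>" and cv: "convex_on UNIV \<Phi>" and k: "0 \<le> k"
  defines "c \<equiv> \<lambda>x. max (- k) (min k x)"
  defines "\<psi> \<equiv> \<lambda>x. \<Phi> (c x) + deriv \<Phi> (c x) * (x - c x)"
  shows "convex_lipschitz_pair \<psi> (\<lambda>x. deriv \<Phi> (c x)) (\<bar>deriv \<Phi> (- k)\<bar> + \<bar>deriv \<Phi> k\<bar>)"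
    and "\<And>x. \<psi> x \<le> \<Phi> x" and "\<And>x. \<bar>x\<bar> \<le> k \<Longrightarrow> \<psi> x = \<Phi> x"
    and "\<And>x. \<Phi> 0 + deriv \<Phi> 0 * x \<le> \<psi> x"
proof -
  have tangent: "\<Phi> x + deriv \<Phi> x * (y - x) \<le> \<Phi> y" for x y
    using convex_on_imp_above_tangent[OF cv, of x y "deriv \<Phi> x"] smoothD(1)[OF sm] by simp
  have mono: "deriv \<Phi> x \<le> deriv \<Phi> y" if "x \<le> y" for x y
  proof (cases "x = y")
    case False
    have "deriv \<Phi> x * (y - x) \<le> deriv \<Phi> y * (y - x)"
      using tangent[of x y] tangent[of y x] by (simp add: algebra_simps)
    then show ?thesis using False that by simp
  qed simp
  have c_mono: "c x \<le> c y" if "x \<le> y" for x y using that by (auto simp: c_def)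
  have c_range: "- k \<le> c x" "c x \<le> k" for x using k by (auto simp: c_def)
  have sub: "\<psi> x + deriv \<Phi> (c x) * (y - x) \<le> \<psi> y" for x y
  proof -
    have "0 \<le> (deriv \<Phi> (c y) - deriv \<Phi> (c x)) * (y - c y)"
    proof -
      consider "y = c y" | "c y < y" "c y = k" | "y < c y" "c y = - k"
        using k unfolding c_def by linarith
      then show ?thesis
      proof cases
        case 2
        then have "deriv \<Phi> (c x) \<le> deriv \<Phi> (c y)" using c_range[of x] by (intro mono) auto
        then show ?thesis using 2 by simp
      next
        case 3
        then have "deriv \<Phi> (c y) \<le> deriv \<Phi> (c x)" using c_range[of x] by (intro mono) auto
        then show ?thesis using 3 by (intro mult_nonpos_nonpos) auto
      qed simp
    qed
    then show ?thesis using tangent[of "c x" "c y"] by (simp add: \<psi>_def algebra_simps)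
  qed
  have "continuous_on UNIV (\<lambda>x. deriv \<Phi> (c x))"
    by (rule continuous_on_compose2[OF smoothD(4)[OF sm, of UNIV]])
       (auto simp: c_def intro!: continuous_intros)
  moreover have "\<bar>deriv \<Phi> (c x)\<bar> \<le> \<bar>deriv \<Phi> (- k)\<bar> + \<bar>deriv \<Phi> k\<bar>" for x
    using mono[OF c_range(1)[of x]] mono[OF c_range(2)[of x]] by linarith
  moreover have "mono (\<lambda>x. deriv \<Phi> (c x))" by (intro monoI mono c_mono)
  ultimately show "convex_lipschitz_pair \<psi> (\<lambda>x. deriv \<Phi> (c x)) (\<bar>deriv \<Phi> (- k)\<bar> + \<bar>deriv \<Phi> k\<bar>)"
    unfolding convex_lipschitz_pair_def using sub by blast
  show "\<psi> x \<le> \<Phi> x" for x unfolding \<psi>_def by (rule tangent)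
  show "\<psi> x = \<Phi> x" if "\<bar>x\<bar> \<le> k" for x
  proof -
    have "c x = x" using that by (auto simp: c_def)
    then show ?thesis by (simp add: \<psi>_def)
  qed
  show "\<Phi> 0 + deriv \<Phi> 0 * x \<le> \<psi> x" for x
  proof -
    have "c 0 = 0" using k by (simp add: c_def)
    then show ?thesis using sub[of 0 x] by (simp add: \<psi>_def)
  qed
qed

text \<open>
  The tangent extensions of \<open>\<Phi>\<close> satisfy the estimate and converge to \<open>\<Phi>\<close>. To apply Fatou's lemma they are
  made nonnegative by subtracting the tangent of \<open>\<Phi>\<close> at \<open>0\<close>, whose integral is known because \<open>p\<close> has mean
  zero.
\<close>

lemma convex_estimate_of_lipschitz:
  assumes p: "integrable torus p" and p0: "(\<integral>x. p x \<partial>torus) = 0"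
    and est: "\<And>\<psi> \<psi>' B. convex_lipschitz_pair \<psi> \<psi>' B \<Longrightarrow> (\<integral>x. \<psi> (p x) \<partial>torus) \<le> (\<integral>x. \<psi> (g x) \<partial>torus)"
    and g: "integrable torus g"
    and sm: "smooth \<Phi>" and cv: "convex_on UNIV \<Phi>" and \<Phi>g: "integrable torus (\<lambda>x. \<Phi> (g x))"
  shows "integrable torus (\<lambda>x. \<Phi> (p x)) \<and> (\<integral>x. \<Phi> (p x) \<partial>torus) \<le> (\<integral>x. \<Phi> (g x) \<partial>torus)"
proof -
  define c where "c = (\<lambda>n x. max (- real n) (min (real n) x))"
  define \<psi> where "\<psi> = (\<lambda>n x. \<Phi> (c n x) + deriv \<Phi> (c n x) * (x - c n x))"
  have clamp: "convex_lipschitz_pair (\<psi> n) (\<lambda>x. deriv \<Phi> (c n x)) (\<bar>deriv \<Phi> (- real n)\<bar> + \<bar>deriv \<Phi> (real n)\<bar>)"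
    "\<psi> n x \<le> \<Phi> x" "\<bar>x\<bar> \<le> real n \<Longrightarrow> \<psi> n x = \<Phi> x" "\<Phi> 0 + deriv \<Phi> 0 * x \<le> \<psi> n x" for n x
    unfolding \<psi>_def c_def
    by (rule convex_tangent_clamp(1)[OF sm cv of_nat_0_le_iff],
        rule convex_tangent_clamp(2)[OF sm cv of_nat_0_le_iff],
        rule convex_tangent_clamp(3)[OF sm cv of_nat_0_le_iff], assumption,
        rule convex_tangent_clamp(4)[OF sm cv of_nat_0_le_iff])
  have i\<psi>: "integrable torus (\<lambda>x. \<psi> n (p x))" "integrable torus (\<lambda>x. \<psi> n (g x))" for n
    by (rule convex_lipschitz_pair_integrable[OF clamp(1) p], rule convex_lipschitz_pair_integrable[OF clamp(1) g])
  have le: "(\<integral>x. \<psi> n (p x) \<partial>torus) \<le> (\<integral>x. \<Phi> (g x) \<partial>torus)" for n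
  proof -
    have "(\<integral>x. \<psi> n (p x) \<partial>torus) \<le> (\<integral>x. \<psi> n (g x) \<partial>torus)" by (rule est[OF clamp(1)])
    also have "\<dots> \<le> (\<integral>x. \<Phi> (g x) \<partial>torus)" by (intro integral_mono i\<psi> \<Phi>g clamp(2))
    finally show ?thesis .
  qed
  define F where "F = (\<lambda>n x. \<psi> n (p x) - (\<Phi> 0 + deriv \<Phi> 0 * p x))"
  define G where "G = (\<lambda>x. \<Phi> (p x) - (\<Phi> 0 + deriv \<Phi> 0 * p x))"
  have i0: "integrable torus (\<lambda>x. \<Phi> 0 + deriv \<Phi> 0 * p x)"
    "(\<integral>x. \<Phi> 0 + deriv \<Phi> 0 * p x \<partial>torus) = \<Phi> 0"
    using p p0 by auto
  have pm: "p \<in> borel_measurable torus" using p by auto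
  have \<Phi>pm: "(\<lambda>x. \<Phi> (p x)) \<in> borel_measurable torus"
    by (rule measurable_compose[OF pm borel_measurable_continuous_onI[OF smoothD(3)[OF sm]]])
  have F_int: "integrable torus (F n)" for n
    unfolding F_def using i\<psi>(1) i0(1) by (intro Bochner_Integration.integrable_diff)
  have F_nonneg: "AE x in torus. 0 \<le> F n x" for n
    using clamp(4) by (intro AE_I2) (simp add: F_def)
  have F_lim: "AE x in torus. (\<lambda>n. F n x) \<longlonglongrightarrow> G x"
  proof (rule AE_I2)
    fix x
    obtain N where N: "\<bar>p x\<bar> \<le> real N" using real_arch_simple by blast
    have "\<forall>\<^sub>F n in sequentially. F n x = G x"
      using eventually_ge_at_top[of N]
    proof eventually_elim
      case (elim n)
      then have "\<bar>p x\<bar> \<le> real n" using N by linarith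
      then show ?case by (simp add: F_def G_def clamp(3))
    qed
    then show "(\<lambda>n. F n x) \<longlonglongrightarrow> G x" by (rule tendsto_eventually)
  qed
  have Gm: "G \<in> borel_measurable torus"
    unfolding G_def by (rule borel_measurable_diff[OF \<Phi>pm borel_measurable_integrable[OF i0(1)]])
  have F_le: "(\<integral>x. F n x \<partial>torus) \<le> (\<integral>x. \<Phi> (g x) \<partial>torus) - \<Phi> 0" for n
    unfolding F_def Bochner_Integration.integral_diff[OF i\<psi>(1) i0(1)] i0(2) using le[of n] by simp
  note G = integral_fatou[OF F_int F_nonneg F_lim Gm F_le]
  have "(\<lambda>x. \<Phi> (p x)) = (\<lambda>x. G x + (\<Phi> 0 + deriv \<Phi> 0 * p x))" by (simp add: G_def)
  then show ?thesis
    using G i0 Bochner_Integration.integral_add[of torus G "\<lambda>x. \<Phi> 0 + deriv \<Phi> 0 * p x"]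
      Bochner_Integration.integrable_add[of torus G "\<lambda>x. \<Phi> 0 + deriv \<Phi> 0 * p x"]
    by simp
qed

lemma weak_solution_exists:
  assumes W: "convex_on UNIV W" and W0: "0 \<in> subdifferential W 0"
    and K: "\<And>z p. z \<in> subdifferential W p \<Longrightarrow> \<bar>z\<bar> \<le> K" and h: "0 < h"
    and f: "has_weak_deriv f g"
  obtains u p where "weak_solution W f h u" "has_weak_deriv u p" "integrable torus p" "(\<integral>x. p x \<partial>torus) = 0"
    "\<And>\<psi> \<psi>' B. convex_lipschitz_pair \<psi> \<psi>' B \<Longrightarrow> (\<integral>x. \<psi> (p x) \<partial>torus) \<le> (\<integral>x. \<psi> (g x) \<partial>torus)"
proof -
  have g: "integrable torus g" and fi: "integrable torus f" using f unfolding has_weak_deriv_def by blast+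
  obtain c where g0: "(\<integral>x. g x \<partial>torus) = 0" and f_ae: "AE x in torus. f x = c + primitive g x"
    by (rule has_weak_deriv_imp_primitive[OF f])
  define F where "F = (\<lambda>x. c + primitive g x)"
  have F: "primitive g x = F x - F 0" for x using primitive_0[OF g] by (simp add: F_def)
  have cF: "continuous_on {0..1} F" unfolding F_def by (intro continuous_intros continuous_on_primitive g)
  obtain p U \<xi> where p: "integrable torus p" "(\<integral>x. p x \<partial>torus) = 0"
    and U: "\<And>x. x \<in> {0..1} \<Longrightarrow> primitive p x = U x - U 0"
    and \<eta>0: "(\<integral>x. (U x - F x) / h \<partial>torus) = 0"
    and \<xi>: "\<And>x. x \<in> {0..1} \<Longrightarrow> primitive (\<lambda>x. (U x - F x) / h) x = \<xi> x - \<xi> 0"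
    and sub: "AE x in torus. \<xi> x \<in> subdifferential W (p x)"
    and est: "\<And>\<psi> \<psi>' B. convex_lipschitz_pair \<psi> \<psi>' B \<Longrightarrow> (\<integral>x. \<psi> (p x) \<partial>torus) \<le> (\<integral>x. \<psi> (g x) \<partial>torus)"
    by (rule dual_problem_solvable[OF W W0 K h g g0 F]) blast+
  have cU: "continuous_on {0..1} U" by (rule continuous_on_of_primitive[OF p(1) U])
  define \<eta> where "\<eta> = (\<lambda>x. (U x - F x) / h)"
  have c\<eta>: "continuous_on {0..1} \<eta>" unfolding \<eta>_def by (intro continuous_intros cU cF) (use h in auto)
  have i\<eta>: "integrable torus \<eta>" by (rule integrable_continuous_torus[OF c\<eta>])
  have Up: "has_weak_deriv U p" by (rule has_weak_deriv_of_primitive[OF p U])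
  have \<xi>\<eta>: "has_weak_deriv \<xi> \<eta>"
    by (rule has_weak_deriv_of_primitive[OF i\<eta>]) (use \<eta>0 \<xi> in \<open>auto simp: \<eta>_def\<close>)
  have i\<xi>: "integrable torus \<xi>" using \<xi>\<eta> unfolding has_weak_deriv_def by blast
  have "AE x in torus. \<bar>\<xi> x\<bar> \<le> K" using sub by eventually_elim (rule K)
  then have "\<xi> \<in> L_infinity"
    unfolding L_infinity_def using i\<xi> by blast
  moreover have "\<eta> \<in> L_2"
    unfolding L_2_def
    by (auto intro!: integrable_continuous_torus continuous_intros c\<eta> continuous_measurable_torus)
  moreover have "(\<integral>x. (1 / h * (U x - f x) * \<phi> x + \<xi> x * deriv \<phi> x) \<partial>torus) = 0"
    if \<phi>: "\<phi> \<in> torus_test_functions" for \<phi>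
  proof -
    have m: "\<phi> \<in> borel_measurable torus" "deriv \<phi> \<in> borel_measurable torus"
      "U \<in> borel_measurable torus" "\<eta> \<in> borel_measurable torus" "\<xi> \<in> borel_measurable torus" "f \<in> borel_measurable torus"
      using i\<xi> fi by (auto intro!: continuous_measurable_torus test_function_facts[OF \<phi>] cU c\<eta>)
    have "(\<integral>x. (1 / h * (U x - f x) * \<phi> x + \<xi> x * deriv \<phi> x) \<partial>torus)
        = (\<integral>x. \<eta> x * \<phi> x + \<xi> x * deriv \<phi> x \<partial>torus)"
    proof (rule integral_cong_AE)
      show "AE x in torus. 1 / h * (U x - f x) * \<phi> x + \<xi> x * deriv \<phi> x = \<eta> x * \<phi> x + \<xi> x * deriv \<phi> x"
        using f_ae by eventually_elim (simp add: \<eta>_def F_def)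
    qed (use m in measurable)
    also have "\<dots> = (\<integral>x. \<eta> x * \<phi> x \<partial>torus) + (\<integral>x. \<xi> x * deriv \<phi> x \<partial>torus)"
      by (intro Bochner_Integration.integral_add integrable_mult_continuous_torus i\<eta> i\<xi> test_function_facts[OF \<phi>])
    also have "\<dots> = 0" using \<xi>\<eta> \<phi> unfolding has_weak_deriv_def by simp
    finally show ?thesis .
  qed
  ultimately have "weak_solution W f h U"
    unfolding weak_solution_def W11_def using Up \<xi>\<eta> sub by blast
  from that[OF this Up p est] show ?thesis .
qed

theorem theorem3p1:
  fixes W f :: "real \<Rightarrow> real" and Winf h :: real
  assumes "\<And>p. W (- p) = W p"
    and "convex_on UNIV W"
    and "((\<lambda>t. W t / t) \<longlongrightarrow> Winf) at_top"
    and "((\<lambda>t. W (- t) / t) \<longlongrightarrow> Winf) at_top"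
    and "Winf > 0"
    and "f \<in> W11"
    and "h > 0"
  shows "(\<exists>u. weak_solution W f h u \<and>
            (\<forall>v. weak_solution W f h v \<longrightarrow> (AE x in torus. v x = u x))) \<and>
         (\<forall>fx. has_weak_deriv f fx \<longrightarrow>
            (\<exists>\<Phi>. smooth \<Phi> \<and> convex_on UNIV \<Phi> \<and>
               filterlim (\<lambda>x. \<Phi> x / \<bar>x\<bar>) at_top at_infinity \<and>
               integrable torus (\<lambda>x. \<Phi> (fx x)))) \<and>
         (\<forall>u ux fx \<Phi>. weak_solution W f h u \<and> has_weak_deriv u ux \<and> has_weak_deriv f fx \<and>
            smooth \<Phi> \<and> convex_on UNIV \<Phi> \<and>
            filterlim (\<lambda>x. \<Phi> x / \<bar>x\<bar>) at_top at_infinity \<and>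
            integrable torus (\<lambda>x. \<Phi> (fx x)) \<longrightarrow>
            integrable torus (\<lambda>x. \<Phi> (ux x)) \<and>
            (\<integral>x. \<Phi> (ux x) \<partial>torus) \<le> (\<integral>x. \<Phi> (fx x) \<partial>torus))"
proof -
  have W0: "0 \<in> subdifferential W 0"
  proof -
    have "W 0 \<le> W q" for q
      using convex_onD[OF assms(2), of "1 / 2" q "- q"] assms(1)[of q] by simp
    then show ?thesis by (simp add: subdifferential_def)
  qed
  have K: "\<bar>z\<bar> \<le> Winf" if "z \<in> subdifferential W p" for z p
    by (rule subdifferential_bound[OF assms(3,4) that])
  have sol: "\<exists>u p. weak_solution W f h u \<and> has_weak_deriv u p \<and> integrable torus p \<and> (\<integral>x. p x \<partial>torus) = 0 \<and>
      (\<forall>\<psi> \<psi>' B. convex_lipschitz_pair \<psi> \<psi>' B \<longrightarrow> (\<integral>x. \<psi> (p x) \<partial>torus) \<le> (\<integral>x. \<psi> (g x) \<partial>torus))"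
    if "has_weak_deriv f g" for g
    by (rule weak_solution_exists[OF assms(2) W0 K assms(7) that]) blast+
  obtain g where g: "has_weak_deriv f g" using assms(6) unfolding W11_def by blast
  have fi: "integrable torus f" using g unfolding has_weak_deriv_def by blast
  note unique = weak_solution_unique[OF assms(7) fi]
  show ?thesis
  proof (intro conjI allI impI)
    obtain u where "weak_solution W f h u" using sol[OF g] by blast
    then show "\<exists>u. weak_solution W f h u \<and> (\<forall>v. weak_solution W f h v \<longrightarrow> (AE x in torus. v x = u x))"
      using unique by blast
  next
    fix fx assume "has_weak_deriv f fx"
    then have "integrable torus fx" unfolding has_weak_deriv_def by blast
    then show "\<exists>\<Phi>. smooth \<Phi> \<and> convex_on UNIV \<Phi> \<and>
               filterlim (\<lambda>x. \<Phi> x / \<bar>x\<bar>) at_top at_infinity \<and> integrable torus (\<lambda>x. \<Phi> (fx x))"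
      by (rule smooth_de_la_Vallee_Poussin)
  next
    fix u ux fx \<Phi>
    assume A: "weak_solution W f h u \<and> has_weak_deriv u ux \<and> has_weak_deriv f fx \<and>
            smooth \<Phi> \<and> convex_on UNIV \<Phi> \<and>
            filterlim (\<lambda>x. \<Phi> x / \<bar>x\<bar>) at_top at_infinity \<and>
            integrable torus (\<lambda>x. \<Phi> (fx x))"
    then have u: "weak_solution W f h u" "has_weak_deriv u ux" and fx: "has_weak_deriv f fx"
      and \<Phi>: "smooth \<Phi>" "convex_on UNIV \<Phi>" "integrable torus (\<lambda>x. \<Phi> (fx x))" by blast+
    obtain u' p where u': "weak_solution W f h u'" "has_weak_deriv u' p" "integrable torus p" "(\<integral>x. p x \<partial>torus) = 0"
      and est: "\<And>\<psi> \<psi>' B. convex_lipschitz_pair \<psi> \<psi>' B \<Longrightarrow> (\<integral>x. \<psi> (p x) \<partial>torus) \<le> (\<integral>x. \<psi> (fx x) \<partial>torus)"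
      using sol[OF fx] by blast
    have fxi: "integrable torus fx" using fx unfolding has_weak_deriv_def by blast
    have "integrable torus (\<lambda>x. \<Phi> (p x)) \<and> (\<integral>x. \<Phi> (p x) \<partial>torus) \<le> (\<integral>x. \<Phi> (fx x) \<partial>torus)"
      by (rule convex_estimate_of_lipschitz[OF u'(3,4) _ fxi \<Phi>]) (rule est)
    then have B: "integrable torus (\<lambda>x. \<Phi> (p x))" "(\<integral>x. \<Phi> (p x) \<partial>torus) \<le> (\<integral>x. \<Phi> (fx x) \<partial>torus)"
      by blast+
    have eq: "AE x in torus. p x = ux x"
      by (rule has_weak_deriv_unique[OF u'(2) u(2) unique[OF u'(1) u(1)]])
    have "integrable torus ux" using u(2) unfolding has_weak_deriv_def by blast
    then have m: "(\<lambda>x. \<Phi> (ux x)) \<in> borel_measurable torus"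
      by (intro measurable_compose[OF borel_measurable_integrable
            borel_measurable_continuous_onI[OF smoothD(3)[OF \<Phi>(1)]]])
    have eq': "AE x in torus. \<Phi> (p x) = \<Phi> (ux x)" using eq by eventually_elim simp
    show "integrable torus (\<lambda>x. \<Phi> (ux x))" by (rule integrable_cong_AE_imp[OF B(1) m eq'])
    have "(\<integral>x. \<Phi> (p x) \<partial>torus) = (\<integral>x. \<Phi> (ux x) \<partial>torus)"
      by (rule integral_cong_AE[OF borel_measurable_integrable[OF B(1)] m eq'])
    then show "(\<integral>x. \<Phi> (ux x) \<partial>torus) \<le> (\<integral>x. \<Phi> (fx x) \<partial>torus)" using B(2) by simp
  qed
qed

end
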